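(* Let $A,B,C,D$ be complex numbers with strictly positive real parts such that ($A,B$ are both real or $A=\bar B$) and ($C,D$ are both real or $C=\bar D$), labelled so that $\Re(A)\le\Re(B)$ and $\Re(C)\le\Re(D)$. Let $(Y_t)$ be the Markov process on the time interval $(-\Re(C),\Re(A))$ defined in the context, and let $\widetilde Y_t=Y_{t/2}+t^2/4$ for $-2\Re(C)<t<2\Re(A)$. Let $M>0$ be given by $$M^2=\frac{(A+C)(B+C)(A+D)(B+D)}{(A+B+C+D)^2(A+B+C+D+1)},$$ let $$\ell(t)=\frac{t(A+B)-(C+D)}{M(A+B+C+D)},\qquad m(t)=\frac{1+t}{M(A+B+C+D)},$$ and let $T'\subset(0,\infty)$ be the open interval that is the image of $(-2\Re(C),2\Re(A))$ under the map $t\mapsto\frac{t+C+D}{A+B-t}$. Then the process $$X_t=m(t)\left(\widetilde Y_{\ell(t)/m(t)}-\mathbb{E}\,\widetilde Y_{\ell(t)/m(t)}\right),\qquad t\in T',$$ is a quadratic harness on $T'$ with parameters $(\eta,\theta,\sigma,\tau,\gamma)$ determined by $$\eta+\theta=\frac{(A+B+C+D)^2}{\sqrt{(A+C)(B+C)(A+D)(B+D)(A+B+C+D+1)}},$$ $$\theta-\eta=\frac{(C-D)^2-(A-B)^2}{\sqrt{(A+C)(B+C)(A+D)(B+D)(A+B+C+D+1)}},$$ $$\sigma=\tau=\frac{1}{A+B+C+D+1},\qquad \gamma=1-2\sqrt{\sigma\tau}=\frac{A+B+C+D-1}{A+B+C+D+1}.$$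
   Context: Density. For $a,b,c,d$ that are positive real numbers, or come as one or two complex conjugate pairs with positive real parts (any remaining parameters being positive reals), define for $x>0$ $$f(x;a,b,c,d)=K(a,b,c,d)\,\frac{\left|\Gamma(a+i\sqrt{x})\Gamma(b+i\sqrt{x})\Gamma(c+i\sqrt{x})\Gamma(d+i\sqrt{x})\right|^2}{\sqrt{x}\,\left|\Gamma(2i\sqrt{x})\right|^2},$$ $$K(a,b,c,d)=\frac{\Gamma(a+b+c+d)}{4\pi\,\Gamma(a+b)\Gamma(a+c)\Gamma(b+c)\Gamma(a+d)\Gamma(b+d)\Gamma(c+d)} .$$ This is a probability density on $(0,\infty)$. Process. $(Y_t)$, $t\in(-\Re(C),\Re(A))$, is the Markov process with state space $(0,\infty)$ whose univariate laws have densities $f_t(x)=f(x;A-t,B-t,C+t,D+t)$ and whose transition probabilities (law of $Y_t$ given $Y_s=x$, $s<t$) have densities $f_{s,t}(y|x)=f(y;A-t,B-t,t-s+i\sqrt{x},t-s-i\sqrt{x})$; these are consistent (they satisfy the Chapman–Kolmogorov equations). Quadratic harness. A square-integrable process $(X_t)_{t\in T'}$ on an open interval $T'\subset(0,\infty)$ is a quadratic harness on $T'$ with parameters $(\eta,\theta,\sigma,\tau,\gamma)$ if for all $s,t\in T'$, $\mathbb{E}(X_t)=0$ and $\mathbb{E}(X_tX_s)=\min\{t,s\}$, and for all $s<t<u$ in $T'$, with $\mathcal{F}_{s,u}$ the $\sigma$-field generated by $\{X_r: r\in T',\ r\le s\text{ or } r\ge u\}$, $$\mathbb{E}(X_t|\mathcal{F}_{s,u})=\frac{u-t}{u-s}X_s+\frac{t-s}{u-s}X_u,$$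 $$\mathrm{Var}[X_t|\mathcal{F}_{s,u}]=\frac{(u-t)(t-s)}{u(1+\sigma s)+\tau-\gamma s}\Big(1+\eta\frac{uX_s-sX_u}{u-s}+\theta\frac{X_u-X_s}{u-s}+\sigma\frac{(uX_s-sX_u)^2}{(u-s)^2}+\tau\frac{(X_u-X_s)^2}{(u-s)^2}-(1-\gamma)\frac{(X_u-X_s)(uX_s-sX_u)}{(u-s)^2}\Big).$$ $\Re$ denotes the real part. *)

theory Defs
  imports "HOL-Probability.Probability"
begin

definition generated_field ::
    "'a measure \<Rightarrow> 'b measure \<Rightarrow> ('i \<Rightarrow> 'a \<Rightarrow> 'b) \<Rightarrow> 'i set \<Rightarrow> 'a measure" where
  "generated_field P S X R =
     sigma (space P) {X r -` B \<inter> space P | r B. r \<in> R \<and> B \<in> sets S}"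

definition cond_var :: "'a measure \<Rightarrow> 'a measure \<Rightarrow> ('a \<Rightarrow> real) \<Rightarrow> 'a \<Rightarrow> real" where
  "cond_var P F X = real_cond_exp P F (\<lambda>\<omega>. (X \<omega> - real_cond_exp P F X \<omega>)\<^sup>2)"

text \<open>
  Markov process \<open>Y\<close> on the time set \<open>T\<close> with state space \<open>S\<close>, univariate laws \<open>\<mu> t\<close> and
  transition probabilities \<open>\<kappa> s t x\<close> (the law of \<open>Y t\<close> given \<open>Y s = x\<close>). The Markov property
  is stated with respect to the natural filtration.
\<close>

definition markov_process ::
    "'a measure \<Rightarrow> 'b measure \<Rightarrow> real set \<Rightarrow> (real \<Rightarrow> 'b measure) \<Rightarrow>
     (real \<Rightarrow> real \<Rightarrow> 'b \<Rightarrow> 'b measure) \<Rightarrow> (real \<Rightarrow> 'a \<Rightarrow> 'b) \<Rightarrow> bool" where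
  "markov_process P S T \<mu> \<kappa> Y \<longleftrightarrow>
     prob_space P \<and>
     (\<forall>t\<in>T. Y t \<in> P \<rightarrow>\<^sub>M S \<and> distr P S (Y t) = \<mu> t) \<and>
     (\<forall>s\<in>T. \<forall>t\<in>T. s < t \<longrightarrow>
        (\<forall>B\<in>sets S. AE \<omega> in P.
           real_cond_exp P (generated_field P S Y {r\<in>T. r \<le> s})
             (\<lambda>\<omega>. indicator B (Y t \<omega>)) \<omega>
           = measure (\<kappa> s t (Y s \<omega>)) B))"

definition wilson_const :: "complex \<Rightarrow> complex \<Rightarrow> complex \<Rightarrow> complex \<Rightarrow> complex" where
  "wilson_const a b c d =
     Gamma (a + b + c + d) /
     (4 * complex_of_real pi * Gamma (a + b) * Gamma (a + c) * Gamma (b + c)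
        * Gamma (a + d) * Gamma (b + d) * Gamma (c + d))"

text \<open>
  When \<open>a\<close>, \<open>b\<close>, \<open>c\<close>, \<open>d\<close> are positive, or form one or two conjugate pairs with positive real
  parts (the remaining ones being positive), \<open>wilson_const a b c d\<close> is a real number, so that
  \<open>Re\<close> only changes its type.
\<close>

definition wilson_density :: "complex \<Rightarrow> complex \<Rightarrow> complex \<Rightarrow> complex \<Rightarrow> real \<Rightarrow> real" where
  "wilson_density a b c d x =
     Re (wilson_const a b c d) *
     (norm (Gamma (a + \<i> * complex_of_real (sqrt x)) * Gamma (b + \<i> * complex_of_real (sqrt x))
          * Gamma (c + \<i> * complex_of_real (sqrt x)) * Gamma (d + \<i> * complex_of_real (sqrt x))))\<^sup>2 /
     (sqrt x * (norm (Gamma (2 * \<i> * complex_of_real (sqrt x))))\<^sup>2)"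

definition pos_lborel :: "real measure" where
  "pos_lborel = restrict_space lborel {0<..}"

definition wilson_measure :: "complex \<Rightarrow> complex \<Rightarrow> complex \<Rightarrow> complex \<Rightarrow> real measure" where
  "wilson_measure a b c d = density pos_lborel (\<lambda>x. ennreal (wilson_density a b c d x))"

definition wilson_process ::
    "complex \<Rightarrow> complex \<Rightarrow> complex \<Rightarrow> complex \<Rightarrow> 'a measure \<Rightarrow> (real \<Rightarrow> 'a \<Rightarrow> real) \<Rightarrow> bool" where
  "wilson_process A B C D P Y \<longleftrightarrow>
     markov_process P pos_lborel {- Re C<..<Re A}
       (\<lambda>t. wilson_measure (A - complex_of_real t) (B - complex_of_real t)
              (C + complex_of_real t) (D + complex_of_real t))
       (\<lambda>s t x. wilson_measure (A - complex_of_real t) (B - complex_of_real t)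
              (complex_of_real (t - s) + \<i> * complex_of_real (sqrt x))
              (complex_of_real (t - s) - \<i> * complex_of_real (sqrt x)))
       Y"

definition quadratic_harness ::
    "'a measure \<Rightarrow> real set \<Rightarrow> (real \<Rightarrow> 'a \<Rightarrow> real) \<Rightarrow>
     real \<Rightarrow> real \<Rightarrow> real \<Rightarrow> real \<Rightarrow> real \<Rightarrow> bool" where
  "quadratic_harness P T X \<eta> \<theta> \<sigma> \<tau> \<gamma> \<longleftrightarrow>
     prob_space P \<and>
     open T \<and> is_interval T \<and> T \<noteq> {} \<and> T \<subseteq> {0<..} \<and>
     (\<forall>t\<in>T. X t \<in> borel_measurable P \<and> integrable P (\<lambda>\<omega>. (X t \<omega>)\<^sup>2)) \<and>
     (\<forall>t\<in>T. (\<integral>\<omega>. X t \<omega> \<partial>P) = 0) \<and>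
     (\<forall>s\<in>T. \<forall>t\<in>T. (\<integral>\<omega>. X t \<omega> * X s \<omega> \<partial>P) = min t s) \<and>
     (\<forall>s\<in>T. \<forall>t\<in>T. \<forall>u\<in>T. s < t \<longrightarrow> t < u \<longrightarrow>
        (let F = generated_field P borel X {r\<in>T. r \<le> s \<or> u \<le> r} in
          (AE \<omega> in P. real_cond_exp P F (X t) \<omega>
             = (u - t) / (u - s) * X s \<omega> + (t - s) / (u - s) * X u \<omega>) \<and>
          (AE \<omega> in P. cond_var P F (X t) \<omega>
             = (u - t) * (t - s) / (u * (1 + \<sigma> * s) + \<tau> - \<gamma> * s) *
               (1 + \<eta> * ((u * X s \<omega> - s * X u \<omega>) / (u - s))
                  + \<theta> * ((X u \<omega> - X s \<omega>) / (u - s))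
                  + \<sigma> * ((u * X s \<omega> - s * X u \<omega>)\<^sup>2 / (u - s)\<^sup>2)
                  + \<tau> * ((X u \<omega> - X s \<omega>)\<^sup>2 / (u - s)\<^sup>2)
                  - (1 - \<gamma>) * ((X u \<omega> - X s \<omega>) * (u * X s \<omega> - s * X u \<omega>) / (u - s)\<^sup>2)))))"

end

theory Submission
  imports Defs "HOL-Complex_Analysis.Complex_Analysis"
begin

text \<open>
  For four parameters \<open>a\<^sub>j\<close> with elementary symmetric functions \<open>e\<^sub>k\<close>, let \<open>w\<close> be the Wilson weight.
  The functions \<open>H s = sin (2 \<pi> s) (s (1 - s))\<^sup>k \<Prod>\<^sub>j \<Gamma>(a\<^sub>j + s) \<Gamma>(a\<^sub>j + 1 - s)\<close> are odd about
  \<open>s = 1/2\<close>, so shifting the line of integration from \<open>Re s = 0\<close> to \<open>Re s = 1\<close> shows that their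
  integrals vanish. For \<open>k = 0, 1\<close> this says that \<open>e\<^sub>1 y - e\<^sub>3\<close> and
  \<open>(1 + e\<^sub>1) y\<^sup>2 - (e\<^sub>2 + e\<^sub>3) y + e\<^sub>4\<close> are orthogonal to \<open>w\<close>, which gives the first two moments;
  the normalisation is never needed, because the laws of the process are assumed to be probability
  measures.

  The transition densities have the form \<open>g\<^sub>t(y) q\<^bsub>t-s\<^esub>(x,y) \<nu>(y) / g\<^sub>s(x)\<close> up to a constant, with
  \<open>q\<close> symmetric. Hence the law of \<open>Y\<^sub>t\<close> given past and future at \<open>s < t < u\<close> is the Wilson law with
  parameters \<open>t - s \<plusminus> \<i> sqrt Y\<^sub>s\<close>, \<open>u - t \<plusminus> \<i> sqrt Y\<^sub>u\<close>, and the moment relations give its mean and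
  variance as polynomials in \<open>Y\<^sub>s\<close> and \<open>Y\<^sub>u\<close>. The Moebius change of time turns these into the
  quadratic harness formulas.
\<close>

section \<open>Exponential decay of the Gamma function on vertical strips\<close>

text \<open>The shape of \<open>H\<close> comes from the weight. At s = iv, y = v^2, the weight is
  sinh(2 pi v) G(s) G(-s), where G(s) is the product of the Gamma(a_j + s), while \<open>H\<close>
  contains G(1 - s) = P(-s) G(-s) with P(s) the product of the a_j + s. The two contour values
  together leave the weight times an odd polynomial in s, and division by 2s gives the orthogonal
  polynomial in y. The factor (s (1 - s))^k raises the degree and respects the symmetry. Two
  obstacles shape the rest. The contour argument needs decay uniformly in a vertical strip: it is
  computed exactly on the line Re z = 1/2 by reflection, then moved to other lines by the functional
  equation and a monotonicity of |Gamma|. And the orthogonal polynomials change sign, whereas the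
  Markov property is iterated most easily for nonnegative functions: each relation is split into two
  nonnegative sides and carried as an equality of integrals in [0, infinity], and only at the end
  turned into real conditional expectations.\<close>

lemma norm_Gamma_ratio_mono:
  fixes z :: complex and r :: real
  assumes "0 < Re z" "Re z \<le> r"
  shows "norm (Gamma z) / Gamma (Re z) \<le> norm (Gamma (Complex r (Im z))) / Gamma r"
proof (rule LIMSEQ_le)
  \<comment> \<open>In Euler's limit the powers of n have equal modulus in numerator and
    denominator, so the quotient is a finite product of factors (x + k) / |x + k + iy|. Each factor
    increases with x, and the inequality passes to the limit. This carries a decay rate in y from
    one vertical line to the lines on its left in the right half-plane.\<close>
  let ?q = "\<lambda>w n. norm (Gamma_series w n) / Gamma_series (Re w) n"
  have lim: "?q w \<longlonglongrightarrow> norm (Gamma w) / Gamma (Re w)" if "Re w > 0" for w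
  proof -
    have "Gamma (Re w) \<noteq> 0"
      using Gamma_real_pos[OF that] by linarith
    then show ?thesis
      by (intro tendsto_intros)
  qed
  show "?q z \<longlonglongrightarrow> norm (Gamma z) / Gamma (Re z)"
    using lim[of z] assms by simp
  show "?q (Complex r (Im z)) \<longlonglongrightarrow> norm (Gamma (Complex r (Im z))) / Gamma r"
    using lim[of "Complex r (Im z)"] assms by simp
  have q: "?q w n = (\<Prod>k\<le>n. (Re w + k) / norm (w + of_nat k))" if "Re w > 0" for w n
    by (simp add: Gamma_series_def pochhammer_prod norm_mult norm_divide prod_norm[symmetric]
        prod_dividef atMost_atLeast0 atLeast0LessThan[symmetric] atLeastLessThanSuc_atLeastAtMost)
  have fac: "(Re z + k) / norm (z + of_nat k)
      \<le> (r + k) / norm (Complex r (Im z) + of_nat k)" for k :: nat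
  proof -
    let ?a = "Re z + k" and ?b = "r + k"
    have ab: "0 < ?a" "?a \<le> ?b"
      using assms by auto
    have n1: "norm (z + of_nat k) = sqrt (?a\<^sup>2 + (Im z)\<^sup>2)"
      "norm (Complex r (Im z) + of_nat k) = sqrt (?b\<^sup>2 + (Im z)\<^sup>2)"
      by (simp_all add: cmod_def)
    have "?a * sqrt (?b\<^sup>2 + (Im z)\<^sup>2) \<le> ?b * sqrt (?a\<^sup>2 + (Im z)\<^sup>2)"
    proof (rule power2_le_imp_le)
      have "?a\<^sup>2 \<le> ?b\<^sup>2"
        using ab by (intro power_mono) auto
      then have "?a\<^sup>2 * (Im z)\<^sup>2 \<le> ?b\<^sup>2 * (Im z)\<^sup>2"
        by (intro mult_right_mono) auto
      then show "(?a * sqrt (?b\<^sup>2 + (Im z)\<^sup>2))\<^sup>2 \<le> (?b * sqrt (?a\<^sup>2 + (Im z)\<^sup>2))\<^sup>2"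
        by (simp add: power_mult_distrib distrib_left mult.commute)
    qed (use ab in auto)
    moreover have "0 < sqrt (?a\<^sup>2 + (Im z)\<^sup>2)" "0 < sqrt (?b\<^sup>2 + (Im z)\<^sup>2)"
      using ab by (auto intro!: add_pos_nonneg)
    ultimately show ?thesis
      unfolding n1 by (simp add: divide_simps mult.commute)
  qed
  have "(\<Prod>k\<le>n. (Re z + k) / norm (z + of_nat k))
      \<le> (\<Prod>k\<le>n. (r + k) / norm (Complex r (Im z) + of_nat k))" for n :: nat
    using fac assms by (intro prod_mono) auto
  then show "\<exists>N. \<forall>n\<ge>N. ?q z n \<le> ?q (Complex r (Im z)) n"
    using assms by (subst q, simp, subst q) auto
qed

text \<open>Absorbs a linear factor into an exponential whose rate may be as small as desired; the
  price is the constant 1/c.\<close>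

lemma one_plus_le_exp:
  fixes c y :: real
  assumes "0 < c" "c \<le> 1" "0 \<le> y"
  shows "1 + y \<le> exp (c * y) / c"
proof -
  have "c * (1 + y) \<le> 1 + c * y"
    using assms by (simp add: algebra_simps)
  also have "\<dots> \<le> exp (c * y)"
    by (rule exp_ge_add_one_self)
  finally show ?thesis
    using assms by (simp add: field_simps)
qed

text \<open>On the line Re z = 1/2 conjugation coincides with z -> 1 - z, so the reflection formula
  evaluates |Gamma|^2 exactly. This is the seed of the decay estimates.\<close>

lemma norm_Gamma_half:
  "(norm (Gamma (Complex (1/2) y)))\<^sup>2 = pi / cosh (pi * y)"
proof -
  let ?z = "Complex (1/2) y"
  have c: "1 - ?z = cnj ?z"
    by (simp add: complex_eq_iff)
  have "complex_of_real ((norm (Gamma ?z))\<^sup>2) = Gamma ?z * Gamma (1 - ?z)"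
    unfolding c cnj_Gamma[symmetric] by (rule complex_norm_square)
  also have "\<dots> = of_real pi / sin (of_real pi * ?z)"
    by (rule Gamma_reflection_complex)
  also have "sin (of_real pi * ?z) = of_real (cosh (pi * y))"
  proof -
    have "of_real pi * ?z = of_real pi / 2 + \<i> * of_real (pi * y)"
      by (simp add: complex_eq_iff)
    then have "sin (of_real pi * ?z) = cos (\<i> * of_real (pi * y))"
      by (simp add: sin_add sin_of_real[symmetric] cos_of_real[symmetric] del: of_real_mult
          flip: sin_of_real cos_of_real)
    then show ?thesis
      by (simp add: cos_exp_eq cosh_def exp_of_real[symmetric] exp_minus field_simps)
  qed
  finally show ?thesis
    by (metis of_real_divide of_real_eq_iff)
qed

text \<open>The functional equation moves the estimate one unit to the right at the cost of a factor
  |z|, linear in |y|. A slightly better rate at level n pays for it, so the induction keeps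
  \<open>q\<close> arbitrary below pi / 2.\<close>

lemma norm_Gamma_half_integer_le:
  assumes "0 \<le> q" "q < pi / 2"
  shows "\<exists>C>0. \<forall>y. norm (Gamma (Complex (real n + 1/2) y)) \<le> C * exp (- q * \<bar>y\<bar>)"
  using assms
proof (induction n arbitrary: q)
  case 0
  have "norm (Gamma (Complex (1/2) y)) \<le> sqrt (2 * pi) * exp (- q * \<bar>y\<bar>)" for y
  proof (rule power2_le_imp_le)
    have "exp (pi * \<bar>y\<bar>) \<le> 2 * cosh (pi * y)"
      by (simp add: cosh_def abs_if)
    then have "pi / cosh (pi * y) \<le> 2 * pi * exp (- pi * \<bar>y\<bar>)"
      using cosh_real_pos[of "pi * y"] by (simp add: exp_minus field_simps)
    also have "\<dots> \<le> 2 * pi * exp (- (2 * q) * \<bar>y\<bar>)"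
      using 0 by (auto intro!: mult_right_mono)
    also have "\<dots> = (sqrt (2 * pi) * exp (- q * \<bar>y\<bar>))\<^sup>2"
      by (simp add: power_mult_distrib exp_double[symmetric] mult.assoc)
    finally show "(norm (Gamma (Complex (1/2) y)))\<^sup>2 \<le> (sqrt (2 * pi) * exp (- q * \<bar>y\<bar>))\<^sup>2"
      by (simp add: norm_Gamma_half)
  qed simp
  then show ?case
    by (intro exI[of _ "sqrt (2 * pi)"]) auto
next
  case (Suc n)
  \<comment> \<open>Half the remaining gap to pi / 2, so that \<open>q + c\<close> is still
    admissible for the induction hypothesis; the cap 1 is what \<open>one_plus_le_exp\<close>
    requires.\<close>
  define c where "c = min 1 ((pi / 2 - q) / 2)"
  have c: "0 < c" "c \<le> 1" "q + c < pi / 2"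
    using Suc.prems by (auto simp: c_def min_def field_simps)
  obtain K where K: "K > 0"
    "\<And>y. norm (Gamma (Complex (real n + 1/2) y)) \<le> K * exp (- (q + c) * \<bar>y\<bar>)"
    using Suc.IH[of "q + c"] c Suc.prems by auto
  have "norm (Gamma (Complex (real (Suc n) + 1/2) y)) \<le> (real n + 1) * K / c * exp (- q * \<bar>y\<bar>)"
    for y
  proof -
    let ?z = "Complex (real n + 1/2) y"
    have "?z \<noteq> 0"
      by (simp add: complex_eq_iff)
    moreover have "Complex (real (Suc n) + 1/2) y = ?z + 1"
      by (simp add: complex_eq_iff)
    moreover have "?z \<notin> \<int>\<^sub>\<le>\<^sub>0"
      by (auto elim!: nonpos_Ints_cases simp: complex_eq_iff)
    ultimately have "Gamma (Complex (real (Suc n) + 1/2) y) = ?z * Gamma ?z"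
      by (simp add: Gamma_plus1)
    then have "norm (Gamma (Complex (real (Suc n) + 1/2) y)) = norm ?z * norm (Gamma ?z)"
      by (simp add: norm_mult)
    also have "norm ?z \<le> (real n + 1) * (1 + \<bar>y\<bar>)"
    proof -
      have "norm ?z \<le> \<bar>real n + 1/2\<bar> + \<bar>y\<bar>"
        using cmod_le[of ?z] by simp
      also have "\<dots> \<le> (real n + 1) * (1 + \<bar>y\<bar>)"
        by (simp add: algebra_simps)
      finally show ?thesis .
    qed
    also have "1 + \<bar>y\<bar> \<le> exp (c * \<bar>y\<bar>) / c"
      using c by (intro one_plus_le_exp) auto
    also have "(real n + 1) * (exp (c * \<bar>y\<bar>) / c) * norm (Gamma ?z)
        \<le> (real n + 1) * (exp (c * \<bar>y\<bar>) / c) * (K * exp (- (q + c) * \<bar>y\<bar>))"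
      using c K by (intro mult_left_mono) auto
    also have "\<dots> = (real n + 1) * K / c * (exp (c * \<bar>y\<bar>) * exp (- (q + c) * \<bar>y\<bar>))"
      by simp
    also have "exp (c * \<bar>y\<bar>) * exp (- (q + c) * \<bar>y\<bar>) = exp (- q * \<bar>y\<bar>)"
      by (simp flip: exp_add add: algebra_simps)
    finally show ?thesis
      by (auto simp: mult_right_mono mult_left_mono)
  qed
  then show ?case
    using c K by (intro exI[of _ "(real n + 1) * K / c"]) auto
qed

text \<open>Compare with a line at a half-integer to the right of the strip; the real Gamma values
  over the compact interval are bounded. The rate 1 is a round number below pi / 2 that is large
  enough for the contour estimates.\<close>

lemma norm_Gamma_strip_le:
  assumes "0 < \<epsilon>"
  shows "\<exists>C>0. \<forall>z. \<epsilon> \<le> Re z \<longrightarrow> Re z \<le> R \<longrightarrow> norm (Gamma z) \<le> C * exp (- \<bar>Im z\<bar>)"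
proof -
  obtain n :: nat where n: "R \<le> n"
    using real_arch_simple by blast
  let ?r = "real n + 1/2"
  have "0 \<le> (1::real)" "1 < pi / 2"
    using pi_gt3 by auto
  from norm_Gamma_half_integer_le[OF this, of n]
  obtain K where K: "K > 0" "\<And>y. norm (Gamma (Complex ?r y)) \<le> K * exp (- \<bar>y\<bar>)"
    by auto
  have "continuous_on {\<epsilon>..R} (Gamma :: real \<Rightarrow> real)"
    using assms by (intro continuous_on_Gamma continuous_intros) (auto elim!: nonpos_Ints_cases)
  then have "bounded (Gamma ` {\<epsilon>..R})"
    by (intro compact_imp_bounded compact_continuous_image) auto
  then obtain L where L: "L > 0" "\<And>x. \<epsilon> \<le> x \<Longrightarrow> x \<le> R \<Longrightarrow> \<bar>Gamma x\<bar> \<le> L"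
    by (auto simp: bounded_pos)
  have G: "Gamma ?r > 0"
    by (intro Gamma_real_pos) auto
  have "norm (Gamma z) \<le> L * K / Gamma ?r * exp (- \<bar>Im z\<bar>)" if "\<epsilon> \<le> Re z" "Re z \<le> R" for z
  proof -
    have pos: "Gamma (Re z) > 0"
      using that assms by (intro Gamma_real_pos) auto
    have "norm (Gamma z) / Gamma (Re z) \<le> norm (Gamma (Complex ?r (Im z))) / Gamma ?r"
      using that assms n by (intro norm_Gamma_ratio_mono) auto
    also have "\<dots> \<le> K * exp (- \<bar>Im z\<bar>) / Gamma ?r"
      using G K by (intro divide_right_mono) auto
    finally have "norm (Gamma z) \<le> Gamma (Re z) * (K * exp (- \<bar>Im z\<bar>) / Gamma ?r)"
      using pos by (simp add: field_simps)
    also have "\<dots> \<le> L * (K * exp (- \<bar>Im z\<bar>) / Gamma ?r)"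
      using L(2)[of "Re z"] that G K by (intro mult_right_mono) auto
    finally show ?thesis
      by simp
  qed
  then show ?thesis
    using L K G by (intro exI[of _ "L * K / Gamma ?r"]) auto
qed

lemma power_le_exp:
  fixes n :: nat
  shows "\<exists>K>0. \<forall>y\<ge>0. (1 + y :: real) ^ n \<le> K * exp y"
proof -
  \<comment> \<open>With this choice the n-th power has rate n / (n + 1), below 1, and n = 0 causes
    no division by zero.\<close>
  let ?c = "1 / real (Suc n)"
  have "(1 + y) ^ n \<le> real (Suc n) ^ n * exp y" if "0 \<le> y" for y :: real
  proof -
    have "1 + y \<le> exp (?c * y) / ?c"
      using that by (intro one_plus_le_exp) auto
    then have "(1 + y) ^ n \<le> (exp (?c * y) / ?c) ^ n"
      using that by (intro power_mono) auto
    also have "\<dots> = real (Suc n) ^ n * exp (real n * (?c * y))"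
      by (simp add: power_mult_distrib mult.commute flip: exp_of_nat_mult)
    also have "real n * (?c * y) \<le> y"
      using that by (simp add: field_simps)
    finally show ?thesis
      by simp
  qed
  then show ?thesis
    by (intro exI[of _ "real (Suc n) ^ n"]) auto
qed

section \<open>Moments of Wilson weights by a contour shift\<close>

definition Gamma4 :: "complex \<Rightarrow> complex \<Rightarrow> complex \<Rightarrow> complex \<Rightarrow> complex \<Rightarrow> complex" where
  "Gamma4 a b c d s = Gamma (a + s) * Gamma (b + s) * Gamma (c + s) * Gamma (d + s)"

lemma norm_Gamma4_strip_le:
  assumes "Re a > 0" "Re b > 0" "Re c > 0" "Re d > 0"
  shows "\<exists>C>0. \<forall>s. 0 \<le> Re s \<longrightarrow> Re s \<le> 1 \<longrightarrow> norm (Gamma4 a b c d s) \<le> C * exp (- 4 * \<bar>Im s\<bar>)"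
proof -
  have one: "\<exists>C>0. \<forall>s. 0 \<le> Re s \<longrightarrow> Re s \<le> 1 \<longrightarrow> norm (Gamma (x + s)) \<le> C * exp (- \<bar>Im s\<bar>)"
    if "Re x > 0" for x
  proof -
    obtain C where C: "C > 0"
      "\<And>z. Re x \<le> Re z \<Longrightarrow> Re z \<le> Re x + 1 \<Longrightarrow> norm (Gamma z) \<le> C * exp (- \<bar>Im z\<bar>)"
      using norm_Gamma_strip_le[OF \<open>Re x > 0\<close>, of "Re x + 1"] by blast
    have "norm (Gamma (x + s)) \<le> C * exp \<bar>Im x\<bar> * exp (- \<bar>Im s\<bar>)"
      if "0 \<le> Re s" "Re s \<le> 1" for s
    proof -
      have "norm (Gamma (x + s)) \<le> C * exp (- \<bar>Im (x + s)\<bar>)"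
        using that by (intro C) auto
      also have "\<dots> \<le> C * exp (\<bar>Im x\<bar> + - \<bar>Im s\<bar>)"
        using C by (intro mult_left_mono) auto
      finally show ?thesis
        by (simp only: exp_add mult.assoc)
    qed
    then show ?thesis
      using C by (intro exI[of _ "C * exp \<bar>Im x\<bar>"]) auto
  qed
  obtain Ka Kb Kc Kd where K: "Ka > 0" "Kb > 0" "Kc > 0" "Kd > 0"
    "\<And>s. 0 \<le> Re s \<Longrightarrow> Re s \<le> 1 \<Longrightarrow> norm (Gamma (a + s)) \<le> Ka * exp (- \<bar>Im s\<bar>)"
    "\<And>s. 0 \<le> Re s \<Longrightarrow> Re s \<le> 1 \<Longrightarrow> norm (Gamma (b + s)) \<le> Kb * exp (- \<bar>Im s\<bar>)"
    "\<And>s. 0 \<le> Re s \<Longrightarrow> Re s \<le> 1 \<Longrightarrow> norm (Gamma (c + s)) \<le> Kc * exp (- \<bar>Im s\<bar>)"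
    "\<And>s. 0 \<le> Re s \<Longrightarrow> Re s \<le> 1 \<Longrightarrow> norm (Gamma (d + s)) \<le> Kd * exp (- \<bar>Im s\<bar>)"
    using one[OF assms(1)] one[OF assms(2)] one[OF assms(3)] one[OF assms(4)] by blast
  have "norm (Gamma4 a b c d s) \<le> Ka * Kb * Kc * Kd * exp (- 4 * \<bar>Im s\<bar>)"
    if "0 \<le> Re s" "Re s \<le> 1" for s
  proof -
    have "norm (Gamma4 a b c d s) \<le> (Ka * exp (- \<bar>Im s\<bar>)) * (Kb * exp (- \<bar>Im s\<bar>))
        * (Kc * exp (- \<bar>Im s\<bar>)) * (Kd * exp (- \<bar>Im s\<bar>))"
      unfolding Gamma4_def norm_mult using that K
      by (intro mult_mono mult_nonneg_nonneg) auto
    also have "\<dots> = Ka * Kb * Kc * Kd * exp (- \<bar>Im s\<bar>) ^ 4"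
      by (simp add: power4_eq_xxxx)
    also have "exp (- \<bar>Im s\<bar>) ^ 4 = exp (- 4 * \<bar>Im s\<bar>)"
      by (simp flip: exp_of_nat_mult)
    finally show ?thesis .
  qed
  then show ?thesis
    using K by (intro exI[of _ "Ka * Kb * Kc * Kd"]) auto
qed

lemma norm_sin_le_exp: "norm (sin z) \<le> exp \<bar>Im z\<bar>" for z :: complex
proof -
  have "norm (sin z) = norm (exp (\<i> * z) - inverse (exp (\<i> * z))) / 2"
    by (simp add: sin_exp_eq norm_divide norm_mult exp_minus)
  also have "\<dots> \<le> (exp (- Im z) + exp (Im z)) / 2"
    by (intro divide_right_mono order_trans[OF norm_triangle_ineq4])
      (auto simp: norm_inverse exp_minus)
  also have "\<dots> \<le> (exp \<bar>Im z\<bar> + exp \<bar>Im z\<bar>) / 2"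
    by (intro divide_right_mono add_mono) auto
  finally show ?thesis
    by simp
qed

text \<open>For conjugate pairs this is pi / 2 times the unnormalised density
  (\<open>wilson_weight_eq_kernel\<close>): reflection turns 1 / (v |Gamma(2iv)|^2) into a multiple
  of sinh(2 pi v), and the squared modulus of the four Gamma factors is a product of values at s and
  -s. Written without conjugates, it is accessible to complex analysis.\<close>

definition wilson_weight :: "complex \<Rightarrow> complex \<Rightarrow> complex \<Rightarrow> complex \<Rightarrow> real \<Rightarrow> complex" where
  "wilson_weight a b c d y = of_real (sinh (2 * pi * sqrt y)) *
     Gamma4 a b c d (\<i> * sqrt y) * Gamma4 a b c d (- (\<i> * sqrt y))"

lemma measurable_Gamma_complex [measurable]: "(Gamma :: complex \<Rightarrow> complex) \<in> borel_measurable borel"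
proof -
  have "(rGamma :: complex \<Rightarrow> complex) \<in> borel_measurable borel"
    by (intro borel_measurable_continuous_onI continuous_intros)
  then have "(\<lambda>z. inverse (rGamma z :: complex)) \<in> borel_measurable borel"
    by measurable
  then show ?thesis
    by (simp add: Gamma_def [abs_def])
qed

lemma measurable_wilson_weight [measurable]: "wilson_weight a b c d \<in> borel_measurable borel"
proof -
  have [measurable]: "(sinh :: real \<Rightarrow> real) \<in> borel_measurable borel"
    by (intro borel_measurable_continuous_onI continuous_intros)
  show ?thesis
    unfolding wilson_weight_def Gamma4_def by measurable
qed

lemma integrable_inverse_square: "set_integrable lborel {0<..} (\<lambda>y::real. 1 / (1 + y)\<^sup>2)"
proof -
  have "(\<integral>\<^sup>+y. ennreal (1 / (1 + y)\<^sup>2) * indicator {0..} y \<partial>lborel) = ennreal (0 - (- 1 / (1 + 0)))"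
  proof (rule nn_integral_FTC_atLeast)
    show "((\<lambda>y::real. - 1 / (1 + y)) \<longlongrightarrow> 0) at_top"
      by real_asymp
    show "((\<lambda>y. - 1 / (1 + y)) has_real_derivative 1 / (1 + y)\<^sup>2) (at y)" if "0 \<le> y" for y :: real
      using that by (auto intro!: derivative_eq_intros simp: power2_eq_square divide_simps)
  qed auto
  then have fin: "(\<integral>\<^sup>+y. ennreal (1 / (1 + y)\<^sup>2) * indicator {0..} y \<partial>lborel) < \<infinity>"
    by simp
  have eq: "ennreal (norm (indicator {0..} y * (1 / (1 + y)\<^sup>2)))
      = ennreal (1 / (1 + y)\<^sup>2) * indicator {0..} y" for y :: real
    by (simp add: indicator_def)
  have "set_integrable lborel {0..} (\<lambda>y::real. 1 / (1 + y)\<^sup>2)"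
    unfolding set_integrable_def real_scaleR_def
    by (rule integrableI_bounded) (measurable, simp only: eq fin)
  then show ?thesis
    by (rule set_integrable_subset) auto
qed

text \<open>The number 7 separates 2 pi from 8: sine and sinh grow like e^(2 pi v), eight Gamma
  factors decay like e^(-8v), and the product is then at most of order e^(-v).\<close>

lemma pi_less_7_halves: "pi < 7 / 2"
  using pi_approx by simp

lemma integrable_wilson_weight:
  assumes "Re a > 0" "Re b > 0" "Re c > 0" "Re d > 0"
  shows "set_integrable lborel {0<..} (\<lambda>y. of_real (y ^ k) * wilson_weight a b c d y)"
proof -
  obtain C where C: "C > 0"
    "\<And>s. 0 \<le> Re s \<Longrightarrow> Re s \<le> 1 \<Longrightarrow> norm (Gamma4 a b c d s) \<le> C * exp (- 4 * \<bar>Im s\<bar>)"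
    using norm_Gamma4_strip_le[OF assms] by blast
  \<comment> \<open>With y = v^2, the product y^k (1 + y)^2 is at most (1 + v)^(2k + 4); the factor
    (1 + y)^2 is what the dominating function 1 / (1 + y)^2 asks for.\<close>
  obtain K where K: "K > 0" "\<And>y::real. 0 \<le> y \<Longrightarrow> (1 + y) ^ (2 * k + 4) \<le> K * exp y"
    using power_le_exp[of "2 * k + 4"] by blast
  have bound: "norm (of_real (y ^ k) * wilson_weight a b c d y) \<le> K * C\<^sup>2 * (1 / (1 + y)\<^sup>2)" if "y > 0" for y
  proof -
    define v where "v = sqrt y"
    have v: "v > 0" "y = v\<^sup>2"
      using that by (auto simp: v_def)
    have "0 \<le> sinh (2 * pi * v)"
      using v by simp
    moreover have "sinh (2 * pi * v) \<le> exp (2 * pi * v)"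
      using sinh_less_cosh_real[of "2 * pi * v"] sinh_plus_cosh[of "2 * pi * v"] cosh_real_pos[of "2 * pi * v"]
      by linarith
    moreover have "exp (2 * pi * v) \<le> exp (7 * v)"
      using v pi_less_7_halves by simp
    ultimately have s: "\<bar>sinh (2 * pi * v)\<bar> \<le> exp (7 * v)"
      by linarith
    have "norm (wilson_weight a b c d y) \<le> exp (7 * v) * (C * exp (- 4 * v)) * (C * exp (- 4 * v))"
      unfolding wilson_weight_def norm_mult v_def[symmetric]
      using C(2)[of "\<i> * v"] C(2)[of "- (\<i> * v)"] s v C(1)
      by (intro mult_mono mult_nonneg_nonneg) auto
    also have "\<dots> = C\<^sup>2 * (exp (7 * v) * exp (- 4 * v) * exp (- 4 * v))"
      by (simp add: power2_eq_square)
    also have "exp (7 * v) * exp (- 4 * v) * exp (- 4 * v) = exp (- v)"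
      by (simp flip: exp_add)
    finally have w: "norm (wilson_weight a b c d y) \<le> C\<^sup>2 * exp (- v)" .
    have "y ^ k * (1 + y)\<^sup>2 \<le> ((1 + v)\<^sup>2) ^ k * ((1 + v)\<^sup>2)\<^sup>2"
      unfolding v using v(1)
      by (intro mult_mono power_mono) (auto simp: power2_eq_square algebra_simps)
    also have "\<dots> = (1 + v) ^ (2 * k + 4)"
      by (simp add: power_add flip: power_mult)
    also have "\<dots> \<le> K * exp v"
      using v by (intro K) auto
    finally have "y ^ k * (1 + y)\<^sup>2 * exp (- v) \<le> K * exp v * exp (- v)"
      by (intro mult_right_mono) auto
    then have yk: "y ^ k * (1 + y)\<^sup>2 * exp (- v) \<le> K"
      by (simp only: mult.assoc flip: exp_add) simp
    have "norm (of_real (y ^ k) * wilson_weight a b c d y) \<le> y ^ k * (C\<^sup>2 * exp (- v))"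
      unfolding norm_mult using w that by (auto simp: norm_power intro!: mult_left_mono)
    also have "\<dots> = C\<^sup>2 * (y ^ k * (1 + y)\<^sup>2 * exp (- v)) * (1 / (1 + y)\<^sup>2)"
      using that by simp
    also have "\<dots> \<le> C\<^sup>2 * K * (1 / (1 + y)\<^sup>2)"
      using yk by (intro mult_right_mono mult_left_mono) auto
    finally show ?thesis
      by (simp add: mult.commute)
  qed
  show ?thesis
  proof (rule set_integrable_bound)
    show "set_integrable lborel {0<..} (\<lambda>y. K * C\<^sup>2 * (1 / (1 + y)\<^sup>2))"
      using integrable_inverse_square by (rule set_integrable_mult_right) 
    show "AE y in lborel. y \<in> {0<..} \<longrightarrow>
        norm (of_real (y ^ k) * wilson_weight a b c d y) \<le> norm (K * C\<^sup>2 * (1 / (1 + y)\<^sup>2))"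
      using bound order_trans[OF _ abs_ge_self] by (intro AE_I2) (auto simp only: greaterThan_iff real_norm_def)
  qed (simp add: set_borel_measurable_def)
qed

text \<open>
  A primitive of \<open>H\<close> on the strip replaces the contour, and \<open>s = \<i> * sqrt y\<close> gives the
  integration variable \<open>y\<close>.
\<close>

lemma wilson_contour_shift:
  fixes k :: nat
  assumes "Re a > 0" "Re b > 0" "Re c > 0" "Re d > 0"
  defines "H \<equiv> \<lambda>s. sin (2 * of_real pi * s) * (s * (1 - s)) ^ k * Gamma4 a b c d s * Gamma4 a b c d (1 - s)"
  defines "f \<equiv> \<lambda>y. (H (\<i> * sqrt y) + H (- (\<i> * sqrt y))) * (\<i> / (2 * sqrt y))"
  assumes "set_integrable lborel {0<..} f"
  shows "(LINT y:{0<..}|lborel. f y) = 0"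
proof -
  \<comment> \<open>The poles coming from \<open>Gamma4\<close> at s lie at Re s <= -\<epsilon>,
    those coming from 1 - s at Re s >= 1 + \<epsilon>. The open strip between them contains both
    contours and is invariant under s -> 1 - s.\<close>
  define \<epsilon> where "\<epsilon> = min (min (Re a) (Re b)) (min (Re c) (Re d))"
  have \<epsilon>: "\<epsilon> > 0" "\<epsilon> \<le> Re a" "\<epsilon> \<le> Re b" "\<epsilon> \<le> Re c" "\<epsilon> \<le> Re d"
    using assms(1-4) by (auto simp: \<epsilon>_def)
  define S where "S = {s. - \<epsilon> < Re s} \<inter> {s. Re s < 1 + \<epsilon>}"
  have S: "open S" "convex S"
    unfolding S_def
    by (auto intro!: open_Int convex_Int open_halfspace_Re_gt open_halfspace_Re_lt
        convex_halfspace_Re_gt convex_halfspace_Re_lt)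
  have Sr: "1 - s \<in> S \<longleftrightarrow> s \<in> S" for s
    by (auto simp: S_def)
  have nonpole: "z \<notin> \<int>\<^sub>\<le>\<^sub>0" if "Re z > 0" for z :: complex
    using that by (auto elim!: nonpos_Ints_cases)
  have holo: "H holomorphic_on S"
    unfolding H_def Gamma4_def using \<epsilon>
    by (intro holomorphic_intros) (auto simp: S_def intro!: nonpole)
  obtain \<Phi> where \<Phi>': "\<And>s. s \<in> S \<Longrightarrow> (\<Phi> has_field_derivative H s) (at s within S)"
    using holomorphic_convex_primitive'[OF S(2,1) holo] by blast
  then have \<Phi>: "(\<Phi> has_field_derivative H s) (at s)" if "s \<in> S" for s
    using that S at_within_open by metis
  have refl: "H (1 - s) = - H s" for s
  proof -
    have "2 * of_real pi * (1 - s) = 2 * of_real pi - 2 * of_real pi * s"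
      by (simp add: algebra_simps)
    then have "sin (2 * of_real pi * (1 - s)) = - sin (2 * of_real pi * s)"
      by (simp add: sin_diff)
    then show ?thesis
      by (simp add: H_def mult_ac)
  qed
  \<comment> \<open>A primitive of a function odd about 1/2 is even about 1/2: the difference has
    derivative 0, and it vanishes at the fixed point 1/2.\<close>
  have "\<exists>c. \<forall>s\<in>S. \<Phi> (1 - s) - \<Phi> s = c"
  proof (rule has_field_derivative_zero_constant[OF S(2)])
    fix s assume s: "s \<in> S"
    have "((\<lambda>s. \<Phi> (1 - s) - \<Phi> s) has_field_derivative H (1 - s) * (- 1) - H s) (at s)"
      using s Sr[of s]
      by (auto intro!: derivative_eq_intros DERIV_chain2[of \<Phi>] \<Phi>)
    then show "((\<lambda>s. \<Phi> (1 - s) - \<Phi> s) has_field_derivative 0) (at s within S)"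
      by (simp add: refl has_field_derivative_at_within)
  qed
  then obtain c0 where c0: "\<And>s. s \<in> S \<Longrightarrow> \<Phi> (1 - s) - \<Phi> s = c0"
    by blast
  have "1 / 2 \<in> S"
    using \<epsilon> by (auto simp: S_def)
  then have "c0 = 0"
    using c0[of "1/2"] by simp
  then have sym: "\<Phi> (1 - s) = \<Phi> s" if "s \<in> S" for s
    using c0[OF that] by simp
  \<comment> \<open>The integral of \<open>H\<close> along the horizontal segment from 1 + iv to iv,
    v = sqrt y. Its derivative in y is \<open>f\<close>, since oddness turns H(1 + iv) into -H(-iv).
    It tends to 0 at infinity by decay, and at 0 because the primitive takes equal values at 0 and
    1.\<close>
  define F where "F = (\<lambda>y. \<Phi> (\<i> * sqrt y) - \<Phi> (1 + \<i> * sqrt y))"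
  have inS: "\<i> * of_real v \<in> S" "1 + \<i> * of_real v \<in> S" for v
    using \<epsilon> by (auto simp: S_def)
  have deriv: "(F has_vector_derivative f y) (at y)" if "y > 0" for y
  proof -
    have sq: "((\<lambda>y. \<i> * of_real (sqrt y)) has_vector_derivative \<i> / (2 * sqrt y)) (at y)"
      using that
      by (auto intro!: derivative_eq_intros has_vector_derivative_of_real
          simp: has_real_derivative_iff_has_vector_derivative[symmetric] divide_simps)
    have "((\<Phi> \<circ> (\<lambda>y. \<i> * of_real (sqrt y))) has_vector_derivative
        (\<i> / (2 * sqrt y)) * H (\<i> * of_real (sqrt y))) (at y)"
      using sq \<Phi>[OF inS(1)] by (rule field_vector_diff_chain_at)
    moreover have "((\<Phi> \<circ> (\<lambda>y. 1 + \<i> * of_real (sqrt y))) has_vector_derivative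
        (\<i> / (2 * sqrt y)) * H (1 + \<i> * of_real (sqrt y))) (at y)"
      using has_vector_derivative_add[OF has_vector_derivative_const sq, of 1] \<Phi>[OF inS(2)]
      by (intro field_vector_diff_chain_at) simp_all
    moreover have "H (1 + \<i> * of_real (sqrt y)) = - H (- (\<i> * of_real (sqrt y)))"
      using refl[of "- (\<i> * of_real (sqrt y))"] by simp
    ultimately have "((\<lambda>y. (\<Phi> \<circ> (\<lambda>y. \<i> * of_real (sqrt y))) y - (\<Phi> \<circ> (\<lambda>y. 1 + \<i> * of_real (sqrt y))) y)
        has_vector_derivative f y) (at y)"
      using has_vector_derivative_diff by (fastforce simp: f_def algebra_simps)
    then show ?thesis
      by (simp add: F_def o_def)
  qed
  obtain C where C: "C > 0"
    "\<And>s. 0 \<le> Re s \<Longrightarrow> Re s \<le> 1 \<Longrightarrow> norm (Gamma4 a b c d s) \<le> C * exp (- 4 * \<bar>Im s\<bar>)"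
    using norm_Gamma4_strip_le[OF assms(1-4)] by blast
  have Hbound: "norm (H s) \<le> C\<^sup>2 * (1 + \<bar>Im s\<bar>) ^ (2 * k) * exp (- \<bar>Im s\<bar>)"
    if s: "0 \<le> Re s" "Re s \<le> 1" for s
  proof -
    have n: "norm s \<le> 1 + \<bar>Im s\<bar>" "norm (1 - s) \<le> 1 + \<bar>Im s\<bar>"
      using cmod_le[of s] cmod_le[of "1 - s"] s by auto
    have "norm (sin (2 * of_real pi * s)) \<le> exp \<bar>2 * pi * Im s\<bar>"
      using norm_sin_le_exp[of "2 * of_real pi * s"] by simp
    also have "\<dots> \<le> exp (7 * \<bar>Im s\<bar>)"
      using pi_less_7_halves by (simp add: abs_mult mult_right_mono)
    finally have "norm (H s) \<le> exp (7 * \<bar>Im s\<bar>) * ((1 + \<bar>Im s\<bar>) * (1 + \<bar>Im s\<bar>)) ^ k *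
        (C * exp (- 4 * \<bar>Im s\<bar>)) * (C * exp (- 4 * \<bar>Im s\<bar>))"
      unfolding H_def norm_mult norm_power
      using C(2)[of s] C(2)[of "1 - s"] C(1) n s
      by (intro mult_mono mult_nonneg_nonneg power_mono) auto
    also have "\<dots> = C\<^sup>2 * (1 + \<bar>Im s\<bar>) ^ (2 * k) *
        (exp (7 * \<bar>Im s\<bar>) * exp (- 4 * \<bar>Im s\<bar>) * exp (- 4 * \<bar>Im s\<bar>))"
      by (simp add: power2_eq_square power_mult)
    also have "exp (7 * \<bar>Im s\<bar>) * exp (- 4 * \<bar>Im s\<bar>) * exp (- 4 * \<bar>Im s\<bar>) = exp (- \<bar>Im s\<bar>)"
      by (simp flip: exp_add)
    finally show ?thesis .
  qed
  have Fbound: "norm (F y) \<le> C\<^sup>2 * (1 + sqrt y) ^ (2 * k) * exp (- sqrt y)" if "y > 0" for y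
  proof -
    let ?L = "closed_segment (1 + \<i> * of_real (sqrt y)) (\<i> * of_real (sqrt y))"
    have seg: "Im s = sqrt y \<and> 0 \<le> Re s \<and> Re s \<le> 1" if "s \<in> ?L" for s
      using that by (auto simp: closed_segment_def left_diff_distrib)
    then have "?L \<subseteq> S"
      using \<epsilon> by (fastforce simp: S_def)
    then have "norm (\<Phi> (\<i> * of_real (sqrt y)) - \<Phi> (1 + \<i> * of_real (sqrt y)))
        \<le> C\<^sup>2 * (1 + sqrt y) ^ (2 * k) * exp (- sqrt y) * norm (\<i> * of_real (sqrt y) - (1 + \<i> * of_real (sqrt y)))"
      using seg Hbound that
      by (intro field_differentiable_bound[of ?L \<Phi> H]) (force intro: has_field_derivative_at_within \<Phi>)+
    then show ?thesis
      by (simp add: F_def)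
  qed
  have "(F \<longlongrightarrow> 0) at_top"
  proof (rule Lim_null_comparison)
    show "\<forall>\<^sub>F y in at_top. norm (F y) \<le> C\<^sup>2 * (1 + sqrt y) ^ (2 * k) * exp (- sqrt y)"
      using eventually_gt_at_top[of 0] by eventually_elim (rule Fbound)
    show "((\<lambda>y. C\<^sup>2 * (1 + sqrt y) ^ (2 * k) * exp (- sqrt y)) \<longlongrightarrow> 0) at_top"
      by real_asymp
  qed
  moreover have "(F \<longlongrightarrow> 0) (at_right 0)"
  proof -
    have "isCont (\<lambda>y. \<Phi> (\<i> * of_real (sqrt y))) 0"
      using DERIV_isCont[OF \<Phi>[OF inS(1)[of 0]]]
      by (intro isCont_o2[where f = "\<lambda>y. \<i> * of_real (sqrt y)" and g = \<Phi>] continuous_intros) simp_all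
    moreover have "isCont (\<lambda>y. \<Phi> (1 + \<i> * of_real (sqrt y))) 0"
      using DERIV_isCont[OF \<Phi>[OF inS(2)[of 0]]]
      by (intro isCont_o2[where f = "\<lambda>y. 1 + \<i> * of_real (sqrt y)" and g = \<Phi>] continuous_intros) simp_all
    ultimately have "isCont F 0"
      unfolding F_def by (rule isCont_diff)
    moreover have "F 0 = 0"
      using sym[of 0] inS(1)[of 0] by (simp add: F_def)
    ultimately show ?thesis
      by (metis isCont_def filterlim_at_split)
  qed
  moreover have "isCont f y" if "y > 0" for y
  proof -
    have H: "isCont H s" if "s \<in> S" for s
      using holo S that continuous_on_eq_continuous_at holomorphic_on_imp_continuous_on by blast
    have "isCont (\<lambda>y. H (\<i> * of_real (sqrt y))) y"
      using H[OF inS(1)[of "sqrt y"]]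
      by (intro isCont_o2[where f = "\<lambda>y. \<i> * of_real (sqrt y)" and g = H] continuous_intros) simp_all
    moreover have "isCont H (- (\<i> * of_real (sqrt y)))"
      using H[of "\<i> * of_real (- sqrt y)"] inS(1)[of "- sqrt y"] by simp
    then have "isCont (\<lambda>y. H (- (\<i> * of_real (sqrt y)))) y"
      by (intro isCont_o2[where f = "\<lambda>y. - (\<i> * of_real (sqrt y))" and g = H] continuous_intros) simp_all
    ultimately show ?thesis
      using that unfolding f_def by (intro continuous_intros) simp_all
  qed
  ultimately have "(LBINT y=0..\<infinity>. f y) = 0 - 0"
    using assms(7) deriv
    by (intro interval_integral_FTC_integrable[of _ _ F])
      (auto simp: zero_ereal_def ereal_tendsto_simps)
  then show ?thesis
    using interval_integral_to_infinity_eq[where a = 0 and M = lborel and f = f]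
    by (simp add: zero_ereal_def)
qed

lemma Gamma4_plus1:
  assumes "Re (a + s) > 0" "Re (b + s) > 0" "Re (c + s) > 0" "Re (d + s) > 0"
  shows "Gamma4 a b c d (1 + s) = (a + s) * (b + s) * (c + s) * (d + s) * Gamma4 a b c d s"
proof -
  have "Gamma (x + (1 + s)) = (x + s) * Gamma (x + s)" if "Re (x + s) > 0" for x
  proof -
    have "x + s \<noteq> 0"
      using that by (metis order_less_irrefl zero_complex.sel(1))
    moreover have "x + s \<notin> \<int>\<^sub>\<le>\<^sub>0"
      using that by (auto elim!: nonpos_Ints_cases simp: complex_eq_iff)
    ultimately show ?thesis
      using Gamma_plus1[of "x + s"] by (simp add: add_ac)
  qed
  then show ?thesis
    using assms by (simp add: Gamma4_def mult_ac)
qed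

text \<open>The polynomial hypothesis is what remains after \<open>Gamma4_plus1\<close> has removed
  the shift by 1: an odd polynomial in s = iv is 2s times a polynomial in y = v^2. Degree 2 in y
  covers k = 0 and k = 1.\<close>

lemma wilson_weight_orthogonality:
  fixes k :: nat
  assumes pos: "Re a > 0" "Re b > 0" "Re c > 0" "Re d > 0"
    and q: "\<And>v. (\<i> * of_real v * (1 - \<i> * of_real v)) ^ k * ((a - \<i> * of_real v) * (b - \<i> * of_real v) * (c - \<i> * of_real v) * (d - \<i> * of_real v))
       - (- (\<i> * of_real v) * (1 + \<i> * of_real v)) ^ k * ((a + \<i> * of_real v) * (b + \<i> * of_real v) * (c + \<i> * of_real v) * (d + \<i> * of_real v))
       = 2 * \<i> * of_real v * (q0 + q1 * of_real (v\<^sup>2) + q2 * of_real (v\<^sup>2) ^ 2)"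
  shows "(LINT y:{0<..}|lborel. (q0 + q1 * of_real y + q2 * of_real y ^ 2) * wilson_weight a b c d y) = 0"
proof -
  let ?H = "\<lambda>s. sin (2 * of_real pi * s) * (s * (1 - s)) ^ k * Gamma4 a b c d s * Gamma4 a b c d (1 - s)"
  let ?f = "\<lambda>y. (?H (\<i> * sqrt y) + ?H (- (\<i> * sqrt y))) * (\<i> / (2 * sqrt y))"
  \<comment> \<open>The constant is i * (2iv) * (i / (2v)) = -i: one factor from the sine at an
    imaginary argument, one from the hypothesis on the polynomials and one from ds.\<close>
  let ?g = "\<lambda>y. - \<i> * ((q0 + q1 * of_real y + q2 * of_real y ^ 2) * wilson_weight a b c d y)"
  have fg: "?f y = ?g y" if "y \<in> {0<..}" for y
  proof -
    define v where "v = sqrt y"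
    have v: "v > 0" "y = v\<^sup>2"
      using that by (auto simp: v_def)
    let ?s = "\<i> * complex_of_real v"
    have sin: "sin (2 * of_real pi * ?s) = \<i> * of_real (sinh (2 * pi * v))"
      by (simp add: sin_exp_eq sinh_def exp_of_real[symmetric] exp_minus field_simps)
    have G: "Gamma4 a b c d (1 - ?s) = (a - ?s) * (b - ?s) * (c - ?s) * (d - ?s) * Gamma4 a b c d (- ?s)"
      using Gamma4_plus1[of a "- ?s" b c d] pos by simp
    have G': "Gamma4 a b c d (1 + ?s) = (a + ?s) * (b + ?s) * (c + ?s) * (d + ?s) * Gamma4 a b c d ?s"
      using Gamma4_plus1[of a "?s" b c d] pos by simp
    have "?f y = \<i> * of_real (sinh (2 * pi * v)) * Gamma4 a b c d ?s * Gamma4 a b c d (- ?s) *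
       ((?s * (1 - ?s)) ^ k * ((a - ?s) * (b - ?s) * (c - ?s) * (d - ?s))
       - (- ?s * (1 + ?s)) ^ k * ((a + ?s) * (b + ?s) * (c + ?s) * (d + ?s))) * (\<i> / (2 * v))"
      unfolding v_def[symmetric]
      by (simp only: minus_minus diff_minus_eq_add mult_minus_right sin_minus sin G G')
        (simp add: algebra_simps)
    also have "\<dots> = ?g y"
      unfolding q wilson_weight_def v_def[symmetric] using v by (simp add: v(2) field_simps)
    finally show ?thesis .
  qed
  have mono: "set_integrable lborel {0<..} (\<lambda>y. of_real y ^ j * wilson_weight a b c d y)" for j
    using integrable_wilson_weight[OF pos, of j] by simp
  have "set_integrable lborel {0<..} (\<lambda>y. - \<i> * q0 * (of_real y ^ 0 * wilson_weight a b c d y)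
      + - \<i> * q1 * (of_real y ^ 1 * wilson_weight a b c d y)
      + - \<i> * q2 * (of_real y ^ 2 * wilson_weight a b c d y))"
    by (intro set_integral_add set_integrable_mult_right mono)
  also have "(\<lambda>y. - \<i> * q0 * (of_real y ^ 0 * wilson_weight a b c d y)
      + - \<i> * q1 * (of_real y ^ 1 * wilson_weight a b c d y)
      + - \<i> * q2 * (of_real y ^ 2 * wilson_weight a b c d y)) = ?g"
    by (auto simp: algebra_simps)
  finally have "set_integrable lborel {0<..} ?g" .
  moreover have "set_integrable lborel {0<..} ?f \<longleftrightarrow> set_integrable lborel {0<..} ?g"
    by (intro set_integrable_cong refl fg) 
  ultimately have "set_integrable lborel {0<..} ?f"
    by blast
  from wilson_contour_shift[OF pos this]
  have "(LINT y:{0<..}|lborel. ?f y) = 0" .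
  also have "(LINT y:{0<..}|lborel. ?f y) = (LINT y:{0<..}|lborel. ?g y)"
    using fg by (intro set_lebesgue_integral_cong) auto
  also have "\<dots> = - \<i> * (LINT y:{0<..}|lborel. (q0 + q1 * of_real y + q2 * of_real y ^ 2) * wilson_weight a b c d y)"
    by (rule set_integral_mult_right)
  finally show ?thesis
    by simp
qed

section \<open>Real parameter pairs, the real kernel and its moment relations\<close>

definition conj_pair :: "complex \<Rightarrow> complex \<Rightarrow> bool" where
  "conj_pair a b \<longleftrightarrow> 0 < Re a \<and> 0 < Re b \<and> (a \<in> \<real> \<and> b \<in> \<real> \<or> a = cnj b)"

lemma conj_pair_sum: "conj_pair a b \<Longrightarrow> a + b = of_real (Re (a + b))"
  and conj_pair_mult: "conj_pair a b \<Longrightarrow> a * b = of_real (Re (a * b))"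
  by (auto simp: conj_pair_def complex_eq_iff complex_is_Real_iff)

lemma conj_pair_mult_pos: "conj_pair a b \<Longrightarrow> Re (a * b) > 0"
proof -
  assume ab: "conj_pair a b"
  have "0 < Re a * Re b - Im a * Im b"
  proof (cases "a = cnj b")
    case True
    moreover have "0 < Re b * Re b + Im b * Im b"
      using ab by (intro add_pos_nonneg) (auto simp: conj_pair_def)
    ultimately show ?thesis
      by simp
  next
    case False
    then show ?thesis
      using ab by (simp add: conj_pair_def complex_is_Real_iff)
  qed
  then show ?thesis
    by simp
qed

text \<open>A single Gamma factor need not be symmetric under conjugation, but conjugation at most
  swaps the two members of a pair, so the product over the pair is symmetric.\<close>

lemma conj_pair_cnj_Gamma:
  assumes "conj_pair a b"
  shows "Gamma (a - \<i> * of_real v) * Gamma (b - \<i> * of_real v)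
    = cnj (Gamma (a + \<i> * of_real v) * Gamma (b + \<i> * of_real v))"
  using assms by (auto simp: conj_pair_def cnj_Gamma Reals_cnj_iff mult.commute)

definition wilson_kernel :: "complex \<Rightarrow> complex \<Rightarrow> complex \<Rightarrow> complex \<Rightarrow> real \<Rightarrow> real" where
  "wilson_kernel a b c d x =
     (norm (Gamma (a + \<i> * complex_of_real (sqrt x)) * Gamma (b + \<i> * complex_of_real (sqrt x))
          * Gamma (c + \<i> * complex_of_real (sqrt x)) * Gamma (d + \<i> * complex_of_real (sqrt x))))\<^sup>2 /
     (sqrt x * (norm (Gamma (2 * \<i> * complex_of_real (sqrt x))))\<^sup>2)"

lemma wilson_density_eq: "wilson_density a b c d x = Re (wilson_const a b c d) * wilson_kernel a b c d x"
  by (simp add: wilson_density_def wilson_kernel_def)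

lemma measurable_wilson_kernel [measurable]: "wilson_kernel a b c d \<in> borel_measurable borel"
  unfolding wilson_kernel_def by measurable

text \<open>On the imaginary axis Gamma(1 - s) is -s times the conjugate of Gamma(s), so the
  reflection formula again yields a squared modulus.\<close>

lemma norm_Gamma_imaginary:
  assumes "v > 0"
  shows "(norm (Gamma (\<i> * of_real v)))\<^sup>2 = pi / (v * sinh (pi * v))"
proof -
  let ?s = "\<i> * complex_of_real v"
  have "- ?s \<notin> \<int>\<^sub>\<le>\<^sub>0"
    using assms by (auto elim!: nonpos_Ints_cases simp: complex_eq_iff)
  then have "Gamma (1 - ?s) = - ?s * Gamma (- ?s)"
    using Gamma_plus1[of "- ?s"] assms by simp
  also have "Gamma (- ?s) = cnj (Gamma ?s)"
    by (simp add: cnj_Gamma)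
  finally have "- ?s * (Gamma ?s * cnj (Gamma ?s)) = Gamma ?s * Gamma (1 - ?s)"
    by simp
  also have "\<dots> = of_real pi / sin (of_real pi * ?s)"
    by (rule Gamma_reflection_complex)
  also have "sin (of_real pi * ?s) = \<i> * of_real (sinh (pi * v))"
    by (simp add: sin_exp_eq sinh_def exp_of_real[symmetric] exp_minus field_simps)
  finally have "complex_of_real (v * (norm (Gamma ?s))\<^sup>2 * sinh (pi * v)) = of_real pi"
    using assms by (simp add: complex_norm_square[symmetric] field_simps)
  then have "v * (norm (Gamma ?s))\<^sup>2 * sinh (pi * v) = pi"
    by (simp only: of_real_eq_iff)
  then show ?thesis
    using assms by (simp add: field_simps)
qed

lemma wilson_weight_eq_kernel:
  assumes "conj_pair a b" "conj_pair c d" "y > 0"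
  shows "wilson_weight a b c d y = of_real (pi / 2 * wilson_kernel a b c d y)"
proof -
  define v where "v = sqrt y"
  have v: "v > 0" "y = v\<^sup>2"
    using assms by (auto simp: v_def)
  let ?N = "(norm (Gamma4 a b c d (\<i> * v)))\<^sup>2"
  have "Gamma4 a b c d (- (\<i> * v)) = cnj (Gamma4 a b c d (\<i> * v))"
    using conj_pair_cnj_Gamma[OF assms(1), of v] conj_pair_cnj_Gamma[OF assms(2), of v]
    by (simp add: Gamma4_def mult.assoc)
  then have "wilson_weight a b c d y = of_real (sinh (2 * pi * v) * ?N)"
    by (simp only: wilson_weight_def v_def[symmetric] complex_norm_square mult.assoc of_real_mult)
  moreover have "wilson_kernel a b c d y = ?N / (v * (norm (Gamma (\<i> * of_real (2 * v))))\<^sup>2)"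
    by (simp add: wilson_kernel_def v_def[symmetric] Gamma4_def mult_ac)
  moreover have "\<dots> = 2 / pi * sinh (2 * pi * v) * ?N"
    using v by (subst norm_Gamma_imaginary) (auto simp: mult_ac)
  ultimately show ?thesis
    by simp
qed

lemma wilson_kernel_nonneg: "x > 0 \<Longrightarrow> wilson_kernel a b c d x \<ge> 0"
  by (simp add: wilson_kernel_def)

lemma integrable_wilson_kernel:
  assumes "conj_pair a b" "conj_pair c d"
  shows "set_integrable lborel {0<..} (\<lambda>y. y ^ k * wilson_kernel a b c d y)"
proof -
  have "set_integrable lborel {0<..} (\<lambda>y. complex_of_real (y ^ k) * wilson_weight a b c d y)"
    using assms by (intro integrable_wilson_weight) (auto simp: conj_pair_def)
  then have "set_integrable lborel {0<..} (\<lambda>y. complex_of_real (pi / 2 * (y ^ k * wilson_kernel a b c d y)))"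
    by (rule iffD1[OF set_integrable_cong[OF refl refl], rotated])
      (use assms in \<open>simp add: wilson_weight_eq_kernel\<close>)
  then have "set_integrable lborel {0<..} (\<lambda>y. pi / 2 * (y ^ k * wilson_kernel a b c d y))"
    unfolding set_integrable_def
    by (simp only: scaleR_conv_of_real flip: of_real_mult) (simp only: complex_of_real_integrable_eq real_scaleR_def of_real_eq_id id_apply)
  then show ?thesis
    by simp
qed

lemma wilson_kernel_orthogonality:
  assumes "conj_pair a b" "conj_pair c d"
    and "(LINT y:{0<..}|lborel. (of_real q0 + of_real q1 * of_real y + of_real q2 * of_real y ^ 2) * wilson_weight a b c d y) = 0"
  shows "(LINT y:{0<..}|lborel. (q0 + q1 * y + q2 * y\<^sup>2) * wilson_kernel a b c d y) = 0"
proof -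
  have "(LINT y:{0<..}|lborel. (of_real q0 + of_real q1 * of_real y + of_real q2 * of_real y ^ 2) * wilson_weight a b c d y)
    = (LINT y:{0<..}|lborel. complex_of_real (pi / 2 * ((q0 + q1 * y + q2 * y\<^sup>2) * wilson_kernel a b c d y)))"
    using assms by (intro set_lebesgue_integral_cong) (auto simp: wilson_weight_eq_kernel)
  also have "\<dots> = of_real (LINT y:{0<..}|lborel. (pi / 2 * ((q0 + q1 * y + q2 * y\<^sup>2) * wilson_kernel a b c d y)))"
    unfolding set_lebesgue_integral_def
    by (simp add: scaleR_conv_of_real flip: of_real_mult)
  finally show ?thesis
    using assms(3) by simp
qed

text \<open>The elementary symmetric functions of the four parameters, expressed by sums and
  products of the two pairs. Over a \<open>conj_pair\<close> these are real, so \<open>Re\<close>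
  only changes the type.\<close>

definition esym1 where "esym1 a b c d = Re (a + b) + Re (c + d)" for a b c d :: complex
definition esym2 where "esym2 a b c d = Re (a * b) + Re (c * d) + Re (a + b) * Re (c + d)" for a b c d :: complex
definition esym3 where "esym3 a b c d = Re (a * b) * Re (c + d) + Re (a + b) * Re (c * d)" for a b c d :: complex
definition esym4 where "esym4 a b c d = Re (a * b) * Re (c * d)" for a b c d :: complex

lemma nn_integral_pos_lborel:
  "f \<in> borel_measurable borel \<Longrightarrow>
    (\<integral>\<^sup>+y. f y \<partial>pos_lborel) = (\<integral>\<^sup>+y. f y * indicator {0<..} y \<partial>lborel)"
  by (simp add: pos_lborel_def nn_integral_restrict_space)

lemma nn_integral_pos_lborel_eq:
  assumes "set_integrable lborel {0<..} f" "\<And>y. y > 0 \<Longrightarrow> f y \<ge> 0" "f \<in> borel_measurable borel"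
  shows "(\<integral>\<^sup>+y. ennreal (f y) \<partial>pos_lborel) = ennreal (LINT y:{0<..}|lborel. f y)"
proof -
  have "(\<integral>\<^sup>+y. ennreal (f y) \<partial>pos_lborel) = (\<integral>\<^sup>+y. ennreal (indicator {0<..} y *\<^sub>R f y) \<partial>lborel)"
    using assms by (subst nn_integral_pos_lborel) (auto intro!: nn_integral_cong simp: indicator_def)
  also have "\<dots> = ennreal (LINT y|lborel. indicator {0<..} y *\<^sub>R f y)"
    using assms by (intro nn_integral_eq_integral) (auto simp: set_integrable_def indicator_def)
  finally show ?thesis
    by (simp add: set_lebesgue_integral_def)
qed

lemma esym_pos:
  assumes "conj_pair a b" "conj_pair c d"
  shows "esym1 a b c d > 0" "esym2 a b c d > 0" "esym3 a b c d > 0" "esym4 a b c d > 0"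
proof -
  have "Re (a + b) > 0" "Re (c + d) > 0"
    using assms by (auto simp: conj_pair_def)
  with assms[THEN conj_pair_mult_pos]
  show "esym1 a b c d > 0" "esym2 a b c d > 0" "esym3 a b c d > 0" "esym4 a b c d > 0"
    unfolding esym1_def esym2_def esym3_def esym4_def
    by (metis add_pos_pos mult_pos_pos)+
qed

lemma nn_wilson_moment_finite:
  assumes "conj_pair a b" "conj_pair c d"
  shows "(\<integral>\<^sup>+y. ennreal (y ^ k * wilson_kernel a b c d y) \<partial>pos_lborel) < \<infinity>"
  using integrable_wilson_kernel[OF assms, of k]
  by (subst nn_integral_pos_lborel_eq) (auto simp: wilson_kernel_nonneg)

text \<open>The orthogonal polynomial is split as f - g with f and g nonnegative on the half-line.
  The resulting equality of nonnegative integrals can be integrated further against arbitrary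
  nonnegative functions of the other coordinates of the process.\<close>

lemma nn_wilson_orthogonality:
  fixes k :: nat
  assumes pairs: "conj_pair a b" "conj_pair c d"
    and nonneg: "\<And>y. y > 0 \<Longrightarrow> 0 \<le> f0 + f1 * y + f2 * y\<^sup>2" "\<And>y. y > 0 \<Longrightarrow> 0 \<le> g0 + g1 * y + g2 * y\<^sup>2"
    and q: "\<And>v. (\<i> * of_real v * (1 - \<i> * of_real v)) ^ k * ((a - \<i> * of_real v) * (b - \<i> * of_real v) * (c - \<i> * of_real v) * (d - \<i> * of_real v))
       - (- (\<i> * of_real v) * (1 + \<i> * of_real v)) ^ k * ((a + \<i> * of_real v) * (b + \<i> * of_real v) * (c + \<i> * of_real v) * (d + \<i> * of_real v))
       = 2 * \<i> * of_real v * (of_real (f0 - g0) + of_real (f1 - g1) * of_real (v\<^sup>2) + of_real (f2 - g2) * of_real (v\<^sup>2) ^ 2)"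
  shows "(\<integral>\<^sup>+y. ennreal ((f0 + f1 * y + f2 * y\<^sup>2) * wilson_kernel a b c d y) \<partial>pos_lborel)
       = (\<integral>\<^sup>+y. ennreal ((g0 + g1 * y + g2 * y\<^sup>2) * wilson_kernel a b c d y) \<partial>pos_lborel)"
proof -
  have int: "set_integrable lborel {0<..} (\<lambda>y. (p0 + p1 * y + p2 * y\<^sup>2) * wilson_kernel a b c d y)" for p0 p1 p2
    unfolding distrib_right[of _ _ "wilson_kernel _ _ _ _ _"] mult.assoc
    using integrable_wilson_kernel[OF pairs, of 0] integrable_wilson_kernel[OF pairs, of 1]
      integrable_wilson_kernel[OF pairs, of 2]
    by (intro set_integral_add(1) set_integrable_mult_right) simp_all
  have "(LINT y:{0<..}|lborel. ((f0 - g0) + (f1 - g1) * y + (f2 - g2) * y\<^sup>2) * wilson_kernel a b c d y) = 0"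
    by (intro wilson_kernel_orthogonality pairs wilson_weight_orthogonality[where k = k] q)
      (use pairs in \<open>auto simp: conj_pair_def\<close>)
  moreover have "(\<lambda>y. ((f0 - g0) + (f1 - g1) * y + (f2 - g2) * y\<^sup>2) * wilson_kernel a b c d y)
    = (\<lambda>y. (f0 + f1 * y + f2 * y\<^sup>2) * wilson_kernel a b c d y - (g0 + g1 * y + g2 * y\<^sup>2) * wilson_kernel a b c d y)"
    by (simp add: algebra_simps)
  ultimately have "(LINT y:{0<..}|lborel. (f0 + f1 * y + f2 * y\<^sup>2) * wilson_kernel a b c d y)
    = (LINT y:{0<..}|lborel. (g0 + g1 * y + g2 * y\<^sup>2) * wilson_kernel a b c d y)"
    using set_integral_diff(2)[OF int[of f0 f1 f2] int[of g0 g1 g2]] by simp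
  then show ?thesis
    using nonneg by (subst (1 2) nn_integral_pos_lborel_eq) (auto intro!: int mult_nonneg_nonneg wilson_kernel_nonneg)
qed

text \<open>Let P(s) be the product of the a_j + s and s = iv. For k = 0, P(-s) - P(s) is minus
  twice the odd part of P, that is 2s (e1 y - e3). For k = 1, s ((1 - s) P(-s) + (1 + s) P(s)) is 2s
  times the sum of the even part of P and s times its odd part, which gives the quadratic
  polynomial. Terms with a negative sign go to the other side.\<close>

lemma nn_wilson_moments:
  assumes "conj_pair a b" "conj_pair c d"
  shows nn_wilson_moment1:
      "(\<integral>\<^sup>+y. ennreal ((esym1 a b c d * y) * wilson_kernel a b c d y) \<partial>pos_lborel)
       = (\<integral>\<^sup>+y. ennreal (esym3 a b c d * wilson_kernel a b c d y) \<partial>pos_lborel)"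
    and nn_wilson_moment2:
      "(\<integral>\<^sup>+y. ennreal (((1 + esym1 a b c d) * y\<^sup>2 + esym4 a b c d) * wilson_kernel a b c d y) \<partial>pos_lborel)
       = (\<integral>\<^sup>+y. ennreal (((esym2 a b c d + esym3 a b c d) * y) * wilson_kernel a b c d y) \<partial>pos_lborel)"
proof -
  have S: "of_real (esym1 a b c d) = (a + b) + (c + d)"
    "of_real (esym2 a b c d) = (a * b) + (c * d) + (a + b) * (c + d)"
    "of_real (esym3 a b c d) = (a * b) * (c + d) + (a + b) * (c * d)"
    "of_real (esym4 a b c d) = (a * b) * (c * d)"
    unfolding esym1_def esym2_def esym3_def esym4_def of_real_add of_real_mult
    using assms by (simp_all flip: conj_pair_sum conj_pair_mult del: plus_complex.sel times_complex.sel)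
  note pos = esym_pos[OF assms]
  have "(\<integral>\<^sup>+y. ennreal ((0 + esym1 a b c d * y + 0 * y\<^sup>2) * wilson_kernel a b c d y) \<partial>pos_lborel)
       = (\<integral>\<^sup>+y. ennreal ((esym3 a b c d + 0 * y + 0 * y\<^sup>2) * wilson_kernel a b c d y) \<partial>pos_lborel)"
  proof (rule nn_wilson_orthogonality[OF assms, where k = 0], goal_cases)
    case (3 v)
    show ?case
      unfolding of_real_diff S of_real_power of_real_0 power_0 using i_squared by algebra
  qed (use pos in auto)
  then show "(\<integral>\<^sup>+y. ennreal ((esym1 a b c d * y) * wilson_kernel a b c d y) \<partial>pos_lborel)
       = (\<integral>\<^sup>+y. ennreal (esym3 a b c d * wilson_kernel a b c d y) \<partial>pos_lborel)"
    by simp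
  have "(\<integral>\<^sup>+y. ennreal ((esym4 a b c d + 0 * y + (1 + esym1 a b c d) * y\<^sup>2) * wilson_kernel a b c d y) \<partial>pos_lborel)
       = (\<integral>\<^sup>+y. ennreal ((0 + (esym2 a b c d + esym3 a b c d) * y + 0 * y\<^sup>2) * wilson_kernel a b c d y) \<partial>pos_lborel)"
  proof (rule nn_wilson_orthogonality[OF assms, where k = 1], goal_cases)
    case (3 v)
    show ?case
      unfolding of_real_diff of_real_add of_real_1 S of_real_power of_real_0 power_one_right using i_squared by algebra
  qed (use pos in auto)
  then show "(\<integral>\<^sup>+y. ennreal (((1 + esym1 a b c d) * y\<^sup>2 + esym4 a b c d) * wilson_kernel a b c d y) \<partial>pos_lborel)
       = (\<integral>\<^sup>+y. ennreal (((esym2 a b c d + esym3 a b c d) * y) * wilson_kernel a b c d y) \<partial>pos_lborel)"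
    by (simp add: add.commute)
qed

section \<open>Markov processes with transition densities\<close>

lemma space_generated_field [simp]: "space (generated_field P S Y R) = space P"
  unfolding generated_field_def by (rule space_measure_of) auto

lemma sets_generated_field:
  "sets (generated_field P S Y R) = sigma_sets (space P) {Y r -` B \<inter> space P | r B. r \<in> R \<and> B \<in> sets S}"
  unfolding generated_field_def by (rule sets_measure_of) auto

lemma measurable_generated_field:
  assumes "r \<in> R" "Y r \<in> space P \<rightarrow> space S"
  shows "Y r \<in> generated_field P S Y R \<rightarrow>\<^sub>M S"
  using assms by (intro measurableI) (auto simp: sets_generated_field intro!: sigma_sets.Basic)

lemma subalgebra_generated_field:
  assumes "\<And>r. r \<in> R \<Longrightarrow> Y r \<in> P \<rightarrow>\<^sub>M S"
  shows "subalgebra P (generated_field P S Y R)"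
  unfolding subalgebra_def sets_generated_field
  using assms by (auto intro!: sets.sigma_sets_subset measurable_sets)

lemma subalgebra_generated_field_mono:
  assumes "R \<subseteq> R'"
  shows "subalgebra (generated_field P S Y R') (generated_field P S Y R)"
  unfolding subalgebra_def sets_generated_field
  using assms by (auto intro!: sigma_sets_mono')

text \<open>\<open>finite_k\<close> makes the real-valued \<open>measure\<close> in the Markov
  property agree with the nonnegative integral of the density; on sets of infinite mass
  \<open>measure\<close> would be 0.\<close>

locale density_markov = prob_space P + S: sigma_finite_measure S
  for P :: "'a measure" and S :: "'b measure" +
  fixes T :: "real set" and k :: "real \<Rightarrow> real \<Rightarrow> 'b \<Rightarrow> 'b \<Rightarrow> ennreal" and Y :: "real \<Rightarrow> 'a \<Rightarrow> 'b"
  assumes measurable_Y: "t \<in> T \<Longrightarrow> Y t \<in> P \<rightarrow>\<^sub>M S"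
    and measurable_k: "s \<in> T \<Longrightarrow> t \<in> T \<Longrightarrow> s < t \<Longrightarrow> (\<lambda>(x, y). k s t x y) \<in> borel_measurable (S \<Otimes>\<^sub>M S)"
    and finite_k: "s \<in> T \<Longrightarrow> t \<in> T \<Longrightarrow> s < t \<Longrightarrow> x \<in> space S \<Longrightarrow> (\<integral>\<^sup>+y. k s t x y \<partial>S) < \<infinity>"
    and transition: "s \<in> T \<Longrightarrow> t \<in> T \<Longrightarrow> s < t \<Longrightarrow> B \<in> sets S \<Longrightarrow> AE \<omega> in P.
           real_cond_exp P (generated_field P S Y {r\<in>T. r \<le> s}) (\<lambda>\<omega>. indicator B (Y t \<omega>)) \<omega>
           = measure (density S (k s t (Y s \<omega>))) B"
begin

abbreviation past :: "real \<Rightarrow> 'a measure" where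
  "past s \<equiv> generated_field P S Y {r\<in>T. r \<le> s}"

lemma subalgebra_past: "subalgebra P (past s)"
  by (rule subalgebra_generated_field) (auto intro: measurable_Y)

lemma measurable_past_P: "f \<in> borel_measurable (past s) \<Longrightarrow> f \<in> borel_measurable P"
  by (rule measurable_from_subalg[OF subalgebra_past])

lemma measurable_past_mono:
  "f \<in> borel_measurable (past s) \<Longrightarrow> s \<le> t \<Longrightarrow> f \<in> borel_measurable (past t)"
  by (rule measurable_from_subalg[OF subalgebra_generated_field_mono]) auto

lemma measurable_Y_past: "r \<in> T \<Longrightarrow> r \<le> s \<Longrightarrow> Y r \<in> past s \<rightarrow>\<^sub>M S"
  by (rule measurable_generated_field) (use measurable_space[OF measurable_Y] in auto)

lemma Y_in_space: "t \<in> T \<Longrightarrow> \<omega> \<in> space P \<Longrightarrow> Y t \<omega> \<in> space S"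
  using measurable_space[OF measurable_Y] by blast

lemma nn_transition_set:
  assumes st: "s \<in> T" "t \<in> T" "s < t" and E: "E \<in> sets (past s)" and B: "B \<in> sets S"
  shows "(\<integral>\<^sup>+\<omega>. indicator E \<omega> * indicator B (Y t \<omega>) \<partial>P)
       = (\<integral>\<^sup>+\<omega>. indicator E \<omega> * (\<integral>\<^sup>+y. k s t (Y s \<omega>) y * indicator B y \<partial>S) \<partial>P)"
proof -
  interpret sub: finite_measure_subalgebra P "past s"
    using subalgebra_past by unfold_locales
  note [measurable] = measurable_Y[OF st(1)] measurable_Y[OF st(2)] measurable_k[OF st] B
  let ?f = "\<lambda>\<omega>. indicator B (Y t \<omega>) :: real"
  have int_f: "integrable P ?f"
    by (rule integrable_const_bound[where B = 1]) auto
  have EP [measurable]: "E \<in> sets P"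
    using E subalgebra_past by (auto simp: subalgebra_def)
  have kx [measurable]: "k s t x \<in> borel_measurable S" if "x \<in> space S" for x
    using measurable_compose[OF measurable_Pair1'[OF that] measurable_k[OF st]] by simp
  have AE: "AE \<omega> in P. ennreal (real_cond_exp P (past s) ?f \<omega>) = (\<integral>\<^sup>+y. k s t (Y s \<omega>) y * indicator B y \<partial>S)"
    using transition[OF st B] AE_space
  proof eventually_elim
    case (elim \<omega>)
    then have x: "Y s \<omega> \<in> space S"
      using Y_in_space st by blast
    have "emeasure (density S (k s t (Y s \<omega>))) B \<le> emeasure (density S (k s t (Y s \<omega>))) (space S)"
      using sets.sets_into_space[OF B] by (intro emeasure_mono) auto
    also have "\<dots> = (\<integral>\<^sup>+y. k s t (Y s \<omega>) y \<partial>S)"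
      using kx[OF x] by (simp add: emeasure_density cong: nn_integral_cong)
    also have "\<dots> < \<infinity>"
      using finite_k[OF st x] .
    finally have "ennreal (measure (density S (k s t (Y s \<omega>))) B) = emeasure (density S (k s t (Y s \<omega>))) B"
      by (simp add: emeasure_eq_ennreal_measure)
    also have "\<dots> = (\<integral>\<^sup>+y. k s t (Y s \<omega>) y * indicator B y \<partial>S)"
      using kx[OF x] B by (simp add: emeasure_density)
    finally show ?case
      using elim by simp
  qed
  have "AE \<omega> in P. 0 \<le> real_cond_exp P (past s) ?f \<omega>"
    by (rule sub.real_cond_exp_pos) auto
  moreover have "integrable P (\<lambda>\<omega>. indicator E \<omega> * real_cond_exp P (past s) ?f \<omega>)"
    using integrable_real_mult_indicator[OF EP sub.real_cond_exp_int(1)[OF int_f]] by (simp add: mult.commute)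
  moreover have "integrable P (\<lambda>\<omega>. indicator E \<omega> * ?f \<omega>)"
    using integrable_real_mult_indicator[OF EP int_f] by (simp add: mult.commute)
  moreover have "(\<integral>\<omega>. indicator E \<omega> * ?f \<omega> \<partial>P) = (\<integral>\<omega>. indicator E \<omega> * real_cond_exp P (past s) ?f \<omega> \<partial>P)"
    using sub.real_cond_exp_intA[OF int_f E] by (simp add: set_lebesgue_integral_def)
  ultimately have "(\<integral>\<^sup>+\<omega>. ennreal (indicator E \<omega> * ?f \<omega>) \<partial>P)
    = (\<integral>\<^sup>+\<omega>. ennreal (indicator E \<omega> * real_cond_exp P (past s) ?f \<omega>) \<partial>P)"
    by (subst (1 2) nn_integral_eq_integral) (auto simp: indicator_def)
  moreover have "(\<integral>\<^sup>+\<omega>. ennreal (indicator E \<omega> * real_cond_exp P (past s) ?f \<omega>) \<partial>P)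
    = (\<integral>\<^sup>+\<omega>. indicator E \<omega> * (\<integral>\<^sup>+y. k s t (Y s \<omega>) y * indicator B y \<partial>S) \<partial>P)"
    using AE by (intro nn_integral_cong_AE) (auto elim!: eventually_mono simp: indicator_def)
  moreover have "(\<integral>\<^sup>+\<omega>. ennreal (indicator E \<omega> * ?f \<omega>) \<partial>P) = (\<integral>\<^sup>+\<omega>. indicator E \<omega> * indicator B (Y t \<omega>) \<partial>P)"
    by (intro nn_integral_cong) (auto simp: indicator_def)
  ultimately show ?thesis
    by simp
qed

text \<open>Restricted to an event E of the past, the distribution of \<open>Y t\<close> has the
  density \<open>?d\<close>. On sets this is \<open>nn_transition_set\<close>; equality of the two
  measures extends it to all nonnegative functions. The weight \<open>G\<close> then enters through
  the characterisation of \<open>nn_cond_exp\<close>.\<close>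

lemma nn_transition:
  assumes st: "s \<in> T" "t \<in> T" "s < t" and G: "G \<in> borel_measurable (past s)"
    and \<phi> [measurable]: "\<phi> \<in> borel_measurable S"
  shows "(\<integral>\<^sup>+\<omega>. G \<omega> * \<phi> (Y t \<omega>) \<partial>P) = (\<integral>\<^sup>+\<omega>. G \<omega> * (\<integral>\<^sup>+y. k s t (Y s \<omega>) y * \<phi> y \<partial>S) \<partial>P)"
proof -
  interpret sub: finite_measure_subalgebra P "past s"
    using subalgebra_past by unfold_locales
  interpret PS: pair_sigma_finite P S ..
  note [measurable] = measurable_Y[OF st(1)] measurable_Y[OF st(2)] measurable_k[OF st]
  have "(\<lambda>\<omega>. \<integral>\<^sup>+y. k s t (Y s \<omega>) y * \<phi> y \<partial>S) \<in> borel_measurable (past s)"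
  proof -
    note [measurable] = measurable_Y_past[OF st(1) order_refl]
    show ?thesis
      by measurable
  qed
  moreover have "(\<integral>\<^sup>+\<omega>\<in>E. \<phi> (Y t \<omega>) \<partial>P) = (\<integral>\<^sup>+\<omega>\<in>E. (\<integral>\<^sup>+y. k s t (Y s \<omega>) y * \<phi> y \<partial>S) \<partial>P)"
    if E: "E \<in> sets (past s)" for E
  proof -
    have [measurable]: "E \<in> sets P"
      using E subalgebra_past by (auto simp: subalgebra_def)
    let ?d = "\<lambda>y. \<integral>\<^sup>+\<omega>. indicator E \<omega> * k s t (Y s \<omega>) y \<partial>P"
    have fub: "(\<integral>\<^sup>+y. ?d y * \<psi> y \<partial>S) = (\<integral>\<^sup>+\<omega>. indicator E \<omega> * (\<integral>\<^sup>+y. k s t (Y s \<omega>) y * \<psi> y \<partial>S) \<partial>P)"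
      if [measurable]: "\<psi> \<in> borel_measurable S" for \<psi>
    proof -
      have "(\<integral>\<^sup>+y. ?d y * \<psi> y \<partial>S) = (\<integral>\<^sup>+y. (\<integral>\<^sup>+\<omega>. indicator E \<omega> * (k s t (Y s \<omega>) y * \<psi> y) \<partial>P) \<partial>S)"
        by (intro nn_integral_cong, subst nn_integral_multc[symmetric]) (measurable, simp add: mult.assoc)
      also have "\<dots> = (\<integral>\<^sup>+\<omega>. (\<integral>\<^sup>+y. indicator E \<omega> * (k s t (Y s \<omega>) y * \<psi> y) \<partial>S) \<partial>P)"
        by (rule PS.Fubini') measurable
      also have "\<dots> = (\<integral>\<^sup>+\<omega>. indicator E \<omega> * (\<integral>\<^sup>+y. k s t (Y s \<omega>) y * \<psi> y \<partial>S) \<partial>P)"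
        by (intro nn_integral_cong nn_integral_cmult) measurable
      finally show ?thesis .
    qed
    have "distr (density P (indicator E)) S (Y t) = density S ?d"
    proof (rule measure_eqI)
      fix B assume "B \<in> sets (distr (density P (indicator E)) S (Y t))"
      then have B [measurable]: "B \<in> sets S"
        by simp
      have "emeasure (distr (density P (indicator E)) S (Y t)) B
          = (\<integral>\<^sup>+\<omega>. indicator E \<omega> * indicator (Y t -` B \<inter> space P) \<omega> \<partial>P)"
        by (simp add: emeasure_distr emeasure_density)
      also have "\<dots> = (\<integral>\<^sup>+\<omega>. indicator E \<omega> * indicator B (Y t \<omega>) \<partial>P)"
        by (intro nn_integral_cong) (auto simp: indicator_def)
      also have "\<dots> = (\<integral>\<^sup>+\<omega>. indicator E \<omega> * (\<integral>\<^sup>+y. k s t (Y s \<omega>) y * indicator B y \<partial>S) \<partial>P)"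
        by (rule nn_transition_set[OF st E B])
      also have "\<dots> = emeasure (density S ?d) B"
        by (subst fub[symmetric]) (auto simp: emeasure_density)
      finally show "emeasure (distr (density P (indicator E)) S (Y t)) B = emeasure (density S ?d) B" .
    qed simp
    note distr_eq = this
    have "(\<integral>\<^sup>+\<omega>\<in>E. \<phi> (Y t \<omega>) \<partial>P) = (\<integral>\<^sup>+y. \<phi> y \<partial>distr (density P (indicator E)) S (Y t))"
      by (simp add: nn_integral_distr nn_integral_density mult.commute)
    also have "\<dots> = (\<integral>\<^sup>+y. ?d y * \<phi> y \<partial>S)"
      by (simp add: distr_eq nn_integral_density)
    also have "\<dots> = (\<integral>\<^sup>+\<omega>. indicator E \<omega> * (\<integral>\<^sup>+y. k s t (Y s \<omega>) y * \<phi> y \<partial>S) \<partial>P)"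
      by (rule fub[OF \<phi>])
    finally show ?thesis
      by (simp add: mult.commute)
  qed
  ultimately have "AE \<omega> in P. (\<integral>\<^sup>+y. k s t (Y s \<omega>) y * \<phi> y \<partial>S) = nn_cond_exp P (past s) (\<lambda>\<omega>. \<phi> (Y t \<omega>)) \<omega>"
    by (intro sub.nn_cond_exp_charact) auto
  then have "(\<integral>\<^sup>+\<omega>. G \<omega> * nn_cond_exp P (past s) (\<lambda>\<omega>. \<phi> (Y t \<omega>)) \<omega> \<partial>P)
      = (\<integral>\<^sup>+\<omega>. G \<omega> * (\<integral>\<^sup>+y. k s t (Y s \<omega>) y * \<phi> y \<partial>S) \<partial>P)"
    by (intro nn_integral_cong_AE) (auto elim!: eventually_mono)
  then show ?thesis
    using sub.nn_cond_exp_intg[OF G, of "\<lambda>\<omega>. \<phi> (Y t \<omega>)"] by simp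
qed

text \<open>The Markov property is applied at t and then at s. Tonelli moves the y-integral inside,
  for fixed values at s and u, which is where the bridge law becomes visible.\<close>

lemma nn_transition2:
  assumes st: "s \<in> T" "t \<in> T" "u \<in> T" "s < t" "t < u" and G: "G \<in> borel_measurable (past s)"
    and \<phi> [measurable]: "\<phi> \<in> borel_measurable S" and [measurable]: "h \<in> borel_measurable S"
  shows "(\<integral>\<^sup>+\<omega>. G \<omega> * \<phi> (Y t \<omega>) * h (Y u \<omega>) \<partial>P)
    = (\<integral>\<^sup>+\<omega>. G \<omega> * (\<integral>\<^sup>+z. h z * (\<integral>\<^sup>+y. k s t (Y s \<omega>) y * k t u y z * \<phi> y \<partial>S) \<partial>S) \<partial>P)"
proof -
  interpret SS: pair_sigma_finite S S ..
  note [measurable] = measurable_k[OF st(1,2,4)] measurable_k[OF st(2,3,5)]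
  have "(\<lambda>\<omega>. G \<omega> * \<phi> (Y t \<omega>)) \<in> borel_measurable (past t)"
  proof -
    note [measurable] = measurable_compose[OF measurable_Y_past[OF st(2) order_refl] \<phi>]
      measurable_past_mono[OF G less_imp_le[OF st(4)]]
    show ?thesis
      by measurable
  qed
  then have "(\<integral>\<^sup>+\<omega>. G \<omega> * \<phi> (Y t \<omega>) * h (Y u \<omega>) \<partial>P)
    = (\<integral>\<^sup>+\<omega>. G \<omega> * \<phi> (Y t \<omega>) * (\<integral>\<^sup>+z. k t u (Y t \<omega>) z * h z \<partial>S) \<partial>P)"
    using st by (intro nn_transition) auto
  also have "\<dots> = (\<integral>\<^sup>+\<omega>. G \<omega> * (\<lambda>y. \<phi> y * (\<integral>\<^sup>+z. k t u y z * h z \<partial>S)) (Y t \<omega>) \<partial>P)"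
    by (simp add: mult.assoc)
  also have "\<dots> = (\<integral>\<^sup>+\<omega>. G \<omega> * (\<integral>\<^sup>+y. k s t (Y s \<omega>) y * (\<phi> y * (\<integral>\<^sup>+z. k t u y z * h z \<partial>S)) \<partial>S) \<partial>P)"
    using st by (intro nn_transition G) auto
  also have "\<dots> = (\<integral>\<^sup>+\<omega>. G \<omega> * (\<integral>\<^sup>+z. h z * (\<integral>\<^sup>+y. k s t (Y s \<omega>) y * k t u y z * \<phi> y \<partial>S) \<partial>S) \<partial>P)"
  proof (intro nn_integral_cong)
    fix \<omega> assume \<omega>: "\<omega> \<in> space P"
    have x: "Y s \<omega> \<in> space S"
      using Y_in_space st \<omega> by blast
    have [measurable]: "k s t (Y s \<omega>) \<in> borel_measurable S"
      using measurable_compose[OF measurable_Pair1'[OF x] measurable_k[OF st(1,2,4)]] by simp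
    have "(\<integral>\<^sup>+y. k s t (Y s \<omega>) y * (\<phi> y * (\<integral>\<^sup>+z. k t u y z * h z \<partial>S)) \<partial>S)
      = (\<integral>\<^sup>+y. (\<integral>\<^sup>+z. h z * (k s t (Y s \<omega>) y * k t u y z * \<phi> y) \<partial>S) \<partial>S)"
      by (intro nn_integral_cong, subst mult.assoc[symmetric], subst nn_integral_cmult[symmetric])
        (measurable, simp add: mult_ac)
    also have "\<dots> = (\<integral>\<^sup>+z. (\<integral>\<^sup>+y. h z * (k s t (Y s \<omega>) y * k t u y z * \<phi> y) \<partial>S) \<partial>S)"
      by (rule SS.Fubini') measurable
    also have "\<dots> = (\<integral>\<^sup>+z. h z * (\<integral>\<^sup>+y. k s t (Y s \<omega>) y * k t u y z * \<phi> y \<partial>S) \<partial>S)"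
      by (intro nn_integral_cong nn_integral_cmult) measurable
    finally show "G \<omega> * (\<integral>\<^sup>+y. k s t (Y s \<omega>) y * (\<phi> y * (\<integral>\<^sup>+z. k t u y z * h z \<partial>S)) \<partial>S)
      = G \<omega> * (\<integral>\<^sup>+z. h z * (\<integral>\<^sup>+y. k s t (Y s \<omega>) y * k t u y z * \<phi> y \<partial>S) \<partial>S)"
      by simp
  qed
  finally show ?thesis .
qed

text \<open>Two terms with separated variables are enough for each side of both moment relations,
  and separation lets \<open>nn_transition2\<close> act on each term.\<close>

lemma nn_transition2_sum:
  assumes st: "s \<in> T" "t \<in> T" "u \<in> T" "s < t" "t < u" and E: "E \<in> sets (past s)"
    and a: "a1 \<in> borel_measurable S" "a2 \<in> borel_measurable S"
    and [measurable]: "\<phi>1 \<in> borel_measurable S" "\<phi>2 \<in> borel_measurable S"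
      "b1 \<in> borel_measurable S" "b2 \<in> borel_measurable S" "h \<in> borel_measurable S"
  shows "(\<integral>\<^sup>+\<omega>. indicator E \<omega> *
      (a1 (Y s \<omega>) * \<phi>1 (Y t \<omega>) * b1 (Y u \<omega>) + a2 (Y s \<omega>) * \<phi>2 (Y t \<omega>) * b2 (Y u \<omega>)) * h (Y u \<omega>) \<partial>P)
    = (\<integral>\<^sup>+\<omega>. indicator E \<omega> * (\<integral>\<^sup>+z. h z * (\<integral>\<^sup>+y. k s t (Y s \<omega>) y * k t u y z *
      (a1 (Y s \<omega>) * \<phi>1 y * b1 z + a2 (Y s \<omega>) * \<phi>2 y * b2 z) \<partial>S) \<partial>S) \<partial>P)"
    (is "?lhs = ?rhs")
proof -
  note [measurable] = measurable_k[OF st(1,2,4)] measurable_k[OF st(2,3,5)]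
    measurable_Y[OF st(1)] measurable_Y[OF st(2)] measurable_Y[OF st(3)] a
  have [measurable]: "E \<in> sets P"
    using E subalgebra_past by (auto simp: subalgebra_def)
  have k_x: "k s t (Y s \<omega>) \<in> borel_measurable S" if "\<omega> \<in> space P" for \<omega>
    using measurable_compose[OF measurable_Pair1'[OF Y_in_space[OF st(1) that]] measurable_k[OF st(1,2,4)]] by simp
  have k_z: "(\<lambda>y. k t u y z) \<in> borel_measurable S" if "z \<in> space S" for z
    using measurable_compose[OF measurable_Pair2'[OF that] measurable_k[OF st(2,3,5)]] by simp
  let ?J = "\<lambda>a \<phi> b \<omega> z. h z * (\<integral>\<^sup>+y. k s t (Y s \<omega>) y * k t u y z * (a (Y s \<omega>) * \<phi> y * b z) \<partial>S)"
  let ?I = "\<lambda>a \<phi> b. (\<integral>\<^sup>+\<omega>. indicator E \<omega> * (\<integral>\<^sup>+z. ?J a \<phi> b \<omega> z \<partial>S) \<partial>P)"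
  have single: "(\<integral>\<^sup>+\<omega>. indicator E \<omega> * (a (Y s \<omega>) * \<phi> (Y t \<omega>) * b (Y u \<omega>)) * h (Y u \<omega>) \<partial>P) = ?I a \<phi> b"
    if m: "a \<in> borel_measurable S" and [measurable]: "\<phi> \<in> borel_measurable S" "b \<in> borel_measurable S" for a \<phi> b
  proof -
    have G: "(\<lambda>\<omega>. indicator E \<omega> * a (Y s \<omega>)) \<in> borel_measurable (past s)"
    proof -
      note [measurable] = E measurable_compose[OF measurable_Y_past[OF st(1) order_refl] m]
      show ?thesis
        by measurable
    qed
    have "(\<integral>\<^sup>+\<omega>. indicator E \<omega> * (a (Y s \<omega>) * \<phi> (Y t \<omega>) * b (Y u \<omega>)) * h (Y u \<omega>) \<partial>P)
      = (\<integral>\<^sup>+\<omega>. (indicator E \<omega> * a (Y s \<omega>)) * \<phi> (Y t \<omega>) * (\<lambda>z. b z * h z) (Y u \<omega>) \<partial>P)"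
      by (simp add: mult.assoc)
    also have "\<dots> = (\<integral>\<^sup>+\<omega>. (indicator E \<omega> * a (Y s \<omega>)) *
       (\<integral>\<^sup>+z. (b z * h z) * (\<integral>\<^sup>+y. k s t (Y s \<omega>) y * k t u y z * \<phi> y \<partial>S) \<partial>S) \<partial>P)"
      using st G by (intro nn_transition2) auto
    also have "\<dots> = ?I a \<phi> b"
    proof (intro nn_integral_cong)
      fix \<omega> assume \<omega>: "\<omega> \<in> space P"
      note [measurable] = k_x[OF \<omega>]
      let ?K = "\<lambda>z. \<integral>\<^sup>+y. k s t (Y s \<omega>) y * k t u y z * \<phi> y \<partial>S"
      have "a (Y s \<omega>) * (\<integral>\<^sup>+z. (b z * h z) * ?K z \<partial>S) = (\<integral>\<^sup>+z. a (Y s \<omega>) * ((b z * h z) * ?K z) \<partial>S)"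
        by (rule nn_integral_cmult[symmetric]) measurable
      also have "\<dots> = (\<integral>\<^sup>+z. ?J a \<phi> b \<omega> z \<partial>S)"
      proof (intro nn_integral_cong)
        fix z assume z: "z \<in> space S"
        note [measurable] = k_z[OF z]
        have "(\<integral>\<^sup>+y. k s t (Y s \<omega>) y * k t u y z * (a (Y s \<omega>) * \<phi> y * b z) \<partial>S)
          = (\<integral>\<^sup>+y. (a (Y s \<omega>) * b z) * (k s t (Y s \<omega>) y * k t u y z * \<phi> y) \<partial>S)"
          by (simp add: mult_ac)
        also have "\<dots> = (a (Y s \<omega>) * b z) * ?K z"
          by (rule nn_integral_cmult) measurable
        finally show "a (Y s \<omega>) * ((b z * h z) * ?K z) = ?J a \<phi> b \<omega> z"
          by (simp add: mult_ac)
      qed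
      finally show "(indicator E \<omega> * a (Y s \<omega>)) * (\<integral>\<^sup>+z. (b z * h z) * ?K z \<partial>S)
        = indicator E \<omega> * (\<integral>\<^sup>+z. ?J a \<phi> b \<omega> z \<partial>S)"
        by (simp add: mult.assoc)
    qed
    finally show ?thesis .
  qed
  have "?lhs = (\<integral>\<^sup>+\<omega>. indicator E \<omega> * (a1 (Y s \<omega>) * \<phi>1 (Y t \<omega>) * b1 (Y u \<omega>)) * h (Y u \<omega>)
      + indicator E \<omega> * (a2 (Y s \<omega>) * \<phi>2 (Y t \<omega>) * b2 (Y u \<omega>)) * h (Y u \<omega>) \<partial>P)"
    by (simp add: distrib_left distrib_right)
  also have "\<dots> = ?I a1 \<phi>1 b1 + ?I a2 \<phi>2 b2"
    using a by (subst nn_integral_add) (measurable, simp add: single)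
  also have "\<dots> = (\<integral>\<^sup>+\<omega>. indicator E \<omega> * (\<integral>\<^sup>+z. ?J a1 \<phi>1 b1 \<omega> z \<partial>S)
      + indicator E \<omega> * (\<integral>\<^sup>+z. ?J a2 \<phi>2 b2 \<omega> z \<partial>S) \<partial>P)"
    by (rule nn_integral_add[symmetric]) measurable
  also have "\<dots> = ?rhs"
  proof (intro nn_integral_cong)
    fix \<omega> assume \<omega>: "\<omega> \<in> space P"
    note [measurable] = k_x[OF \<omega>]
    let ?L = "\<lambda>z. h z * (\<integral>\<^sup>+y. k s t (Y s \<omega>) y * k t u y z *
      (a1 (Y s \<omega>) * \<phi>1 y * b1 z + a2 (Y s \<omega>) * \<phi>2 y * b2 z) \<partial>S)"
    have "(\<integral>\<^sup>+z. ?J a1 \<phi>1 b1 \<omega> z \<partial>S) + (\<integral>\<^sup>+z. ?J a2 \<phi>2 b2 \<omega> z \<partial>S) = (\<integral>\<^sup>+z. ?J a1 \<phi>1 b1 \<omega> z + ?J a2 \<phi>2 b2 \<omega> z \<partial>S)"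
      by (rule nn_integral_add[symmetric]) measurable
    also have "\<dots> = (\<integral>\<^sup>+z. ?L z \<partial>S)"
    proof (intro nn_integral_cong)
      fix z assume z: "z \<in> space S"
      note [measurable] = k_z[OF z]
      show "?J a1 \<phi>1 b1 \<omega> z + ?J a2 \<phi>2 b2 \<omega> z = ?L z"
        unfolding distrib_left by (subst nn_integral_add) (measurable, simp add: distrib_left)
    qed
    finally show "indicator E \<omega> * (\<integral>\<^sup>+z. ?J a1 \<phi>1 b1 \<omega> z \<partial>S) + indicator E \<omega> * (\<integral>\<^sup>+z. ?J a2 \<phi>2 b2 \<omega> z \<partial>S)
      = indicator E \<omega> * (\<integral>\<^sup>+z. ?L z \<partial>S)"
      by (simp flip: distrib_left)
  qed
  finally show ?thesis .
qed

text \<open>Backward recursion over the earliest time b: the indicator at b times the function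
  belonging to the later times, integrated against the transition from u to b unless u = b. Both u
  and \<open>G\<close> must vary: the induction hypothesis is used at time b, with the indicator at
  b absorbed into \<open>G\<close>.\<close>

lemma future_cylinder:
  assumes "finite I" "I \<subseteq> T" "u \<in> T" "\<And>i. i \<in> I \<Longrightarrow> u \<le> i" "\<And>i. i \<in> I \<Longrightarrow> B i \<in> sets S"
  shows "\<exists>h \<in> borel_measurable S. \<forall>G \<in> borel_measurable (past u).
    (\<integral>\<^sup>+\<omega>. G \<omega> * (\<Prod>i\<in>I. indicator (B i) (Y i \<omega>)) \<partial>P) = (\<integral>\<^sup>+\<omega>. G \<omega> * h (Y u \<omega>) \<partial>P)"
  using assms
proof (induction I arbitrary: u rule: finite_linorder_min_induct)
  case empty
  then show ?case
    by (intro bexI[of _ "\<lambda>_. 1"]) auto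
next
  case (insert b I)
  have b: "b \<in> T" and [measurable]: "B b \<in> sets S"
    using insert by auto
  obtain h where h [measurable]: "h \<in> borel_measurable S" and hG: "\<And>G. G \<in> borel_measurable (past b) \<Longrightarrow>
    (\<integral>\<^sup>+\<omega>. G \<omega> * (\<Prod>i\<in>I. indicator (B i) (Y i \<omega>)) \<partial>P) = (\<integral>\<^sup>+\<omega>. G \<omega> * h (Y b \<omega>) \<partial>P)"
    using insert.IH[of b] insert.hyps insert.prems by fastforce
  define h' where "h' y = indicator (B b) y * h y" for y
  have h' [measurable]: "h' \<in> borel_measurable S"
    unfolding h'_def by measurable
  have step: "(\<integral>\<^sup>+\<omega>. G \<omega> * (\<Prod>i\<in>insert b I. indicator (B i) (Y i \<omega>)) \<partial>P) = (\<integral>\<^sup>+\<omega>. G \<omega> * h' (Y b \<omega>) \<partial>P)"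
    if G: "G \<in> borel_measurable (past u)" for G
  proof -
    have "u \<le> b"
      using insert.prems by simp
    note [measurable] = measurable_Y_past[OF b order_refl] measurable_past_mono[OF G \<open>u \<le> b\<close>]
    have "(\<integral>\<^sup>+\<omega>. G \<omega> * (\<Prod>i\<in>insert b I. indicator (B i) (Y i \<omega>)) \<partial>P)
      = (\<integral>\<^sup>+\<omega>. (G \<omega> * indicator (B b) (Y b \<omega>)) * (\<Prod>i\<in>I. indicator (B i) (Y i \<omega>)) \<partial>P)"
      using insert.hyps by (subst prod.insert) (auto simp: mult.assoc)
    also have "\<dots> = (\<integral>\<^sup>+\<omega>. (G \<omega> * indicator (B b) (Y b \<omega>)) * h (Y b \<omega>) \<partial>P)"
      by (rule hG) measurable
    finally show ?thesis
      by (simp add: h'_def mult.assoc)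
  qed
  show ?case
  proof (cases "u = b")
    case True
    then show ?thesis
      using step h' by blast
  next
    case False
    then have ub: "u < b"
      using insert.prems by (simp add: less_le)
    note [measurable] = measurable_k[OF insert.prems(2) b ub]
    have "(\<lambda>x. \<integral>\<^sup>+y. k u b x y * h' y \<partial>S) \<in> borel_measurable S"
      by measurable
    moreover have "(\<integral>\<^sup>+\<omega>. G \<omega> * (\<Prod>i\<in>insert b I. indicator (B i) (Y i \<omega>)) \<partial>P)
       = (\<integral>\<^sup>+\<omega>. G \<omega> * (\<integral>\<^sup>+y. k u b (Y u \<omega>) y * h' y \<partial>S) \<partial>P)" if G: "G \<in> borel_measurable (past u)" for G
      unfolding step[OF G] using insert.prems b ub by (intro nn_transition G h') auto
    ultimately show ?thesis
      by (intro bexI[of _ "\<lambda>x. \<integral>\<^sup>+y. k u b x y * h' y \<partial>S"]) auto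
  qed
qed

text \<open>
  To identify a conditional expectation given past and future it suffices to test against
  \<open>1\<^sub>E h(Y u)\<close> with \<open>E\<close> in the past: cylinders generate, and their future part may be
  replaced by a function of \<open>Y u\<close> by the Markov property.
\<close>

lemma bridge_integral_eqI:
  assumes st: "s \<in> T" "u \<in> T" "s < u"
    and U: "U \<in> borel_measurable (past u)" and V: "V \<in> borel_measurable (past u)"
    and fin: "(\<integral>\<^sup>+\<omega>. U \<omega> \<partial>P) < \<infinity>"
    and eq: "\<And>E h. E \<in> sets (past s) \<Longrightarrow> h \<in> borel_measurable S \<Longrightarrow>
      (\<integral>\<^sup>+\<omega>. indicator E \<omega> * U \<omega> * h (Y u \<omega>) \<partial>P) = (\<integral>\<^sup>+\<omega>. indicator E \<omega> * V \<omega> * h (Y u \<omega>) \<partial>P)"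
    and E: "E \<in> sets (generated_field P S Y {r\<in>T. r \<le> s \<or> u \<le> r})"
  shows "(\<integral>\<^sup>+\<omega>\<in>E. U \<omega> \<partial>P) = (\<integral>\<^sup>+\<omega>\<in>E. V \<omega> \<partial>P)"
proof -
  let ?R = "{r\<in>T. r \<le> s \<or> u \<le> r}"
  let ?F = "generated_field P S Y ?R"
  have sub: "subalgebra P ?F"
    by (rule subalgebra_generated_field) (auto intro: measurable_Y)
  define cyl where "cyl I B = {\<omega> \<in> space P. \<forall>i\<in>I. Y i \<omega> \<in> B i}" for I and B :: "real \<Rightarrow> 'b set"
  define \<C> where "\<C> = {cyl I B | I B. finite I \<and> I \<subseteq> ?R \<and> (\<forall>i. B i \<in> sets S)}"
  have [measurable]: "U \<in> borel_measurable P" "V \<in> borel_measurable P"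
    using U V measurable_past_P by auto
  have sets_F: "sets ?F = sigma_sets (space P) \<C>"
  proof
    have "Y r -` B \<inter> space P \<in> \<C>" if "r \<in> ?R" "B \<in> sets S" for r B
      unfolding \<C>_def using that
      by (intro CollectI exI[of _ "{r}"] exI[of _ "\<lambda>_. B"]) (auto simp: cyl_def)
    then show "sets ?F \<subseteq> sigma_sets (space P) \<C>"
      unfolding sets_generated_field by (intro sigma_sets_mono') auto
  next
    have "cyl I B \<in> sets ?F" if "finite I" "I \<subseteq> ?R" "\<And>i. B i \<in> sets S" for I B
    proof -
      have "Y i -` B i \<inter> space ?F \<in> sets ?F" if "i \<in> I" for i
        using that \<open>I \<subseteq> ?R\<close> \<open>B i \<in> sets S\<close> measurable_space[OF measurable_Y]
        by (intro measurable_sets[OF measurable_generated_field]) auto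
      then have "(\<Inter>i\<in>I. Y i -` B i \<inter> space ?F) \<in> sets ?F" if "I \<noteq> {}"
        using that \<open>finite I\<close> by (intro sets.finite_INT) auto
      \<comment> \<open>The case distinction is there because an empty intersection is
        \<open>UNIV\<close>, not the sample space.\<close>
      then have "(if I = {} then space ?F else (\<Inter>i\<in>I. Y i -` B i \<inter> space ?F)) \<in> sets ?F"
        using sets.top[of ?F] by (cases "I = {}") simp_all
      also have "(if I = {} then space ?F else (\<Inter>i\<in>I. Y i -` B i \<inter> space ?F)) = cyl I B"
        by (auto simp: cyl_def)
      finally show ?thesis .
    qed
    then have "\<C> \<subseteq> sets ?F"
      by (auto simp: \<C>_def)
    then show "sigma_sets (space P) \<C> \<subseteq> sets ?F"
      using sets.sigma_sets_subset[of \<C> ?F] by simp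
  qed
  have cyl_eq: "(\<integral>\<^sup>+\<omega>\<in>C. U \<omega> \<partial>P) = (\<integral>\<^sup>+\<omega>\<in>C. V \<omega> \<partial>P)" if C: "C \<in> \<C>" for C
  proof -
    obtain I B where I: "C = cyl I B" "finite I" "I \<subseteq> ?R" "\<And>i. B i \<in> sets S"
      using C by (auto simp: \<C>_def)
    define J where "J = {i\<in>I. u \<le> i}"
    define E1 where "E1 = cyl {i\<in>I. i \<le> s} B"
    have IJ: "I = {i\<in>I. i \<le> s} \<union> J"
      using I by (auto simp: J_def)
    have E1: "E1 \<in> sets (past s)"
    proof -
      have "Y i -` B i \<inter> space (past s) \<in> sets (past s)" if "i \<in> I" "i \<le> s" for i
        using that I by (intro measurable_sets[OF measurable_Y_past]) auto
      then have "(\<Inter>i\<in>{i\<in>I. i \<le> s}. Y i -` B i \<inter> space (past s)) \<in> sets (past s)"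
        if "{i\<in>I. i \<le> s} \<noteq> {}"
        using that I(2) by (intro sets.finite_INT) auto
      then have "space (past s) \<inter> (\<Inter>i\<in>{i\<in>I. i \<le> s}. Y i -` B i \<inter> space (past s)) \<in> sets (past s)"
        using sets.top[of "past s"] by (cases "{i\<in>I. i \<le> s} = {}") (simp only: Inter_empty image_empty Int_UNIV_right, intro sets.Int)
      also have "space (past s) \<inter> (\<Inter>i\<in>{i\<in>I. i \<le> s}. Y i -` B i \<inter> space (past s)) = E1"
        by (auto simp: E1_def cyl_def)
      finally show ?thesis .
    qed
    have E1u: "E1 \<in> sets (past u)"
    proof -
      have "{r\<in>T. r \<le> s} \<subseteq> {r\<in>T. r \<le> u}"
        using st by auto
      from subalgebra_generated_field_mono[OF this, of P S Y] show ?thesis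
        using E1 by (auto simp: subalgebra_def)
    qed
    have "\<exists>h \<in> borel_measurable S. \<forall>G \<in> borel_measurable (past u).
      (\<integral>\<^sup>+\<omega>. G \<omega> * (\<Prod>i\<in>J. indicator (B i) (Y i \<omega>)) \<partial>P) = (\<integral>\<^sup>+\<omega>. G \<omega> * h (Y u \<omega>) \<partial>P)"
      by (rule future_cylinder) (use I st in \<open>auto simp: J_def\<close>)
    then obtain h where h: "h \<in> borel_measurable S" "\<And>G. G \<in> borel_measurable (past u) \<Longrightarrow>
      (\<integral>\<^sup>+\<omega>. G \<omega> * (\<Prod>i\<in>J. indicator (B i) (Y i \<omega>)) \<partial>P) = (\<integral>\<^sup>+\<omega>. G \<omega> * h (Y u \<omega>) \<partial>P)"
      by blast
    \<comment> \<open>\<open>W\<close> may involve times between s and u. It belongs to the past of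
      u, so the part of the cylinder from u on can still be replaced by
      \<open>h (Y u)\<close>.\<close>
    have cyl_int: "(\<integral>\<^sup>+\<omega>\<in>C. W \<omega> \<partial>P) = (\<integral>\<^sup>+\<omega>. indicator E1 \<omega> * W \<omega> * h (Y u \<omega>) \<partial>P)"
      if W: "W \<in> borel_measurable (past u)" for W
    proof -
      have "W \<omega> * indicator C \<omega> = (indicator E1 \<omega> * W \<omega>) * (\<Prod>i\<in>J. indicator (B i) (Y i \<omega>))"
        if "\<omega> \<in> space P" for \<omega>
      proof -
        have "finite J"
          using I by (simp add: J_def)
        then have "(\<Prod>i\<in>J. indicator (B i) (Y i \<omega>)) = (if \<forall>i\<in>J. Y i \<omega> \<in> B i then 1 else 0 :: ennreal)"
          by induction (auto simp: indicator_def)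
        moreover have "\<omega> \<in> C \<longleftrightarrow> \<omega> \<in> E1 \<and> (\<forall>i\<in>J. Y i \<omega> \<in> B i)"
          using IJ that unfolding I(1) E1_def cyl_def by blast
        ultimately show ?thesis
          by (auto simp: indicator_def)
      qed
      then have "(\<integral>\<^sup>+\<omega>\<in>C. W \<omega> \<partial>P) = (\<integral>\<^sup>+\<omega>. (indicator E1 \<omega> * W \<omega>) * (\<Prod>i\<in>J. indicator (B i) (Y i \<omega>)) \<partial>P)"
        by (rule nn_integral_cong)
      also have "\<dots> = (\<integral>\<^sup>+\<omega>. indicator E1 \<omega> * W \<omega> * h (Y u \<omega>) \<partial>P)"
        by (intro h borel_measurable_times_ennreal borel_measurable_indicator E1u W)
      finally show ?thesis .
    qed
    show ?thesis
      unfolding cyl_int[OF U] cyl_int[OF V] using E1 h(1) by (rule eq)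
  qed
  \<comment> \<open>\<open>U\<close> and \<open>V\<close> become densities of measures on
    \<open>?F\<close>. The cylinders are an intersection-stable generator, and \<open>fin\<close>
    gives the finiteness that uniqueness of measures asks for.\<close>
  let ?U = "restr_to_subalg (density P U) ?F" and ?V = "restr_to_subalg (density P V) ?F"
  have subU: "subalgebra (density P U) ?F" "subalgebra (density P V) ?F"
    using sub by (auto simp: subalgebra_def)
  have em: "emeasure ?U C = (\<integral>\<^sup>+\<omega>\<in>C. U \<omega> \<partial>P)" "emeasure ?V C = (\<integral>\<^sup>+\<omega>\<in>C. V \<omega> \<partial>P)" if "C \<in> sets ?F" for C
    using that sub by (auto simp: emeasure_restr_to_subalg[OF subU(1)] emeasure_restr_to_subalg[OF subU(2)]
        emeasure_density subalgebra_def)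
  have "?U = ?V"
  proof (rule measure_eqI_generator_eq[where \<Omega> = "space P" and E = \<C> and A = "\<lambda>_::nat. space P"])
    show "Int_stable \<C>"
    proof (rule Int_stableI)
      fix a b assume "a \<in> \<C>" "b \<in> \<C>"
      then obtain I B J B' where ab: "a = cyl I B" "finite I" "I \<subseteq> ?R" "\<And>i. B i \<in> sets S"
        "b = cyl J B'" "finite J" "J \<subseteq> ?R" "\<And>i. B' i \<in> sets S"
        by (auto simp: \<C>_def)
      \<comment> \<open>\<open>space S\<close> is the neutral constraint at times where a cylinder
        prescribes nothing.\<close>
      let ?B = "\<lambda>i. (if i \<in> I then B i else space S) \<inter> (if i \<in> J then B' i else space S)"
      have "Y i \<omega> \<in> space S" if "\<omega> \<in> space P" "i \<in> I \<union> J" for \<omega> i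
        using that ab Y_in_space by blast
      then have "a \<inter> b = cyl (I \<union> J) ?B"
        unfolding ab cyl_def by (auto split: if_splits)
      moreover have "\<forall>i. ?B i \<in> sets S"
        using ab by auto
      ultimately show "a \<inter> b \<in> \<C>"
        unfolding \<C>_def using ab by (intro CollectI exI[of _ "I \<union> J"] exI[of _ ?B]) auto
    qed
    show "\<C> \<subseteq> Pow (space P)"
      by (auto simp: \<C>_def cyl_def)
    show "sets ?U = sigma_sets (space P) \<C>" "sets ?V = sigma_sets (space P) \<C>"
      using subU by (simp_all add: sets_restr_to_subalg sets_F)
    show "emeasure ?U X = emeasure ?V X" if "X \<in> \<C>" for X
    proof -
      have "X \<in> sets ?F"
        using that by (auto simp: sets_F)
      then show ?thesis
        using cyl_eq[OF that] by (simp add: em)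
    qed
    show "range (\<lambda>_::nat. space P) \<subseteq> \<C>"
      unfolding \<C>_def by (auto intro!: exI[of _ "{}"] exI[of _ "\<lambda>_. {}"] simp: cyl_def)
    show "emeasure ?U (space P) \<noteq> \<infinity>" for i :: nat
    proof -
      have "emeasure ?U (space P) = (\<integral>\<^sup>+\<omega>\<in>space P. U \<omega> \<partial>P)"
        using sets.top[of ?F] by (intro em) simp
      also have "\<dots> = (\<integral>\<^sup>+\<omega>. U \<omega> \<partial>P)"
        by (rule nn_integral_cong) simp
      finally show ?thesis
        using fin by simp
    qed
  qed auto
  then show ?thesis
    using em[OF E] by simp
qed

end

section \<open>The Wilson process\<close>

lemma Gamma_nonzero: "Re z > 0 \<Longrightarrow> Gamma z \<noteq> (0::complex)"
  by (auto simp: Gamma_eq_zero_iff elim!: nonpos_Ints_cases)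

lemma conj_pair_shift: "conj_pair a b \<Longrightarrow> Re a + \<delta> > 0 \<Longrightarrow> Re b + \<delta> > 0 \<Longrightarrow>
  conj_pair (a + of_real \<delta>) (b + of_real \<delta>)"
  by (auto simp: conj_pair_def)

lemma conj_pair_cnj: "\<delta> > 0 \<Longrightarrow> conj_pair (of_real \<delta> + \<i> * of_real v) (of_real \<delta> - \<i> * of_real v)"
  by (simp add: conj_pair_def)

text \<open>When the last two parameters are conjugate, the four mixed Gamma factors combine into a
  squared modulus, and everything else is independent of v. In the process, with a = A - t and
  \<delta> = t - s, the modulus is taken at A - s + iv and B - s + iv, so it depends on the starting
  time and value but not on t.\<close>

lemma wilson_const_shift:
  assumes ab: "conj_pair a b" and \<delta>: "\<delta> > 0"
  shows "\<exists>\<kappa>\<ge>0. \<forall>v. Re (wilson_const a b (of_real \<delta> + \<i> * of_real v) (of_real \<delta> - \<i> * of_real v))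
    = \<kappa> / (norm (Gamma (a + of_real \<delta> + \<i> * of_real v) * Gamma (b + of_real \<delta> + \<i> * of_real v)))\<^sup>2"
proof -
  define \<sigma> where "\<sigma> = Re (a + b)"
  have \<sigma>: "a + b = of_real \<sigma>" "\<sigma> > 0"
    using conj_pair_sum[OF ab] ab by (auto simp: \<sigma>_def conj_pair_def)
  define \<kappa> where "\<kappa> = Gamma (\<sigma> + 2 * \<delta>) / (4 * pi * Gamma \<sigma> * Gamma (2 * \<delta>))"
  have "Gamma (\<sigma> + 2 * \<delta>) > 0" "Gamma \<sigma> > 0" "Gamma (2 * \<delta>) > 0"
    using \<sigma> \<delta> by (auto intro!: Gamma_real_pos)
  then have \<kappa>: "\<kappa> \<ge> 0"
    by (simp add: \<kappa>_def)
  have "wilson_const a b (of_real \<delta> + \<i> * of_real v) (of_real \<delta> - \<i> * of_real v)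
    = of_real (\<kappa> / (norm (Gamma (a + of_real \<delta> + \<i> * of_real v) * Gamma (b + of_real \<delta> + \<i> * of_real v)))\<^sup>2)" for v
  proof -
    let ?c = "of_real \<delta> + \<i> * complex_of_real v" and ?d = "of_real \<delta> - \<i> * complex_of_real v"
    let ?g = "Gamma (a + of_real \<delta> + \<i> * of_real v) * Gamma (b + of_real \<delta> + \<i> * of_real v)"
    have "Gamma (a + ?d) * Gamma (b + ?d) = cnj ?g"
      using conj_pair_cnj_Gamma[OF conj_pair_shift[OF ab, of \<delta>], of v] ab \<delta>
      by (simp add: conj_pair_def add_diff_eq)
    then have g: "Gamma (a + ?c) * Gamma (b + ?c) * (Gamma (a + ?d) * Gamma (b + ?d)) = of_real ((norm ?g)\<^sup>2)"
      by (simp only: complex_norm_square add.assoc)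
    have "a + b + ?c + ?d = of_real (\<sigma> + 2 * \<delta>)"
      using \<sigma>(1) by (simp add: algebra_simps)
    moreover have "?c + ?d = of_real (2 * \<delta>)"
      by simp
    ultimately have "wilson_const a b ?c ?d = of_real (Gamma (\<sigma> + 2 * \<delta>)) /
      (4 * of_real pi * of_real (Gamma \<sigma>) * of_real (Gamma (2 * \<delta>)) *
        (Gamma (a + ?c) * Gamma (b + ?c) * (Gamma (a + ?d) * Gamma (b + ?d))))"
      unfolding wilson_const_def \<sigma>(1) by (simp only: Gamma_complex_of_real mult_ac)
    also have "\<dots> = of_real (\<kappa> / (norm ?g)\<^sup>2)"
      unfolding g by (simp add: \<kappa>_def)
    finally show ?thesis .
  qed
  then show ?thesis
    using \<kappa> by (intro exI[of _ \<kappa>]) simp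
qed

lemma wilson_const_shift_nonneg:
  assumes "conj_pair a b" "\<delta> > 0"
  shows "Re (wilson_const a b (of_real \<delta> + \<i> * of_real v) (of_real \<delta> - \<i> * of_real v)) \<ge> 0"
proof -
  obtain \<kappa> where "\<kappa> \<ge> 0" "Re (wilson_const a b (of_real \<delta> + \<i> * of_real v) (of_real \<delta> - \<i> * of_real v))
    = \<kappa> / (norm (Gamma (a + of_real \<delta> + \<i> * of_real v) * Gamma (b + of_real \<delta> + \<i> * of_real v)))\<^sup>2"
    using wilson_const_shift[OF assms] by blast
  then show ?thesis
    by simp
qed

lemma wilson_density_shift_nonneg:
  assumes "conj_pair a b" "\<delta> > 0" "y > 0"
  shows "wilson_density a b (of_real \<delta> + \<i> * of_real v) (of_real \<delta> - \<i> * of_real v) y \<ge> 0"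
  unfolding wilson_density_eq
  using wilson_const_shift_nonneg[OF assms(1,2)] wilson_kernel_nonneg[OF assms(3)]
  by (rule mult_nonneg_nonneg)

abbreviation bridge_kernel :: "real \<Rightarrow> real \<Rightarrow> real \<Rightarrow> real \<Rightarrow> real \<Rightarrow> real" where
  "bridge_kernel d1 d2 x z \<equiv> wilson_kernel (of_real d2 + \<i> * sqrt z) (of_real d2 - \<i> * sqrt z)
     (of_real d1 + \<i> * sqrt x) (of_real d1 - \<i> * sqrt x)"

text \<open>The squared modulus of Gamma(a + i sqrt y) Gamma(b + i sqrt y) stands in the numerator
  of the first density and, by \<open>wilson_const_shift\<close>, in the denominator of the second.
  After cancellation y occurs only in the four bridge factors and in the reference weight.\<close>

lemma wilson_density_bridge:
  assumes ab: "conj_pair a b" and \<delta>: "d1 > 0" "d2 > 0" and ab': "conj_pair (a - of_real d2) (b - of_real d2)"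
    and x: "x > 0" and z: "z > 0"
  shows "\<exists>c\<ge>0. \<forall>y>0.
    wilson_density a b (of_real d1 + \<i> * sqrt x) (of_real d1 - \<i> * sqrt x) y *
    wilson_density (a - of_real d2) (b - of_real d2) (of_real d2 + \<i> * sqrt y) (of_real d2 - \<i> * sqrt y) z
    = c * bridge_kernel d1 d2 x z y"
proof -
  obtain \<kappa>1 where \<kappa>1: "\<kappa>1 \<ge> 0" "\<And>v. Re (wilson_const a b (of_real d1 + \<i> * of_real v) (of_real d1 - \<i> * of_real v))
    = \<kappa>1 / (norm (Gamma (a + of_real d1 + \<i> * of_real v) * Gamma (b + of_real d1 + \<i> * of_real v)))\<^sup>2"
    using wilson_const_shift[OF ab \<delta>(1)] by blast
  obtain \<kappa>2 where \<kappa>2: "\<kappa>2 \<ge> 0" "\<And>v. Re (wilson_const (a - of_real d2) (b - of_real d2) (of_real d2 + \<i> * of_real v) (of_real d2 - \<i> * of_real v))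
    = \<kappa>2 / (norm (Gamma (a + \<i> * of_real v) * Gamma (b + \<i> * of_real v)))\<^sup>2"
    using wilson_const_shift[OF ab' \<delta>(2)] by auto
  \<comment> \<open>\<open>K1\<close> collects what depends on x but not on y or z, \<open>g\<close>
    what depends on z alone; both go into the constant.\<close>
  define K1 where "K1 = \<kappa>1 / (norm (Gamma (a + of_real d1 + \<i> * sqrt x) * Gamma (b + of_real d1 + \<i> * sqrt x)))\<^sup>2"
  define g where "g = (norm (Gamma (a - of_real d2 + \<i> * sqrt z) * Gamma (b - of_real d2 + \<i> * sqrt z)))\<^sup>2
    / (sqrt z * (norm (Gamma (2 * \<i> * sqrt z)))\<^sup>2)"
  have nonneg: "K1 * \<kappa>2 * g \<ge> 0"
    using \<kappa>1(1) \<kappa>2(1) z by (simp add: K1_def g_def)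
  have "wilson_density a b (of_real d1 + \<i> * sqrt x) (of_real d1 - \<i> * sqrt x) y *
    wilson_density (a - of_real d2) (b - of_real d2) (of_real d2 + \<i> * sqrt y) (of_real d2 - \<i> * sqrt y) z
    = K1 * \<kappa>2 * g * bridge_kernel d1 d2 x z y" if y: "y > 0" for y
  proof -
    let ?h = "norm (Gamma (a + \<i> * sqrt y) * Gamma (b + \<i> * sqrt y))"
    have h: "?h > 0"
      using ab Gamma_nonzero[of "a + \<i> * sqrt y"] Gamma_nonzero[of "b + \<i> * sqrt y"]
      by (simp add: conj_pair_def)
    \<comment> \<open>The second density is evaluated at z with y as its starting point; conjugation
      exchanges the roles of y and z in this factor.\<close>
    have "norm (Gamma (of_real d2 - \<i> * sqrt y + \<i> * sqrt z)) = norm (cnj (Gamma (of_real d2 - \<i> * sqrt z + \<i> * sqrt y)))"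
      by (simp add: cnj_Gamma algebra_simps)
    then have c: "norm (Gamma (of_real d2 - \<i> * sqrt y + \<i> * sqrt z)) = norm (Gamma (of_real d2 - \<i> * sqrt z + \<i> * sqrt y))"
      by simp
    have c': "of_real d2 + \<i> * sqrt y + \<i> * sqrt z = of_real d2 + \<i> * sqrt z + \<i> * sqrt y"
      by simp
    let ?q1 = "norm (Gamma (of_real d1 + \<i> * sqrt x + \<i> * sqrt y)) * norm (Gamma (of_real d1 - \<i> * sqrt x + \<i> * sqrt y))"
    let ?q2 = "norm (Gamma (of_real d2 + \<i> * sqrt z + \<i> * sqrt y)) * norm (Gamma (of_real d2 - \<i> * sqrt z + \<i> * sqrt y))"
    let ?\<nu> = "sqrt y * (norm (Gamma (2 * \<i> * sqrt y)))\<^sup>2"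
    have "wilson_density a b (of_real d1 + \<i> * sqrt x) (of_real d1 - \<i> * sqrt x) y = K1 * (?h * ?q1)\<^sup>2 / ?\<nu>"
    proof -
      have "Re (wilson_const a b (of_real d1 + \<i> * sqrt x) (of_real d1 - \<i> * sqrt x)) = K1"
        unfolding K1_def by (rule \<kappa>1(2))
      then show ?thesis
        unfolding wilson_density_def norm_mult by (simp only: mult_ac)
    qed
    moreover have "wilson_density (a - of_real d2) (b - of_real d2) (of_real d2 + \<i> * sqrt y) (of_real d2 - \<i> * sqrt y) z
      = \<kappa>2 / ?h\<^sup>2 * g * ?q2\<^sup>2"
      unfolding wilson_density_def \<kappa>2(2) g_def norm_mult c c' by (simp add: power_mult_distrib)
    moreover have "bridge_kernel d1 d2 x z y = (?q2 * ?q1)\<^sup>2 / ?\<nu>"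
      unfolding wilson_kernel_def norm_mult by (simp only: mult.assoc)
    moreover have "K1 * (?h * ?q1)\<^sup>2 / ?\<nu> * (\<kappa>2 / ?h\<^sup>2 * g * ?q2\<^sup>2) = K1 * \<kappa>2 * g * ((?q2 * ?q1)\<^sup>2 / ?\<nu>)"
      using h by (simp add: power_mult_distrib del: norm_mult)
    ultimately show ?thesis
      by simp
  qed
  then show ?thesis
    using nonneg by blast
qed

lemma space_pos_lborel [simp]: "space pos_lborel = {0<..}"
  by (simp add: pos_lborel_def space_restrict_space)

lemma sets_pos_lborel: "sets pos_lborel = sets (restrict_space borel {0<..})"
  by (simp add: pos_lborel_def sets_restrict_space)

lemma measurable_pos_lborel_id [measurable]: "(\<lambda>x. x) \<in> borel_measurable pos_lborel"
  by (simp add: pos_lborel_def measurable_restrict_space1)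

lemma sigma_finite_pos_lborel: "sigma_finite_measure pos_lborel"
  unfolding pos_lborel_def
  by (rule sigma_finite_measure_restrict_space[OF sigma_finite_lborel]) simp

definition transition_density :: "complex \<Rightarrow> complex \<Rightarrow> real \<Rightarrow> real \<Rightarrow> real \<Rightarrow> real \<Rightarrow> real" where
  "transition_density A B s t x y = wilson_density (A - of_real t) (B - of_real t)
     (of_real (t - s) + \<i> * of_real (sqrt x)) (of_real (t - s) - \<i> * of_real (sqrt x)) y"

lemma measurable_transition_density [measurable]:
  "(\<lambda>(x, y). transition_density A B s t x y) \<in> borel_measurable (pos_lborel \<Otimes>\<^sub>M pos_lborel)"
proof -
  have [measurable]: "fst \<in> borel_measurable (pos_lborel \<Otimes>\<^sub>M pos_lborel)" "snd \<in> borel_measurable (pos_lborel \<Otimes>\<^sub>M pos_lborel)"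
    using measurable_compose[OF measurable_fst measurable_pos_lborel_id]
      measurable_compose[OF measurable_snd measurable_pos_lborel_id] by simp_all
  show ?thesis
    unfolding transition_density_def wilson_density_def wilson_const_def split_beta by measurable
qed

lemma esym_bridge:
  fixes d1 d2 v w :: real
  defines "a \<equiv> of_real d2 + \<i> * of_real w" and "b \<equiv> of_real d2 - \<i> * of_real w"
    and "c \<equiv> of_real d1 + \<i> * of_real v" and "d \<equiv> of_real d1 - \<i> * of_real v"
  shows "esym1 a b c d = 2 * (d1 + d2)"
    "esym2 a b c d = (d1\<^sup>2 + v\<^sup>2) + (d2\<^sup>2 + w\<^sup>2) + 4 * d1 * d2"
    "esym3 a b c d = 2 * d2 * (d1\<^sup>2 + v\<^sup>2) + 2 * d1 * (d2\<^sup>2 + w\<^sup>2)"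
    "esym4 a b c d = (d1\<^sup>2 + v\<^sup>2) * (d2\<^sup>2 + w\<^sup>2)"
  by (simp_all add: assms esym1_def esym2_def esym3_def esym4_def power2_eq_square algebra_simps)

definition nonneg_borel :: "(real \<Rightarrow> real) \<Rightarrow> bool" where
  "nonneg_borel f \<longleftrightarrow> f \<in> borel_measurable borel \<and> (\<forall>x>0. 0 \<le> f x)"

locale wilson_bridge =
  fixes A B C D :: complex and P :: "'a measure" and Y :: "real \<Rightarrow> 'a \<Rightarrow> real"
  assumes AB: "conj_pair A B" and CD: "conj_pair C D"
    and ReA_le: "Re A \<le> Re B" and ReC_le: "Re C \<le> Re D"
    and process: "wilson_process A B C D P Y"
begin

definition T :: "real set" where "T = {- Re C<..<Re A}"

lemma pair_AB: "t \<in> T \<Longrightarrow> conj_pair (A - of_real t) (B - of_real t)"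
  and pair_CD: "t \<in> T \<Longrightarrow> conj_pair (C + of_real t) (D + of_real t)"
  using AB CD ReA_le ReC_le by (auto simp: conj_pair_def T_def)

lemma transition_density_nonneg: "s < t \<Longrightarrow> t \<in> T \<Longrightarrow> y > 0 \<Longrightarrow> transition_density A B s t x y \<ge> 0"
  unfolding transition_density_def by (rule wilson_density_shift_nonneg[OF pair_AB]) auto

sublocale density_markov P pos_lborel T "\<lambda>s t x y. ennreal (transition_density A B s t x y)" Y
proof -
  have mp: "markov_process P pos_lborel T
       (\<lambda>t. wilson_measure (A - complex_of_real t) (B - complex_of_real t)
              (C + complex_of_real t) (D + complex_of_real t))
       (\<lambda>s t x. density pos_lborel (\<lambda>y. ennreal (transition_density A B s t x y))) Y"
    using process unfolding wilson_process_def wilson_measure_def transition_density_def T_def .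
  then have "prob_space P"
    by (simp add: markov_process_def)
  then interpret prob_space P .
  interpret sigma_finite_measure pos_lborel
    by (rule sigma_finite_pos_lborel)
  show "density_markov P pos_lborel T (\<lambda>s t x y. ennreal (transition_density A B s t x y)) Y"
  proof
    show "Y t \<in> P \<rightarrow>\<^sub>M pos_lborel" if "t \<in> T" for t
      using mp that by (simp add: markov_process_def)
    show "(\<lambda>(x, y). ennreal (transition_density A B s t x y)) \<in> borel_measurable (pos_lborel \<Otimes>\<^sub>M pos_lborel)" for s t
      using measurable_transition_density[of A B s t] unfolding split_beta by measurable
    show "(\<integral>\<^sup>+y. ennreal (transition_density A B s t x y) \<partial>pos_lborel) < \<infinity>"
      if "s \<in> T" "t \<in> T" "s < t" "x \<in> space pos_lborel" for s t x
    proof -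
      let ?c = "of_real (t - s) + \<i> * complex_of_real (sqrt x)" and ?d = "of_real (t - s) - \<i> * complex_of_real (sqrt x)"
      let ?K = "Re (wilson_const (A - of_real t) (B - of_real t) ?c ?d)"
      have "(\<integral>\<^sup>+y. ennreal (transition_density A B s t x y) \<partial>pos_lborel)
        \<le> (\<integral>\<^sup>+y. ennreal \<bar>?K\<bar> * ennreal (wilson_kernel (A - of_real t) (B - of_real t) ?c ?d y) \<partial>pos_lborel)"
        unfolding transition_density_def wilson_density_eq
        by (intro nn_integral_mono) (simp add: wilson_kernel_nonneg mult_right_mono ennreal_leI flip: ennreal_mult)
      also have "\<dots> = ennreal \<bar>?K\<bar> * (\<integral>\<^sup>+y. ennreal (y ^ 0 * wilson_kernel (A - of_real t) (B - of_real t) ?c ?d y) \<partial>pos_lborel)"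
      proof -
        have [measurable]: "wilson_kernel (A - of_real t) (B - of_real t) ?c ?d \<in> borel_measurable pos_lborel"
          using measurable_compose[OF measurable_pos_lborel_id measurable_wilson_kernel] by simp
        show ?thesis
          by (subst nn_integral_cmult) auto
      qed
      also have "\<dots> < \<infinity>"
        using nn_wilson_moment_finite[OF pair_AB[OF that(2)] conj_pair_cnj, of "t - s" 0 "sqrt x"] that
        by (simp add: ennreal_mult_less_top)
      finally show ?thesis .
    qed
    show "AE \<omega> in P. real_cond_exp P (generated_field P pos_lborel Y {r\<in>T. r \<le> s}) (\<lambda>\<omega>. indicator E (Y t \<omega>)) \<omega>
       = measure (density pos_lborel (\<lambda>y. ennreal (transition_density A B s t (Y s \<omega>) y))) E"
      if "s \<in> T" "t \<in> T" "s < t" "E \<in> sets pos_lborel" for s t E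
      using mp that by (simp add: markov_process_def)
  qed
qed

section \<open>One-time laws and two-time products of the process\<close>

lemma measurable_Y_real: "t \<in> T \<Longrightarrow> Y t \<in> borel_measurable P"
  using measurable_compose[OF measurable_Y measurable_pos_lborel_id] by simp

lemma measurable_Y_field:
  assumes "r \<in> R" "r \<in> T"
  shows "Y r \<in> borel_measurable (generated_field P pos_lborel Y R)"
proof -
  have "Y r \<in> generated_field P pos_lborel Y R \<rightarrow>\<^sub>M pos_lborel"
    using assms measurable_space[OF measurable_Y[OF assms(2)]] by (intro measurable_generated_field) auto
  from measurable_compose[OF this measurable_pos_lborel_id] show ?thesis
    by simp
qed

lemma Y_pos: "t \<in> T \<Longrightarrow> \<omega> \<in> space P \<Longrightarrow> Y t \<omega> > 0"
  using Y_in_space by auto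

abbreviation kernel :: "real \<Rightarrow> real \<Rightarrow> real" where
  "kernel t \<equiv> wilson_kernel (A - of_real t) (B - of_real t) (C + of_real t) (D + of_real t)"

text \<open>The constant may stay unspecified because it is common to both sides of each moment
  relation (\<open>law_integral_eqI\<close>).\<close>

lemma law:
  assumes t: "t \<in> T"
  shows "\<exists>K. \<forall>f\<in>borel_measurable borel. (\<forall>y>0. 0 \<le> f y) \<longrightarrow>
    (\<integral>\<^sup>+\<omega>. ennreal (f (Y t \<omega>)) \<partial>P) = ennreal K * (\<integral>\<^sup>+y. ennreal (f y * kernel t y) \<partial>pos_lborel)"
proof -
  define K where "K = Re (wilson_const (A - of_real t) (B - of_real t) (C + of_real t) (D + of_real t))"
  have [measurable]: "kernel t \<in> borel_measurable pos_lborel"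
    using measurable_compose[OF measurable_pos_lborel_id measurable_wilson_kernel] by simp
  have "distr P pos_lborel (Y t) = density pos_lborel (\<lambda>y. ennreal (K * kernel t y))"
    using process t by (simp add: wilson_process_def markov_process_def wilson_measure_def wilson_density_eq K_def T_def)
  moreover note [measurable] = measurable_Y[OF t]
  ultimately have law: "(\<integral>\<^sup>+\<omega>. \<phi> (Y t \<omega>) \<partial>P) = (\<integral>\<^sup>+y. ennreal (K * kernel t y) * \<phi> y \<partial>pos_lborel)"
    if [measurable]: "\<phi> \<in> borel_measurable pos_lborel" for \<phi>
    using nn_integral_distr[of "Y t" P pos_lborel \<phi>] nn_integral_density[of "\<lambda>y. ennreal (K * kernel t y)" pos_lborel \<phi>]
    by simp
  \<comment> \<open>Otherwise the density would become 0 in \<open>ennreal\<close>, against total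
    mass 1. Positivity is used to split \<open>K\<close> off as a factor in
    \<open>ennreal\<close>.\<close>
  have "K > 0"
  proof (rule ccontr)
    assume "\<not> K > 0"
    then have "ennreal (K * kernel t y) = 0" if "y \<in> space pos_lborel" for y
      using that wilson_kernel_nonneg[of y] by (intro ennreal_neg mult_nonpos_nonneg) auto
    then have "(\<integral>\<^sup>+y. ennreal (K * kernel t y) * 1 \<partial>pos_lborel) = (\<integral>\<^sup>+y. 0 \<partial>pos_lborel)"
      by (intro nn_integral_cong) simp
    with law[of "\<lambda>_. 1"] show False
      by (simp add: emeasure_space_1)
  qed
  have "(\<integral>\<^sup>+\<omega>. ennreal (f (Y t \<omega>)) \<partial>P) = ennreal K * (\<integral>\<^sup>+y. ennreal (f y * kernel t y) \<partial>pos_lborel)"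
    if f: "f \<in> borel_measurable borel" "\<forall>y>0. 0 \<le> f y" for f
  proof -
    have [measurable]: "f \<in> borel_measurable pos_lborel"
      using measurable_compose[OF measurable_pos_lborel_id f(1)] by simp
    have "(\<integral>\<^sup>+y. ennreal (K * kernel t y) * ennreal (f y) \<partial>pos_lborel) = (\<integral>\<^sup>+y. ennreal K * ennreal (f y * kernel t y) \<partial>pos_lborel)"
      using \<open>K > 0\<close> f(2) by (intro nn_integral_cong) (simp add: wilson_kernel_nonneg mult_ac flip: ennreal_mult)
    then show ?thesis
      using law[of "\<lambda>y. ennreal (f y)"] by (simp add: nn_integral_cmult)
  qed
  then show ?thesis
    by blast
qed

lemma integrable_Y_power:
  assumes t: "t \<in> T"
  shows "integrable P (\<lambda>\<omega>. Y t \<omega> ^ k)"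
proof (rule integrableI_nonneg)
  note [measurable] = measurable_Y_real[OF t]
  show "(\<lambda>\<omega>. Y t \<omega> ^ k) \<in> borel_measurable P"
    by measurable
  show "AE \<omega> in P. 0 \<le> Y t \<omega> ^ k"
    using Y_pos[OF t] by (intro AE_I2) (simp add: less_imp_le)
  obtain K where K: "\<And>f. f \<in> borel_measurable borel \<Longrightarrow> (\<forall>y>0. 0 \<le> f y) \<Longrightarrow>
    (\<integral>\<^sup>+\<omega>. ennreal (f (Y t \<omega>)) \<partial>P) = ennreal K * (\<integral>\<^sup>+y. ennreal (f y * kernel t y) \<partial>pos_lborel)"
    using law[OF t] by blast
  have "(\<integral>\<^sup>+\<omega>. ennreal (Y t \<omega> ^ k) \<partial>P) = ennreal K * (\<integral>\<^sup>+y. ennreal (y ^ k * kernel t y) \<partial>pos_lborel)"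
    by (rule K) auto
  also have "\<dots> < \<infinity>"
    using nn_wilson_moment_finite[OF pair_AB[OF t] pair_CD[OF t], of k] by (simp add: ennreal_mult_less_top)
  finally show "(\<integral>\<^sup>+\<omega>. ennreal (Y t \<omega> ^ k) \<partial>P) < \<infinity>" .
qed

lemma integrable_Y: "t \<in> T \<Longrightarrow> integrable P (Y t)"
  using integrable_Y_power[of t 1] by simp

lemma integrable_Y_mult:
  assumes "s \<in> T" "t \<in> T"
  shows "integrable P (\<lambda>\<omega>. Y s \<omega> * Y t \<omega>)"
proof (rule Bochner_Integration.integrable_bound)
  show "integrable P (\<lambda>\<omega>. Y s \<omega> ^ 2 + Y t \<omega> ^ 2)"
    using assms by (intro Bochner_Integration.integrable_add integrable_Y_power)
  show "AE \<omega> in P. norm (Y s \<omega> * Y t \<omega>) \<le> norm (Y s \<omega> ^ 2 + Y t \<omega> ^ 2)"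
  proof (intro AE_I2)
    fix \<omega>
    have "2 * \<bar>Y s \<omega> * Y t \<omega>\<bar> \<le> Y s \<omega> ^ 2 + Y t \<omega> ^ 2"
      using sum_squares_bound[of "\<bar>Y s \<omega>\<bar>" "\<bar>Y t \<omega>\<bar>"] by (simp add: abs_mult)
    then show "norm (Y s \<omega> * Y t \<omega>) \<le> norm (Y s \<omega> ^ 2 + Y t \<omega> ^ 2)"
      by simp
  qed
qed (use assms measurable_Y_real in auto)

abbreviation e1 where "e1 t \<equiv> esym1 (A - of_real t) (B - of_real t) (C + of_real t) (D + of_real t)"
abbreviation e2 where "e2 t \<equiv> esym2 (A - of_real t) (B - of_real t) (C + of_real t) (D + of_real t)"
abbreviation e3 where "e3 t \<equiv> esym3 (A - of_real t) (B - of_real t) (C + of_real t) (D + of_real t)"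
abbreviation e4 where "e4 t \<equiv> esym4 (A - of_real t) (B - of_real t) (C + of_real t) (D + of_real t)"

lemma law_integral_eqI:
  assumes t: "t \<in> T" and f: "f \<in> borel_measurable borel" "g \<in> borel_measurable borel"
    and nonneg: "\<And>y. y > 0 \<Longrightarrow> 0 \<le> f y" "\<And>y. y > 0 \<Longrightarrow> 0 \<le> g y"
    and int: "integrable P (\<lambda>\<omega>. f (Y t \<omega>))" "integrable P (\<lambda>\<omega>. g (Y t \<omega>))"
    and eq: "(\<integral>\<^sup>+y. ennreal (f y * kernel t y) \<partial>pos_lborel) = (\<integral>\<^sup>+y. ennreal (g y * kernel t y) \<partial>pos_lborel)"
  shows "(\<integral>\<omega>. f (Y t \<omega>) \<partial>P) = (\<integral>\<omega>. g (Y t \<omega>) \<partial>P)"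
proof -
  obtain K where K: "\<And>f. f \<in> borel_measurable borel \<Longrightarrow> (\<forall>y>0. 0 \<le> f y) \<Longrightarrow>
    (\<integral>\<^sup>+\<omega>. ennreal (f (Y t \<omega>)) \<partial>P) = ennreal K * (\<integral>\<^sup>+y. ennreal (f y * kernel t y) \<partial>pos_lborel)"
    using law[OF t] by blast
  have "(\<integral>\<^sup>+\<omega>. ennreal (f (Y t \<omega>)) \<partial>P) = (\<integral>\<^sup>+\<omega>. ennreal (g (Y t \<omega>)) \<partial>P)"
    using f nonneg by (simp add: K eq)
  moreover have "AE \<omega> in P. 0 \<le> f (Y t \<omega>)" "AE \<omega> in P. 0 \<le> g (Y t \<omega>)"
    using Y_pos[OF t] nonneg by (auto intro!: AE_I2)
  ultimately show ?thesis
    by (simp add: nn_integral_eq_integral int integral_nonneg_AE)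
qed

lemma expectation_Y:
  assumes t: "t \<in> T"
  shows "e1 t * expectation (Y t) = e3 t"
proof -
  note pos = esym_pos[OF pair_AB[OF t] pair_CD[OF t]]
  have "(\<integral>\<omega>. (\<lambda>y. e1 t * y) (Y t \<omega>) \<partial>P) = (\<integral>\<omega>. (\<lambda>_. e3 t) (Y t \<omega>) \<partial>P)"
    using pos nn_wilson_moment1[OF pair_AB[OF t] pair_CD[OF t]]
    by (intro law_integral_eqI[OF t]) (auto intro: integrable_Y t)
  then show ?thesis
    by (simp add: prob_space)
qed

lemma expectation_Y_square:
  assumes t: "t \<in> T"
  shows "(1 + e1 t) * expectation (\<lambda>\<omega>. Y t \<omega> ^ 2) + e4 t = (e2 t + e3 t) * expectation (Y t)"
proof -
  note pos = esym_pos[OF pair_AB[OF t] pair_CD[OF t]]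
  have "(\<integral>\<omega>. (\<lambda>y. (1 + e1 t) * y\<^sup>2 + e4 t) (Y t \<omega>) \<partial>P) = (\<integral>\<omega>. (\<lambda>y. (e2 t + e3 t) * y) (Y t \<omega>) \<partial>P)"
    using pos nn_wilson_moment2[OF pair_AB[OF t] pair_CD[OF t]]
    by (intro law_integral_eqI[OF t]) (auto intro!: integrable_Y integrable_Y_power t)
  then show ?thesis
    using integrable_Y_power[OF t, of 2] by (simp add: prob_space)
qed

text \<open>The transition law has the pairs A - t, B - t and t - s +- i sqrt x, for which e1 =
  \<alpha> - 2s and e3 is affine in x. So the regression of \<open>Y t\<close> on \<open>Y s\<close>
  is affine; it is multiplied by \<open>Y s\<close> and integrated.\<close>

lemma expectation_Y_Y:
  assumes st: "s \<in> T" "t \<in> T" "s < t"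
  defines "\<alpha> \<equiv> Re (A + B)"
  shows "(\<alpha> - 2 * s) * expectation (\<lambda>\<omega>. Y s \<omega> * Y t \<omega>)
    = expectation (\<lambda>\<omega>. Y s \<omega> * (Re ((A - of_real t) * (B - of_real t)) * (2 * (t - s)) + (\<alpha> - 2 * t) * ((t - s)\<^sup>2 + Y s \<omega>)))"
proof -
  define Q where "Q = Re ((A - of_real t) * (B - of_real t))"
  define f3 where "f3 x = Q * (2 * (t - s)) + (\<alpha> - 2 * t) * ((t - s)\<^sup>2 + x)" for x
  define f1 where "f1 = \<alpha> - 2 * s"
  have Q: "Q > 0"
    unfolding Q_def by (rule conj_pair_mult_pos[OF pair_AB[OF st(2)]])
  have \<alpha>: "\<alpha> - 2 * t > 0" "f1 > 0"
    using pair_AB[OF st(1)] pair_AB[OF st(2)] by (simp_all add: conj_pair_def \<alpha>_def f1_def)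
  have f3_pos: "f3 x > 0" if "x > 0" for x
    unfolding f3_def using Q \<alpha> st that by (intro add_pos_pos mult_pos_pos) auto
  have [measurable]: "f3 \<in> borel_measurable borel"
    unfolding f3_def by measurable
  note [measurable] = measurable_Y_real[OF st(1)] measurable_Y_real[OF st(2)]
  have G: "(\<lambda>\<omega>. ennreal (Y s \<omega>)) \<in> borel_measurable (past s)"
    using measurable_compose[OF measurable_Y_past[OF st(1) order_refl] measurable_pos_lborel_id] by measurable
  have G3: "(\<lambda>\<omega>. ennreal (Y s \<omega>) * ennreal (f3 (Y s \<omega>))) \<in> borel_measurable (past s)"
    using measurable_compose[OF measurable_Y_past[OF st(1) order_refl] measurable_pos_lborel_id] by measurable
  \<comment> \<open>The total mass of the transition density is carried along as a factor; a second
    use of \<open>nn_transition\<close>, with the constant function 1, removes it.\<close>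
  have tr: "(\<integral>\<^sup>+y. ennreal (transition_density A B s t x y) * ennreal (f1 * y) \<partial>pos_lborel)
    = ennreal (f3 x) * (\<integral>\<^sup>+y. ennreal (transition_density A B s t x y) * 1 \<partial>pos_lborel)" if x: "x > 0" for x
  proof -
    let ?c = "of_real (t - s) + \<i> * complex_of_real (sqrt x)" and ?d = "of_real (t - s) - \<i> * complex_of_real (sqrt x)"
    let ?K = "Re (wilson_const (A - of_real t) (B - of_real t) ?c ?d)"
    let ?w = "wilson_kernel (A - of_real t) (B - of_real t) ?c ?d"
    have cd: "conj_pair ?c ?d"
      using st by (intro conj_pair_cnj) simp
    have [measurable]: "?w \<in> borel_measurable pos_lborel"
      using measurable_compose[OF measurable_pos_lborel_id measurable_wilson_kernel] by simp
    have K: "?K \<ge> 0"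
      using wilson_const_shift_nonneg[OF pair_AB[OF st(2)], of "t - s" "sqrt x"] st by simp
    have e: "esym1 (A - of_real t) (B - of_real t) ?c ?d = f1"
      "esym3 (A - of_real t) (B - of_real t) ?c ?d = f3 x"
      using x unfolding esym1_def esym3_def f1_def f3_def Q_def[symmetric]
      by (simp_all add: \<alpha>_def power2_eq_square algebra_simps)
    have td: "ennreal (transition_density A B s t x y) * ennreal f = ennreal ?K * ennreal (f * ?w y)"
      if "y \<in> space pos_lborel" "f \<ge> 0" for y f
      using that K by (simp add: transition_density_def wilson_density_eq wilson_kernel_nonneg ennreal_mult[symmetric] mult_ac)
    have "(\<integral>\<^sup>+y. ennreal (transition_density A B s t x y) * ennreal (f1 * y) \<partial>pos_lborel)
      = (\<integral>\<^sup>+y. ennreal ?K * ennreal (f1 * y * ?w y) \<partial>pos_lborel)"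
      using \<alpha> by (intro nn_integral_cong td) auto
    also have "\<dots> = ennreal ?K * (\<integral>\<^sup>+y. ennreal (f1 * y * ?w y) \<partial>pos_lborel)"
      by (rule nn_integral_cmult) measurable
    also have "\<dots> = ennreal ?K * (\<integral>\<^sup>+y. ennreal (f3 x * ?w y) \<partial>pos_lborel)"
      using nn_wilson_moment1[OF pair_AB[OF st(2)] cd] unfolding e by simp
    also have "\<dots> = (\<integral>\<^sup>+y. ennreal ?K * ennreal (f3 x * ?w y) \<partial>pos_lborel)"
      by (rule nn_integral_cmult[symmetric]) measurable
    also have "\<dots> = (\<integral>\<^sup>+y. ennreal (transition_density A B s t x y) * ennreal (f3 x) \<partial>pos_lborel)"
      using f3_pos[OF x] by (intro nn_integral_cong td[symmetric]) auto
    also have "\<dots> = (\<integral>\<^sup>+y. ennreal (f3 x) * (ennreal (transition_density A B s t x y) * 1) \<partial>pos_lborel)"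
      by (simp add: mult.commute)
    also have "\<dots> = ennreal (f3 x) * (\<integral>\<^sup>+y. ennreal (transition_density A B s t x y) * 1 \<partial>pos_lborel)"
      by (rule nn_integral_cmult) (simp add: transition_density_def wilson_density_eq)
    finally show ?thesis .
  qed
  have "(\<integral>\<^sup>+\<omega>. ennreal (f1 * (Y s \<omega> * Y t \<omega>)) \<partial>P) = (\<integral>\<^sup>+\<omega>. ennreal (Y s \<omega>) * ennreal (f1 * Y t \<omega>) \<partial>P)"
    using Y_pos[OF st(1)] Y_pos[OF st(2)] \<alpha>
    by (intro nn_integral_cong) (simp add: less_imp_le mult_ac flip: ennreal_mult)
  also have "\<dots> = (\<integral>\<^sup>+\<omega>. ennreal (Y s \<omega>) * (\<integral>\<^sup>+y. ennreal (transition_density A B s t (Y s \<omega>) y) * ennreal (f1 * y) \<partial>pos_lborel) \<partial>P)"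
    by (rule nn_transition[OF st G]) measurable
  also have "\<dots> = (\<integral>\<^sup>+\<omega>. ennreal (Y s \<omega>) * ennreal (f3 (Y s \<omega>)) *
      (\<integral>\<^sup>+y. ennreal (transition_density A B s t (Y s \<omega>) y) * 1 \<partial>pos_lborel) \<partial>P)"
    using Y_pos[OF st(1)] by (intro nn_integral_cong) (simp only: tr mult.assoc)
  also have "\<dots> = (\<integral>\<^sup>+\<omega>. ennreal (Y s \<omega>) * ennreal (f3 (Y s \<omega>)) * 1 \<partial>P)"
    by (rule nn_transition[OF st G3, symmetric]) measurable
  also have "\<dots> = (\<integral>\<^sup>+\<omega>. ennreal (Y s \<omega> * f3 (Y s \<omega>)) \<partial>P)"
    using Y_pos[OF st(1)] f3_pos by (intro nn_integral_cong) (simp add: less_imp_le ennreal_mult)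
  finally have nn: "(\<integral>\<^sup>+\<omega>. ennreal (f1 * (Y s \<omega> * Y t \<omega>)) \<partial>P) = (\<integral>\<^sup>+\<omega>. ennreal (Y s \<omega> * f3 (Y s \<omega>)) \<partial>P)" .
  have int: "integrable P (\<lambda>\<omega>. Y s \<omega> * f3 (Y s \<omega>))" "integrable P (\<lambda>\<omega>. f1 * (Y s \<omega> * Y t \<omega>))"
    unfolding f3_def using integrable_Y[OF st(1)] integrable_Y_mult[OF st(1,1)] integrable_Y_mult[OF st(1,2)]
    by (simp_all add: distrib_left mult.left_commute[of _ "\<alpha> - _"])
  have "(\<integral>\<omega>. f1 * (Y s \<omega> * Y t \<omega>) \<partial>P) = (\<integral>\<omega>. Y s \<omega> * f3 (Y s \<omega>) \<partial>P)"
  proof -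
    have AE: "AE \<omega> in P. 0 \<le> f1 * (Y s \<omega> * Y t \<omega>)" "AE \<omega> in P. 0 \<le> Y s \<omega> * f3 (Y s \<omega>)"
      using Y_pos[OF st(1)] Y_pos[OF st(2)] \<alpha> f3_pos by (auto intro!: AE_I2 mult_nonneg_nonneg less_imp_le)
    from nn have "ennreal (\<integral>\<omega>. f1 * (Y s \<omega> * Y t \<omega>) \<partial>P) = ennreal (\<integral>\<omega>. Y s \<omega> * f3 (Y s \<omega>) \<partial>P)"
      unfolding nn_integral_eq_integral[OF int(2) AE(1)] nn_integral_eq_integral[OF int(1) AE(2)] .
    then show ?thesis
      using integral_nonneg_AE[OF AE(1)] integral_nonneg_AE[OF AE(2)] by (simp only: ennreal_inj)
  qed
  then show ?thesis
    by (simp add: f1_def f3_def Q_def)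
qed

end

section \<open>Conditional moments given past and future\<close>

context wilson_bridge
begin

lemma transition_bridge:
  assumes st: "s \<in> T" "t \<in> T" "u \<in> T" "s < t" "t < u" and x: "x > 0" and z: "z > 0"
  shows "\<exists>c\<ge>0. \<forall>y>0. transition_density A B s t x y * transition_density A B t u y z
    = c * bridge_kernel (t - s) (u - t) x z y"
proof -
  have shift: "A - of_real t - of_real (u - t) = A - of_real u" "B - of_real t - of_real (u - t) = B - of_real u"
    by simp_all
  have "t - s > 0" "u - t > 0"
    using st by simp_all
  from wilson_density_bridge[OF pair_AB[OF st(2)] this _ x z, unfolded shift, OF pair_AB[OF st(3)]]
  show ?thesis
    unfolding transition_density_def .
qed

text \<open>For fixed end values x and z the product of the two transition densities is a multiple
  of the bridge kernel, and the multiple does not depend on y. Hence an equality of bridge integrals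
  passes to the process, first against past events and functions of \<open>Y u\<close>, then by
  \<open>bridge_integral_eqI\<close> on the whole conditioning field.\<close>

lemma bridge_set_integral_eqI:
  fixes a1 a2 \<phi>1 \<phi>2 b1 b2 a1' a2' \<phi>1' \<phi>2' b1' b2' :: "real \<Rightarrow> real"
  assumes st: "s \<in> T" "t \<in> T" "u \<in> T" "s < t" "t < u"
  defines "U \<equiv> \<lambda>x y z. a1 x * \<phi>1 y * b1 z + a2 x * \<phi>2 y * b2 z"
    and "V \<equiv> \<lambda>x y z. a1' x * \<phi>1' y * b1' z + a2' x * \<phi>2' y * b2' z"
  assumes nb: "nonneg_borel a1" "nonneg_borel a2" "nonneg_borel \<phi>1" "nonneg_borel \<phi>2" "nonneg_borel b1" "nonneg_borel b2"
      "nonneg_borel a1'" "nonneg_borel a2'" "nonneg_borel \<phi>1'" "nonneg_borel \<phi>2'" "nonneg_borel b1'" "nonneg_borel b2'"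
    and int: "integrable P (\<lambda>\<omega>. U (Y s \<omega>) (Y t \<omega>) (Y u \<omega>))" "integrable P (\<lambda>\<omega>. V (Y s \<omega>) (Y t \<omega>) (Y u \<omega>))"
    and eq: "\<And>x z. x > 0 \<Longrightarrow> z > 0 \<Longrightarrow>
      (\<integral>\<^sup>+y. ennreal (U x y z * bridge_kernel (t - s) (u - t) x z y) \<partial>pos_lborel)
      = (\<integral>\<^sup>+y. ennreal (V x y z * bridge_kernel (t - s) (u - t) x z y) \<partial>pos_lborel)"
    and E: "E \<in> sets (generated_field P pos_lborel Y {r\<in>T. r \<le> s \<or> u \<le> r})"
  shows "(LINT \<omega>:E|P. U (Y s \<omega>) (Y t \<omega>) (Y u \<omega>)) = (LINT \<omega>:E|P. V (Y s \<omega>) (Y t \<omega>) (Y u \<omega>))"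
proof -
  have lift [measurable]: "(\<lambda>x. ennreal (f x)) \<in> borel_measurable pos_lborel" "f \<in> borel_measurable pos_lborel"
    if "f \<in> borel_measurable borel" for f :: "real \<Rightarrow> real"
    using measurable_compose[OF measurable_pos_lborel_id that] by simp_all
  note meas = nb[unfolded nonneg_borel_def, THEN conjunct1]
  have nonneg: "f x \<ge> 0" if "nonneg_borel f" "x > 0" for f x
    using that unfolding nonneg_borel_def by blast
  have su: "s < u"
    using st by simp
  have Upos: "U x y z \<ge> 0" and Vpos: "V x y z \<ge> 0" if "x > 0" "y > 0" "z > 0" for x y z
    using nb[THEN nonneg] that by (simp_all add: U_def V_def)
  have real_past: "(\<lambda>\<omega>. f (Y r \<omega>)) \<in> borel_measurable (past u)"
    if "f \<in> borel_measurable borel" "r \<in> T" "r \<le> u" for f :: "real \<Rightarrow> real" and r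
    using measurable_compose[OF measurable_Y_past[OF that(2,3)] lift(2)[OF that(1)]] .
  have U_past: "(\<lambda>\<omega>. ennreal (U (Y s \<omega>) (Y t \<omega>) (Y u \<omega>))) \<in> borel_measurable (past u)"
    unfolding U_def using st
    by (intro measurable_ennreal[THEN measurable_compose_rev] borel_measurable_add borel_measurable_times real_past meas) simp_all
  have V_past: "(\<lambda>\<omega>. ennreal (V (Y s \<omega>) (Y t \<omega>) (Y u \<omega>))) \<in> borel_measurable (past u)"
    unfolding V_def using st
    by (intro measurable_ennreal[THEN measurable_compose_rev] borel_measurable_add borel_measurable_times real_past meas) simp_all
  let ?k = "\<lambda>s t x y. ennreal (transition_density A B s t x y)"
  have sum2: "ennreal (a x) * ennreal (\<phi> y) * ennreal (b z) + ennreal (a' x) * ennreal (\<phi>' y) * ennreal (b' z)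
      = ennreal (a x * \<phi> y * b z + a' x * \<phi>' y * b' z)"
    if "a x \<ge> 0" "\<phi> y \<ge> 0" "b z \<ge> 0" "a' x \<ge> 0" "\<phi>' y \<ge> 0" "b' z \<ge> 0"
    for a \<phi> b a' \<phi>' b' :: "real \<Rightarrow> real" and x y z
    using that by (simp add: ennreal_mult)
  have expand: "(\<integral>\<^sup>+\<omega>. indicator E \<omega> * ennreal (a (Y s \<omega>) * \<phi> (Y t \<omega>) * b (Y u \<omega>) + a' (Y s \<omega>) * \<phi>' (Y t \<omega>) * b' (Y u \<omega>)) * h (Y u \<omega>) \<partial>P)
    = (\<integral>\<^sup>+\<omega>. indicator E \<omega> * (\<integral>\<^sup>+z. h z * (\<integral>\<^sup>+y. ?k s t (Y s \<omega>) y * ?k t u y z *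
       ennreal (a (Y s \<omega>) * \<phi> y * b z + a' (Y s \<omega>) * \<phi>' y * b' z) \<partial>pos_lborel) \<partial>pos_lborel) \<partial>P)"
    if n: "nonneg_borel a" "nonneg_borel \<phi>" "nonneg_borel b" "nonneg_borel a'" "nonneg_borel \<phi>'" "nonneg_borel b'"
      and E: "E \<in> sets (past s)" and h: "h \<in> borel_measurable pos_lborel"
    for a \<phi> b a' \<phi>' b' :: "real \<Rightarrow> real" and E and h :: "real \<Rightarrow> ennreal"
  proof -
    note m = n[unfolded nonneg_borel_def, THEN conjunct1]
    have "(\<integral>\<^sup>+\<omega>. indicator E \<omega> * ennreal (a (Y s \<omega>) * \<phi> (Y t \<omega>) * b (Y u \<omega>) + a' (Y s \<omega>) * \<phi>' (Y t \<omega>) * b' (Y u \<omega>)) * h (Y u \<omega>) \<partial>P)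
      = (\<integral>\<^sup>+\<omega>. indicator E \<omega> * (ennreal (a (Y s \<omega>)) * ennreal (\<phi> (Y t \<omega>)) * ennreal (b (Y u \<omega>))
          + ennreal (a' (Y s \<omega>)) * ennreal (\<phi>' (Y t \<omega>)) * ennreal (b' (Y u \<omega>))) * h (Y u \<omega>) \<partial>P)"
      using Y_pos st n[THEN nonneg] by (intro nn_integral_cong, subst sum2) auto
    also have "\<dots> = (\<integral>\<^sup>+\<omega>. indicator E \<omega> * (\<integral>\<^sup>+z. h z * (\<integral>\<^sup>+y. ?k s t (Y s \<omega>) y * ?k t u y z *
       (ennreal (a (Y s \<omega>)) * ennreal (\<phi> y) * ennreal (b z) + ennreal (a' (Y s \<omega>)) * ennreal (\<phi>' y) * ennreal (b' z))
        \<partial>pos_lborel) \<partial>pos_lborel) \<partial>P)"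
      by (rule nn_transition2_sum[OF st E lift(1)[OF m(1)] lift(1)[OF m(4)] lift(1)[OF m(2)] lift(1)[OF m(5)]
            lift(1)[OF m(3)] lift(1)[OF m(6)] h])
    also have "\<dots> = (\<integral>\<^sup>+\<omega>. indicator E \<omega> * (\<integral>\<^sup>+z. h z * (\<integral>\<^sup>+y. ?k s t (Y s \<omega>) y * ?k t u y z *
       ennreal (a (Y s \<omega>) * \<phi> y * b z + a' (Y s \<omega>) * \<phi>' y * b' z) \<partial>pos_lborel) \<partial>pos_lborel) \<partial>P)"
      using Y_pos[OF st(1)] n[THEN nonneg] by (intro nn_integral_cong arg_cong2[where f = times] refl, subst sum2) auto
    finally show ?thesis .
  qed
  have inner: "(\<integral>\<^sup>+y. ?k s t x y * ?k t u y z * ennreal (U x y z) \<partial>pos_lborel)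
     = (\<integral>\<^sup>+y. ?k s t x y * ?k t u y z * ennreal (V x y z) \<partial>pos_lborel)" if xz: "x > 0" "z > 0" for x z
  proof -
    let ?w = "bridge_kernel (t - s) (u - t) x z"
    obtain c where c: "c \<ge> 0" "\<And>y. y > 0 \<Longrightarrow> transition_density A B s t x y * transition_density A B t u y z = c * ?w y"
      using transition_bridge[OF st xz] by blast
    have kk: "?k s t x y * ?k t u y z * ennreal f = ennreal c * ennreal (f * ?w y)" if "y > 0" "f \<ge> 0" for y f
    proof -
      have "?k s t x y * ?k t u y z = ennreal (c * ?w y)"
        using that xz st c(2) by (simp add: transition_density_nonneg flip: ennreal_mult)
      then show ?thesis
        using that c(1) wilson_kernel_nonneg[OF that(1)] by (simp add: ennreal_mult mult_ac)
    qed
    have w [measurable]: "?w \<in> borel_measurable pos_lborel"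
      by (rule lift(2)) measurable
    have Um: "(\<lambda>y. ennreal (U x y z * ?w y)) \<in> borel_measurable pos_lborel"
      "(\<lambda>y. ennreal (V x y z * ?w y)) \<in> borel_measurable pos_lborel"
      unfolding U_def V_def using meas by measurable
    have "(\<integral>\<^sup>+y. ?k s t x y * ?k t u y z * ennreal (U x y z) \<partial>pos_lborel)
      = (\<integral>\<^sup>+y. ennreal c * ennreal (U x y z * ?w y) \<partial>pos_lborel)"
      using Upos xz by (intro nn_integral_cong kk) auto
    also have "\<dots> = ennreal c * (\<integral>\<^sup>+y. ennreal (U x y z * ?w y) \<partial>pos_lborel)"
      by (rule nn_integral_cmult[OF Um(1)])
    also have "\<dots> = ennreal c * (\<integral>\<^sup>+y. ennreal (V x y z * ?w y) \<partial>pos_lborel)"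
      using eq[OF xz] by simp
    also have "\<dots> = (\<integral>\<^sup>+y. ennreal c * ennreal (V x y z * ?w y) \<partial>pos_lborel)"
      by (rule nn_integral_cmult[OF Um(2), symmetric])
    also have "\<dots> = (\<integral>\<^sup>+y. ?k s t x y * ?k t u y z * ennreal (V x y z) \<partial>pos_lborel)"
      using Vpos xz by (intro nn_integral_cong kk[symmetric]) auto
    finally show ?thesis .
  qed
  have AE: "AE \<omega> in P. 0 \<le> U (Y s \<omega>) (Y t \<omega>) (Y u \<omega>)" "AE \<omega> in P. 0 \<le> V (Y s \<omega>) (Y t \<omega>) (Y u \<omega>)"
    using Y_pos st Upos Vpos by (auto intro!: AE_I2)
  have nn: "(\<integral>\<^sup>+\<omega>\<in>E. ennreal (U (Y s \<omega>) (Y t \<omega>) (Y u \<omega>)) \<partial>P) = (\<integral>\<^sup>+\<omega>\<in>E. ennreal (V (Y s \<omega>) (Y t \<omega>) (Y u \<omega>)) \<partial>P)"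
  proof (rule bridge_integral_eqI[OF st(1,3) su U_past V_past _ _ E])
    show "(\<integral>\<^sup>+\<omega>. ennreal (U (Y s \<omega>) (Y t \<omega>) (Y u \<omega>)) \<partial>P) < \<infinity>"
      by (subst nn_integral_eq_integral[OF int(1) AE(1)]) simp
    fix E' and h :: "real \<Rightarrow> ennreal" assume E': "E' \<in> sets (past s)" and h: "h \<in> borel_measurable pos_lborel"
    have "(\<integral>\<^sup>+\<omega>. indicator E' \<omega> * (\<integral>\<^sup>+z. h z * (\<integral>\<^sup>+y. ?k s t (Y s \<omega>) y * ?k t u y z *
       ennreal (U (Y s \<omega>) y z) \<partial>pos_lborel) \<partial>pos_lborel) \<partial>P)
      = (\<integral>\<^sup>+\<omega>. indicator E' \<omega> * (\<integral>\<^sup>+z. h z * (\<integral>\<^sup>+y. ?k s t (Y s \<omega>) y * ?k t u y z *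
       ennreal (V (Y s \<omega>) y z) \<partial>pos_lborel) \<partial>pos_lborel) \<partial>P)"
    proof (rule nn_integral_cong)
      fix \<omega> assume \<omega>: "\<omega> \<in> space P"
      have "(\<integral>\<^sup>+z. h z * (\<integral>\<^sup>+y. ?k s t (Y s \<omega>) y * ?k t u y z * ennreal (U (Y s \<omega>) y z) \<partial>pos_lborel) \<partial>pos_lborel)
        = (\<integral>\<^sup>+z. h z * (\<integral>\<^sup>+y. ?k s t (Y s \<omega>) y * ?k t u y z * ennreal (V (Y s \<omega>) y z) \<partial>pos_lborel) \<partial>pos_lborel)"
      proof (rule nn_integral_cong)
        fix z assume "z \<in> space pos_lborel"
        then have "z > 0"
          by simp
        show "h z * (\<integral>\<^sup>+y. ?k s t (Y s \<omega>) y * ?k t u y z * ennreal (U (Y s \<omega>) y z) \<partial>pos_lborel)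
          = h z * (\<integral>\<^sup>+y. ?k s t (Y s \<omega>) y * ?k t u y z * ennreal (V (Y s \<omega>) y z) \<partial>pos_lborel)"
          by (simp only: inner[OF Y_pos[OF st(1) \<omega>] \<open>z > 0\<close>])
      qed
      then show "indicator E' \<omega> * (\<integral>\<^sup>+z. h z * (\<integral>\<^sup>+y. ?k s t (Y s \<omega>) y * ?k t u y z *
          ennreal (U (Y s \<omega>) y z) \<partial>pos_lborel) \<partial>pos_lborel)
        = indicator E' \<omega> * (\<integral>\<^sup>+z. h z * (\<integral>\<^sup>+y. ?k s t (Y s \<omega>) y * ?k t u y z *
          ennreal (V (Y s \<omega>) y z) \<partial>pos_lborel) \<partial>pos_lborel)"
        by (simp only:)
    qed
    then show "(\<integral>\<^sup>+\<omega>. indicator E' \<omega> * ennreal (U (Y s \<omega>) (Y t \<omega>) (Y u \<omega>)) * h (Y u \<omega>) \<partial>P)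
      = (\<integral>\<^sup>+\<omega>. indicator E' \<omega> * ennreal (V (Y s \<omega>) (Y t \<omega>) (Y u \<omega>)) * h (Y u \<omega>) \<partial>P)"
      unfolding U_def V_def
      by (simp only: expand[OF nb(1,3,5,2,4,6) E' h]
          expand[OF nb(7,9,11,8,10,12) E' h])
  qed
  have "E \<in> sets P"
    using E subalgebra_generated_field[of "{r\<in>T. r \<le> s \<or> u \<le> r}" Y P pos_lborel] measurable_Y
    by (auto simp: subalgebra_def)
  then have ind: "integrable P (\<lambda>\<omega>. indicator E \<omega> * U (Y s \<omega>) (Y t \<omega>) (Y u \<omega>))" "integrable P (\<lambda>\<omega>. indicator E \<omega> * V (Y s \<omega>) (Y t \<omega>) (Y u \<omega>))"
    using integrable_real_mult_indicator[OF _ int(1)] integrable_real_mult_indicator[OF _ int(2)]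
    by (simp_all add: mult.commute)
  have AE': "AE \<omega> in P. 0 \<le> indicator E \<omega> * U (Y s \<omega>) (Y t \<omega>) (Y u \<omega>)" "AE \<omega> in P. 0 \<le> indicator E \<omega> * V (Y s \<omega>) (Y t \<omega>) (Y u \<omega>)"
    by (rule eventually_mono[OF AE(1)], simp) (rule eventually_mono[OF AE(2)], simp)
  have "ennreal (\<integral>\<omega>. indicator E \<omega> * U (Y s \<omega>) (Y t \<omega>) (Y u \<omega>) \<partial>P) = ennreal (\<integral>\<omega>. indicator E \<omega> * V (Y s \<omega>) (Y t \<omega>) (Y u \<omega>) \<partial>P)"
    unfolding nn_integral_eq_integral[OF ind(1) AE'(1), symmetric] nn_integral_eq_integral[OF ind(2) AE'(2), symmetric]
    using nn by (simp add: ennreal_mult' ennreal_indicator mult.commute)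
  then show ?thesis
    using integral_nonneg_AE[OF AE'(1)] integral_nonneg_AE[OF AE'(2)]
    by (simp add: set_lebesgue_integral_def)
qed

lemma integrable_affine_mult:
  assumes "i \<in> T" "j \<in> T" "k \<in> T"
  shows "integrable P (\<lambda>\<omega>. (p0 + p1 * Y i \<omega> + p2 * Y j \<omega>) * Y k \<omega>)"
    and "integrable P (\<lambda>\<omega>. (p0 + p1 * Y i \<omega> + p2 * Y j \<omega>) * (q0 + q1 * Y i \<omega> + q2 * Y j \<omega>))"
proof -
  note int = integrable_Y_mult integrable_Y assms
  have "(\<lambda>\<omega>. (p0 + p1 * Y i \<omega> + p2 * Y j \<omega>) * Y k \<omega>)
    = (\<lambda>\<omega>. p0 * Y k \<omega> + p1 * (Y i \<omega> * Y k \<omega>) + p2 * (Y j \<omega> * Y k \<omega>))"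
    by (simp add: algebra_simps)
  then show "integrable P (\<lambda>\<omega>. (p0 + p1 * Y i \<omega> + p2 * Y j \<omega>) * Y k \<omega>)"
    using int by simp
  have "(\<lambda>\<omega>. (p0 + p1 * Y i \<omega> + p2 * Y j \<omega>) * (q0 + q1 * Y i \<omega> + q2 * Y j \<omega>))
    = (\<lambda>\<omega>. p0 * q0 + (p0 * q1 + p1 * q0) * Y i \<omega> + (p0 * q2 + p2 * q0) * Y j \<omega>
       + (p1 * q1) * (Y i \<omega> * Y i \<omega>) + (p1 * q2 + p2 * q1) * (Y i \<omega> * Y j \<omega>) + (p2 * q2) * (Y j \<omega> * Y j \<omega>))"
    by (simp add: algebra_simps)
  then show "integrable P (\<lambda>\<omega>. (p0 + p1 * Y i \<omega> + p2 * Y j \<omega>) * (q0 + q1 * Y i \<omega> + q2 * Y j \<omega>))"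
    using int by simp
qed

text \<open>The bridge parameters have e1 = 2 (u - s), e3 = 2 (u - t) X + 2 (t - s) Z and e4 = X Z
  (\<open>esym_bridge\<close>), so the first relation gives the conditional mean e3 / e1 = W. In the
  second relation the coefficient of \<open>Y t\<close> is measurable for the conditioning field, so
  \<open>Y t\<close> may be replaced there by \<open>W\<close>.\<close>

lemma cond_exp_bridge:
  assumes st: "s \<in> T" "t \<in> T" "u \<in> T" "s < t" "t < u"
  defines "F \<equiv> generated_field P pos_lborel Y {r\<in>T. r \<le> s \<or> u \<le> r}"
    and "X \<equiv> \<lambda>\<omega>. (t - s)\<^sup>2 + Y s \<omega>" and "Z \<equiv> \<lambda>\<omega>. (u - t)\<^sup>2 + Y u \<omega>"
  defines "W \<equiv> \<lambda>\<omega>. ((u - t) * X \<omega> + (t - s) * Z \<omega>) / (u - s)"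
  shows "AE \<omega> in P. real_cond_exp P F (Y t) \<omega> = W \<omega>"
    and "AE \<omega> in P. real_cond_exp P F (\<lambda>\<omega>. (Y t \<omega>)\<^sup>2) \<omega>
      = (((1 + 2 * (u - t)) * X \<omega> + (1 + 2 * (t - s)) * Z \<omega> + 4 * (t - s) * (u - t)) * W \<omega> - X \<omega> * Z \<omega>) / (1 + 2 * (u - s))"
proof -
  define d1 where "d1 = t - s"
  define d2 where "d2 = u - t"
  have \<delta>: "d1 > 0" "d2 > 0" "u - s = d1 + d2"
    using st by (simp_all add: d1_def d2_def)
  have subalg: "subalgebra P F"
    unfolding F_def by (rule subalgebra_generated_field) (auto intro: measurable_Y)
  interpret sub: finite_measure_subalgebra P F
    using subalg by unfold_locales
  note [measurable] = measurable_Y_real[OF st(1)] measurable_Y_real[OF st(2)] measurable_Y_real[OF st(3)]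
  have [measurable]: "Y s \<in> borel_measurable F" "Y u \<in> borel_measurable F"
    unfolding F_def using st by (auto intro!: measurable_Y_field)
  \<comment> \<open>The squares inside X and Z contribute d1 d2 (d1 + d2) / (d1 + d2), so
    \<open>W\<close> is affine in the end values with constant term d1 d2.\<close>
  have W: "W = (\<lambda>\<omega>. d1 * d2 + d2 / (d1 + d2) * Y s \<omega> + d1 / (d1 + d2) * Y u \<omega>)"
  proof
    fix \<omega>
    have "d1 + d2 \<noteq> 0"
      using \<delta> by simp
    then show "W \<omega> = d1 * d2 + d2 / (d1 + d2) * Y s \<omega> + d1 / (d1 + d2) * Y u \<omega>"
      unfolding W_def X_def Z_def \<delta>(3) d1_def[symmetric] d2_def[symmetric]
      by (simp add: add_divide_eq_iff divide_add_eq_iff) (simp add: algebra_simps power2_eq_square)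
  qed
  have W_meas [measurable]: "W \<in> borel_measurable F"
    unfolding W by measurable
  have intW: "integrable P W"
    unfolding W using st
    by (intro Bochner_Integration.integrable_add integrable_mult_right integrable_Y) auto
  \<comment> \<open>This is e2 + e3 for the bridge parameters, the coefficient of y in the second
    moment relation.\<close>
  define R where "R = (\<lambda>\<omega>. (1 + 2 * d2) * X \<omega> + (1 + 2 * d1) * Z \<omega> + 4 * d1 * d2)"
  have R: "R = (\<lambda>\<omega>. ((1 + 2 * d2) * d1\<^sup>2 + (1 + 2 * d1) * d2\<^sup>2 + 4 * d1 * d2) + (1 + 2 * d2) * Y s \<omega> + (1 + 2 * d1) * Y u \<omega>)"
    by (auto simp: R_def X_def Z_def algebra_simps simp flip: d1_def d2_def)
  have R_meas [measurable]: "R \<in> borel_measurable F"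
    unfolding R by measurable
  have pair: "conj_pair (of_real d2 + \<i> * of_real w) (of_real d2 - \<i> * of_real w)"
    "conj_pair (of_real d1 + \<i> * of_real w) (of_real d1 - \<i> * of_real w)" for w
    using \<delta> by (auto intro: conj_pair_cnj)
  have int_XZ: "integrable P (\<lambda>\<omega>. X \<omega> * Z \<omega>)"
    using integrable_affine_mult(2)[OF st(1,3,3), of "d1\<^sup>2" 1 0 "d2\<^sup>2" 0 1]
    by (simp add: X_def Z_def d1_def d2_def)
  have int_Yt2: "integrable P (\<lambda>\<omega>. (Y t \<omega>)\<^sup>2)"
    by (rule integrable_Y_power[OF st(2)])
  have int_RY: "integrable P (\<lambda>\<omega>. R \<omega> * Y t \<omega>)"
    unfolding R by (rule integrable_affine_mult(1)[OF st(1,3,2)])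
  have int_RW: "integrable P (\<lambda>\<omega>. R \<omega> * W \<omega>)"
    unfolding R W by (rule integrable_affine_mult(2)[OF st(1,3,3)])
  have bridge1: "(LINT \<omega>:E|P. 1 * (2 * (d1 + d2) * Y t \<omega>) * 1 + 0 * 0 * 0)
    = (LINT \<omega>:E|P. (2 * d2 * (d1\<^sup>2 + Y s \<omega>)) * 1 * 1 + 1 * 1 * (2 * d1 * (d2\<^sup>2 + Y u \<omega>)))" if "E \<in> sets F" for E
  \<comment> \<open>The left side has a single term; zeros pad it to the two-term shape.\<close>
  proof (rule bridge_set_integral_eqI[OF st, of "\<lambda>_. 1" "\<lambda>_. 0" "\<lambda>y. 2 * (d1 + d2) * y" "\<lambda>_. 0" "\<lambda>_. 1" "\<lambda>_. 0"
        "\<lambda>x. 2 * d2 * (d1\<^sup>2 + x)" "\<lambda>_. 1" "\<lambda>_. 1" "\<lambda>_. 1" "\<lambda>_. 1" "\<lambda>z. 2 * d1 * (d2\<^sup>2 + z)"])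
    show "integrable P (\<lambda>\<omega>. 1 * (2 * (d1 + d2) * Y t \<omega>) * 1 + 0 * 0 * 0)"
      using integrable_Y[OF st(2)] by simp
    show "integrable P (\<lambda>\<omega>. 2 * d2 * (d1\<^sup>2 + Y s \<omega>) * 1 * 1 + 1 * 1 * (2 * d1 * (d2\<^sup>2 + Y u \<omega>)))"
      using integrable_Y[OF st(1)] integrable_Y[OF st(3)] by simp
    fix x z :: real assume "x > 0" "z > 0"
    then show "(\<integral>\<^sup>+y. ennreal ((1 * (2 * (d1 + d2) * y) * 1 + 0 * 0 * 0) * bridge_kernel (t - s) (u - t) x z y) \<partial>pos_lborel)
      = (\<integral>\<^sup>+y. ennreal ((2 * d2 * (d1\<^sup>2 + x) * 1 * 1 + 1 * 1 * (2 * d1 * (d2\<^sup>2 + z))) * bridge_kernel (t - s) (u - t) x z y) \<partial>pos_lborel)"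
      using nn_wilson_moment1[OF pair(1)[of "sqrt z"] pair(2)[of "sqrt x"]]
      unfolding esym_bridge d1_def[symmetric] d2_def[symmetric] by simp
  qed (use \<delta> that in \<open>auto simp: F_def nonneg_borel_def\<close>)
  have bridge2: "(LINT \<omega>:E|P. 1 * ((1 + 2 * (d1 + d2)) * (Y t \<omega>)\<^sup>2) * 1 + (d1\<^sup>2 + Y s \<omega>) * 1 * (d2\<^sup>2 + Y u \<omega>))
    = (LINT \<omega>:E|P. ((1 + 2 * d2) * (d1\<^sup>2 + Y s \<omega>)) * Y t \<omega> * 1 + 1 * Y t \<omega> * ((1 + 2 * d1) * (d2\<^sup>2 + Y u \<omega>) + 4 * d1 * d2))"
    if "E \<in> sets F" for E
  proof (rule bridge_set_integral_eqI[OF st, of "\<lambda>_. 1" "\<lambda>x. d1\<^sup>2 + x" "\<lambda>y. (1 + 2 * (d1 + d2)) * y\<^sup>2" "\<lambda>_. 1" "\<lambda>_. 1" "\<lambda>z. d2\<^sup>2 + z"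
        "\<lambda>x. (1 + 2 * d2) * (d1\<^sup>2 + x)" "\<lambda>_. 1" "\<lambda>y. y" "\<lambda>y. y" "\<lambda>_. 1" "\<lambda>z. (1 + 2 * d1) * (d2\<^sup>2 + z) + 4 * d1 * d2"])
    show "integrable P (\<lambda>\<omega>. 1 * ((1 + 2 * (d1 + d2)) * (Y t \<omega>)\<^sup>2) * 1 + (d1\<^sup>2 + Y s \<omega>) * 1 * (d2\<^sup>2 + Y u \<omega>))"
      using int_Yt2 int_XZ by (simp add: X_def Z_def d1_def d2_def)
    show "integrable P (\<lambda>\<omega>. (1 + 2 * d2) * (d1\<^sup>2 + Y s \<omega>) * Y t \<omega> * 1 + 1 * Y t \<omega> * ((1 + 2 * d1) * (d2\<^sup>2 + Y u \<omega>) + 4 * d1 * d2))"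
      using int_RY unfolding R by (simp add: algebra_simps)
    fix x z :: real assume xz: "x > 0" "z > 0"
    let ?w = "bridge_kernel (t - s) (u - t) x z"
    have sq: "(sqrt x)\<^sup>2 = x" "(sqrt z)\<^sup>2 = z"
      using xz by simp_all
    have "(\<integral>\<^sup>+y. ennreal (((1 + 2 * (d1 + d2)) * y\<^sup>2 + (d1\<^sup>2 + x) * (d2\<^sup>2 + z)) * ?w y) \<partial>pos_lborel)
      = (\<integral>\<^sup>+y. ennreal ((d1\<^sup>2 + x + (d2\<^sup>2 + z) + 4 * d1 * d2 + (2 * d2 * (d1\<^sup>2 + x) + 2 * d1 * (d2\<^sup>2 + z))) * y * ?w y) \<partial>pos_lborel)"
      using nn_wilson_moment2[OF pair(1)[of "sqrt z"] pair(2)[of "sqrt x"]]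
      unfolding esym_bridge sq d1_def[symmetric] d2_def[symmetric] .
    moreover have "(d1\<^sup>2 + x + (d2\<^sup>2 + z) + 4 * d1 * d2 + (2 * d2 * (d1\<^sup>2 + x) + 2 * d1 * (d2\<^sup>2 + z))) * y
      = (1 + 2 * d2) * (d1\<^sup>2 + x) * y * 1 + 1 * y * ((1 + 2 * d1) * (d2\<^sup>2 + z) + 4 * d1 * d2)" for y
      by (simp add: algebra_simps)
    ultimately show "(\<integral>\<^sup>+y. ennreal ((1 * ((1 + 2 * (d1 + d2)) * y\<^sup>2) * 1 + (d1\<^sup>2 + x) * 1 * (d2\<^sup>2 + z)) * ?w y) \<partial>pos_lborel)
      = (\<integral>\<^sup>+y. ennreal (((1 + 2 * d2) * (d1\<^sup>2 + x) * y * 1 + 1 * y * ((1 + 2 * d1) * (d2\<^sup>2 + z) + 4 * d1 * d2)) * ?w y) \<partial>pos_lborel)"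
      by simp
  qed (use \<delta> that in \<open>auto simp: F_def nonneg_borel_def\<close>)
  show 1: "AE \<omega> in P. real_cond_exp P F (Y t) \<omega> = W \<omega>"
  proof (rule sub.real_cond_exp_charact[OF _ integrable_Y[OF st(2)] intW W_meas])
    fix E assume E: "E \<in> sets F"
    have "2 * (d1 + d2) * (LINT \<omega>:E|P. Y t \<omega>) = (LINT \<omega>:E|P. 1 * (2 * (d1 + d2) * Y t \<omega>) * 1 + 0 * 0 * 0)"
      by simp
    also note bridge1[OF E]
    also have "(\<lambda>\<omega>. (2 * d2 * (d1\<^sup>2 + Y s \<omega>)) * 1 * 1 + 1 * 1 * (2 * d1 * (d2\<^sup>2 + Y u \<omega>))) = (\<lambda>\<omega>. 2 * (d1 + d2) * W \<omega>)"
    proof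
      fix \<omega>
      have "d1 + d2 \<noteq> 0"
        using \<delta> by simp
      then show "2 * d2 * (d1\<^sup>2 + Y s \<omega>) * 1 * 1 + 1 * 1 * (2 * d1 * (d2\<^sup>2 + Y u \<omega>)) = 2 * (d1 + d2) * W \<omega>"
        unfolding W_def X_def Z_def \<delta>(3) d1_def[symmetric] d2_def[symmetric]
        by (simp add: eq_divide_eq) (simp add: algebra_simps)
    qed
    finally have "2 * (d1 + d2) * (LINT \<omega>:E|P. Y t \<omega>) = 2 * (d1 + d2) * (LINT \<omega>:E|P. W \<omega>)"
      by simp
    then show "(LINT \<omega>:E|P. Y t \<omega>) = (LINT \<omega>:E|P. W \<omega>)"
      using \<delta> by simp
  qed
  have "AE \<omega> in P. real_cond_exp P F (\<lambda>\<omega>. (Y t \<omega>)\<^sup>2) \<omega> = (R \<omega> * W \<omega> - X \<omega> * Z \<omega>) / (1 + 2 * (d1 + d2))"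
  proof (rule sub.real_cond_exp_charact[OF _ int_Yt2])
    show "integrable P (\<lambda>\<omega>. (R \<omega> * W \<omega> - X \<omega> * Z \<omega>) / (1 + 2 * (d1 + d2)))"
      using int_RW int_XZ by simp
    show "(\<lambda>\<omega>. (R \<omega> * W \<omega> - X \<omega> * Z \<omega>) / (1 + 2 * (d1 + d2))) \<in> borel_measurable F"
      unfolding X_def Z_def by measurable
    fix E assume E: "E \<in> sets F"
    have EP [measurable]: "E \<in> sets P"
      using E subalg by (auto simp: subalgebra_def)
    have si: "set_integrable P E f" if "integrable P f" for f :: "'a \<Rightarrow> real"
      unfolding set_integrable_def using integrable_mult_indicator[OF EP that] .
    have ER [measurable]: "(\<lambda>\<omega>. indicator E \<omega> * R \<omega>) \<in> borel_measurable F"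
      using E by measurable
    have "(LINT \<omega>:E|P. R \<omega> * Y t \<omega>) = (\<integral>\<omega>. (indicator E \<omega> * R \<omega>) * Y t \<omega> \<partial>P)"
      by (simp add: set_lebesgue_integral_def mult.assoc)
    also have "\<dots> = (\<integral>\<omega>. (indicator E \<omega> * R \<omega>) * real_cond_exp P F (Y t) \<omega> \<partial>P)"
      using si[OF int_RY] by (intro sub.real_cond_exp_intg(2)[symmetric] ER)
        (simp_all add: set_integrable_def mult.assoc)
    also have "\<dots> = (\<integral>\<omega>. (indicator E \<omega> * R \<omega>) * W \<omega> \<partial>P)"
    proof (rule integral_cong_AE)
      have [measurable]: "R \<in> borel_measurable P" "W \<in> borel_measurable P"
        using measurable_from_subalg[OF subalg] R_meas W_meas by blast+
      show "(\<lambda>\<omega>. indicator E \<omega> * R \<omega> * real_cond_exp P F (Y t) \<omega>) \<in> borel_measurable P"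
        "(\<lambda>\<omega>. indicator E \<omega> * R \<omega> * W \<omega>) \<in> borel_measurable P"
        by measurable
    qed (use 1 in \<open>auto elim!: eventually_mono\<close>)
    also have "\<dots> = (LINT \<omega>:E|P. R \<omega> * W \<omega>)"
      by (simp add: set_lebesgue_integral_def mult.assoc)
    finally have RW: "(LINT \<omega>:E|P. R \<omega> * Y t \<omega>) = (LINT \<omega>:E|P. R \<omega> * W \<omega>)" .
    have "(1 + 2 * (d1 + d2)) * (LINT \<omega>:E|P. (Y t \<omega>)\<^sup>2) + (LINT \<omega>:E|P. X \<omega> * Z \<omega>)
      = (LINT \<omega>:E|P. (1 + 2 * (d1 + d2)) * (Y t \<omega>)\<^sup>2 + X \<omega> * Z \<omega>)"
      using int_Yt2 int_XZ by (subst set_integral_add(2)) (auto intro!: si)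
    also have "\<dots> = (LINT \<omega>:E|P. R \<omega> * Y t \<omega>)"
      using bridge2[OF E] by (simp add: R_def X_def Z_def algebra_simps flip: d1_def d2_def)
    finally have "(1 + 2 * (d1 + d2)) * (LINT \<omega>:E|P. (Y t \<omega>)\<^sup>2) = (LINT \<omega>:E|P. R \<omega> * W \<omega>) - (LINT \<omega>:E|P. X \<omega> * Z \<omega>)"
      using RW by simp
    also have "\<dots> = (LINT \<omega>:E|P. R \<omega> * W \<omega> - X \<omega> * Z \<omega>)"
      using int_RW int_XZ by (intro set_integral_diff(2)[symmetric] si)
    finally show "(LINT \<omega>:E|P. (Y t \<omega>)\<^sup>2) = (LINT \<omega>:E|P. (R \<omega> * W \<omega> - X \<omega> * Z \<omega>) / (1 + 2 * (d1 + d2)))"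
      using \<delta> by (simp add: field_simps)
  qed
  then show "AE \<omega> in P. real_cond_exp P F (\<lambda>\<omega>. (Y t \<omega>)\<^sup>2) \<omega>
      = (((1 + 2 * (u - t)) * X \<omega> + (1 + 2 * (t - s)) * Z \<omega> + 4 * (t - s) * (u - t)) * W \<omega> - X \<omega> * Z \<omega>) / (1 + 2 * (u - s))"
    by (simp add: R_def \<delta>(3) flip: d1_def d2_def)
qed

end

section \<open>The change of time\<close>

text \<open>A Wilson law has as variance the product of the six pairwise parameter sums divided by
  e1^2 (1 + e1). Shifting A, B by -r and C, D by r changes only the sums inside the two pairs, which
  are \<alpha>' and \<beta>'; the rest is the constant \<open>M2\<close>.\<close>

lemma wilson_variance_identity:
  fixes \<alpha> \<beta> q p r E1 E2 M2 :: real
  assumes N: "\<alpha> + \<beta> > 0"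
    and M2: "M2 * (\<alpha> + \<beta>)\<^sup>2 * (\<alpha> + \<beta> + 1) = (\<alpha> + \<beta>) * (q * \<beta> + \<alpha> * p) + (q - p)\<^sup>2"
  defines "q' \<equiv> q - r * \<alpha> + r\<^sup>2" and "p' \<equiv> p + r * \<beta> + r\<^sup>2"
    and "\<alpha>' \<equiv> \<alpha> - 2 * r" and "\<beta>' \<equiv> \<beta> + 2 * r"
  assumes E1: "(\<alpha> + \<beta>) * E1 = q' * \<beta>' + \<alpha>' * p'"
    and E2: "(1 + (\<alpha> + \<beta>)) * E2 + q' * p' = (q' + p' + \<alpha>' * \<beta>' + (q' * \<beta>' + \<alpha>' * p')) * E1"
  shows "E2 - E1\<^sup>2 = M2 * \<alpha>' * \<beta>'"
proof -
  define N where "N = \<alpha> + \<beta>"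
  define e3 where "e3 = q' * \<beta>' + \<alpha>' * p'"
  have NN: "N = \<alpha>' + \<beta>'"
    by (simp add: N_def \<alpha>'_def \<beta>'_def)
  \<comment> \<open>For \<alpha> = A + B, \<beta> = C + D, q = A B, p = C D both sides are the
    product of A + C, B + C, A + D and B + D, in which r cancels.\<close>
  have inv: "N * e3 + (q' - p')\<^sup>2 = N * (q * \<beta> + \<alpha> * p) + (q - p)\<^sup>2"
    unfolding N_def e3_def q'_def p'_def \<alpha>'_def \<beta>'_def by algebra
  have E1': "N * E1 = e3"
    using E1 by (simp add: N_def e3_def)
  have E2': "(1 + N) * E2 + q' * p' = (q' + p' + \<alpha>' * \<beta>' + e3) * E1"
    using E2 by (simp add: N_def e3_def)
  have "N\<^sup>2 * (N + 1) * (E2 - E1\<^sup>2) = N\<^sup>2 * ((1 + N) * E2) - (N + 1) * (N * E1)\<^sup>2"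
    by algebra
  also have "\<dots> = N * (q' + p' + \<alpha>' * \<beta>' + e3) * (N * E1) - N\<^sup>2 * (q' * p') - (N + 1) * (N * E1)\<^sup>2"
    using E2' by algebra
  also have "\<dots> = N * (q' + p' + \<alpha>' * \<beta>') * e3 - N\<^sup>2 * (q' * p') - e3\<^sup>2"
    unfolding E1' by algebra
  also have "\<dots> = \<alpha>' * \<beta>' * (N * e3 + (q' - p')\<^sup>2)"
    unfolding e3_def NN by algebra
  also have "\<dots> = N\<^sup>2 * (N + 1) * (M2 * \<alpha>' * \<beta>')"
    unfolding inv using M2 unfolding N_def[symmetric] by algebra
  finally have "N\<^sup>2 * (N + 1) * (E2 - E1\<^sup>2) = N\<^sup>2 * (N + 1) * (M2 * \<alpha>' * \<beta>')" .
  moreover have "N\<^sup>2 * (N + 1) \<noteq> 0"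
    using N by (simp add: N_def)
  ultimately show ?thesis
    by simp
qed

text \<open>Here r is a time of Y, half the time of the shifted process. \<open>w r\<close> is the
  corresponding harness time, \<open>c r\<close> is the value of m there, and \<open>\<mu> r\<close>
  will be the mean of \<open>Y r\<close>. The summand t^2 / 4 of the shifted process compensates the
  term -r^2 in this mean.\<close>

context
  fixes \<alpha> \<beta> M \<kappa>0 \<kappa>1 :: real and w c \<mu> :: "real \<Rightarrow> real"
  assumes M: "M > 0"
  defines "w \<equiv> \<lambda>r. (2 * r + \<beta>) / (\<alpha> - 2 * r)"
    and "c \<equiv> \<lambda>r. 1 / (M * (\<alpha> - 2 * r))"
    and "\<mu> \<equiv> \<lambda>r. \<kappa>0 + 2 * r * \<kappa>1 - r\<^sup>2"
begin

lemma time_diff: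
  assumes "\<alpha> - 2 * r \<noteq> 0" "\<alpha> - 2 * r' \<noteq> 0"
  shows "w r' - w r = 2 * (\<alpha> + \<beta>) * (r' - r) / ((\<alpha> - 2 * r) * (\<alpha> - 2 * r'))"
  unfolding w_def using assms by (simp add: diff_frac_eq) (simp add: algebra_simps)

text \<open>A Moebius map carries linear interpolation to linear interpolation once values are
  rescaled by the projective factor \<open>c\<close>; \<open>r1\<close> and \<open>r2\<close> say
  this for the two weights. The means fit because \<mu> plus r^2 is affine in r, while interpolating
  r^2 itself produces exactly the squares in the bridge mean.\<close>

lemma harness_mean_identity:
  assumes a: "\<alpha> - 2 * s > 0" "\<alpha> - 2 * t > 0" "\<alpha> - 2 * u > 0" and N: "\<alpha> + \<beta> > 0" and st: "s < t" "t < u"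
  shows "c t * (((u - t) * ((t - s)\<^sup>2 + x) + (t - s) * ((u - t)\<^sup>2 + z)) / (u - s) - \<mu> t)
    = (w u - w t) / (w u - w s) * (c s * (x - \<mu> s)) + (w t - w s) / (w u - w s) * (c u * (z - \<mu> u))"
proof -
  have pos: "u - s > 0" "u - t > 0" "t - s > 0"
    using st by auto
  have r1: "(w u - w t) / (w u - w s) * c s = c t * (u - t) / (u - s)"
    using a N pos M by (subst (1 2) time_diff) (auto simp: c_def divide_simps)
  have r2: "(w t - w s) / (w u - w s) * c u = c t * (t - s) / (u - s)"
    using a N pos M by (subst (1 2) time_diff) (auto simp: c_def divide_simps)
  have "(w u - w t) / (w u - w s) * (c s * (x - \<mu> s)) + (w t - w s) / (w u - w s) * (c u * (z - \<mu> u))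
    = ((w u - w t) / (w u - w s) * c s) * (x - \<mu> s) + ((w t - w s) / (w u - w s) * c u) * (z - \<mu> u)"
    by (simp only: mult.assoc)
  also have "\<dots> = c t * (((u - t) * (x - \<mu> s) + (t - s) * (z - \<mu> u)) / (u - s))"
    unfolding r1 r2 by (simp add: add_divide_distrib distrib_left)
  also have "((u - t) * (x - \<mu> s) + (t - s) * (z - \<mu> u)) / (u - s)
    = ((u - t) * ((t - s)\<^sup>2 + x) + (t - s) * ((u - t)\<^sup>2 + z)) / (u - s) - \<mu> t"
  proof -
    have "(u - t) * (x - \<mu> s) + (t - s) * (z - \<mu> u)
      = (u - t) * ((t - s)\<^sup>2 + x) + (t - s) * ((u - t)\<^sup>2 + z) - (u - s) * \<mu> t"
      unfolding \<mu>_def by algebra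
    then show ?thesis
      using pos by (simp add: diff_divide_distrib)
  qed
  finally show ?thesis
    by simp
qed

text \<open>The formula with six pairwise sums again: the sums inside the pairs are 2 d1 and 2 d2,
  the four mixed sums h +- i sqrt x +- i sqrt z multiply to h^4 + 2 h^2 (x + z) + (z - x)^2, and
  e1^2 (1 + e1) = 4 h^2 (1 + 2h).\<close>

lemma bridge_variance_identity:
  fixes d1 d2 x z :: real
  assumes "d1 > 0" "d2 > 0"
  defines "h \<equiv> d1 + d2" and "X \<equiv> d1\<^sup>2 + x" and "Z \<equiv> d2\<^sup>2 + z"
  defines "W \<equiv> (d2 * X + d1 * Z) / h"
  shows "(((1 + 2 * d2) * X + (1 + 2 * d1) * Z + 4 * d1 * d2) * W - X * Z) / (1 + 2 * h) - W\<^sup>2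
    = d1 * d2 * (h ^ 4 + 2 * h\<^sup>2 * (x + z) + (z - x)\<^sup>2) / (h\<^sup>2 * (1 + 2 * h))"
proof -
  have h: "h > 0" "1 + 2 * h > 0"
    using assms by auto
  have W: "h * W = d2 * X + d1 * Z"
    using h by (simp add: W_def)
  have "h\<^sup>2 * (((1 + 2 * d2) * X + (1 + 2 * d1) * Z + 4 * d1 * d2) * W - X * Z - (1 + 2 * h) * W\<^sup>2)
    = h * ((1 + 2 * d2) * X + (1 + 2 * d1) * Z + 4 * d1 * d2) * (h * W) - h\<^sup>2 * X * Z - (1 + 2 * h) * (h * W)\<^sup>2"
    by algebra
  also have "\<dots> = d1 * d2 * (h ^ 4 + 2 * h\<^sup>2 * (x + z) + (z - x)\<^sup>2)"
    unfolding W unfolding h_def X_def Z_def by algebra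
  finally have eq: "h\<^sup>2 * (((1 + 2 * d2) * X + (1 + 2 * d1) * Z + 4 * d1 * d2) * W - X * Z - (1 + 2 * h) * W\<^sup>2)
    = d1 * d2 * (h ^ 4 + 2 * h\<^sup>2 * (x + z) + (z - x)\<^sup>2)" .
  have "(((1 + 2 * d2) * X + (1 + 2 * d1) * Z + 4 * d1 * d2) * W - X * Z) / (1 + 2 * h) - W\<^sup>2
    = (((1 + 2 * d2) * X + (1 + 2 * d1) * Z + 4 * d1 * d2) * W - X * Z - (1 + 2 * h) * W\<^sup>2) / (1 + 2 * h)"
    using h by (simp add: diff_divide_distrib)
  also have "\<dots> = h\<^sup>2 * (((1 + 2 * d2) * X + (1 + 2 * d1) * Z + 4 * d1 * d2) * W - X * Z - (1 + 2 * h) * W\<^sup>2) / (h\<^sup>2 * (1 + 2 * h))"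
    using h by simp
  finally show ?thesis
    unfolding eq .
qed

text \<open>Because \<sigma> = \<tau> and 1 - \<gamma> = 2 \<sigma>, the quadratic part of the
  bracket collapses to \<sigma> (b1 - b2)^2, and b1 - b2 = (\<xi> - \<zeta>) / (2 M h). The linear
  part is resolved along b1 + b2 and b1 - b2, which is why \<eta> + \<theta> and \<theta> - \<eta>
  are the natural data.\<close>

lemma harness_variance_identity:
  fixes x z :: real
  assumes a: "\<alpha> - 2 * s > 0" "\<alpha> - 2 * t > 0" "\<alpha> - 2 * u > 0" and N: "\<alpha> + \<beta> > 0" and st: "s < t" "t < u"
    and M2: "M\<^sup>2 * (\<alpha> + \<beta> + 1) = \<kappa>0 + \<kappa>1\<^sup>2"
  defines "\<sigma> \<equiv> 1 / (\<alpha> + \<beta> + 1)" and "\<gamma> \<equiv> (\<alpha> + \<beta> - 1) / (\<alpha> + \<beta> + 1)"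
  assumes sum: "\<eta> + \<theta> = (\<alpha> + \<beta>) / (M * (\<alpha> + \<beta> + 1))"
    and diff: "\<theta> - \<eta> = (\<beta> - \<alpha> + 4 * \<kappa>1) / (M * (\<alpha> + \<beta> + 1))"
  defines "Xs \<equiv> c s * (x - \<mu> s)" and "Xu \<equiv> c u * (z - \<mu> u)"
  defines "W \<equiv> ((u - t) * ((t - s)\<^sup>2 + x) + (t - s) * ((u - t)\<^sup>2 + z)) / (u - s)"
  shows "(c t)\<^sup>2 * ((((1 + 2 * (u - t)) * ((t - s)\<^sup>2 + x) + (1 + 2 * (t - s)) * ((u - t)\<^sup>2 + z) + 4 * (t - s) * (u - t)) * W
       - ((t - s)\<^sup>2 + x) * ((u - t)\<^sup>2 + z)) / (1 + 2 * (u - s)) - W\<^sup>2)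
    = (w u - w t) * (w t - w s) / (w u * (1 + \<sigma> * w s) + \<sigma> - \<gamma> * w s) *
       (1 + \<eta> * ((w u * Xs - w s * Xu) / (w u - w s)) + \<theta> * ((Xu - Xs) / (w u - w s))
         + \<sigma> * ((w u * Xs - w s * Xu)\<^sup>2 / (w u - w s)\<^sup>2) + \<sigma> * ((Xu - Xs)\<^sup>2 / (w u - w s)\<^sup>2)
         - (1 - \<gamma>) * ((Xu - Xs) * (w u * Xs - w s * Xu) / (w u - w s)\<^sup>2))"
proof -
  define N where "N = \<alpha> + \<beta>"
  define h where "h = u - s"
  define d1 where "d1 = t - s"
  define d2 where "d2 = u - t"
  define as where "as = \<alpha> - 2 * s"
  define am where "am = \<alpha> - 2 * t"
  define au where "au = \<alpha> - 2 * u"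
  define \<xi> where "\<xi> = x - \<mu> s"
  define \<zeta> where "\<zeta> = z - \<mu> u"
  \<comment> \<open>\<open>b1\<close> and \<open>b2\<close> are the intercept at time 0 and the
    slope of the line through (w s, Xs) and (w u, Xu); the bracket is a polynomial in these two
    numbers.\<close>
  define b1 where "b1 = (w u * Xs - w s * Xu) / (w u - w s)"
  define b2 where "b2 = (Xu - Xs) / (w u - w s)"
  have pos: "N > 0" "h > 0" "d1 > 0" "d2 > 0" "as > 0" "am > 0" "au > 0"
    using a N st by (simp_all add: N_def h_def d1_def d2_def as_def am_def au_def)
  have h: "h = d1 + d2"
    by (simp add: h_def d1_def d2_def)
  have auh: "au = as - 2 * h"
    by (simp add: au_def as_def h_def)
  have wN: "w s = N / as - 1" "w u = N / au - 1"
    using pos unfolding w_def N_def as_def au_def by (simp_all add: divide_simps)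
  have d: "w u - w s = 2 * N * h / (as * au)" "w u - w t = 2 * N * d2 / (am * au)" "w t - w s = 2 * N * d1 / (as * am)"
    using a unfolding N_def h_def d1_def d2_def as_def am_def au_def by (simp_all add: time_diff)
  have Xs: "Xs = \<xi> / (M * as)" and Xu: "Xu = \<zeta> / (M * au)"
    by (simp_all add: Xs_def Xu_def c_def \<xi>_def \<zeta>_def as_def au_def)
  have b2: "b2 = (as * \<zeta> - au * \<xi>) / (2 * N * M * h)"
    unfolding b2_def d(1) Xs Xu using pos M by (simp add: divide_simps)
  have b1: "b1 = ((N - au) * \<xi> - (N - as) * \<zeta>) / (2 * N * M * h)"
    unfolding b1_def d(1) unfolding Xs Xu wN using pos M by (simp add: divide_simps)
  have bd: "b1 - b2 = (\<xi> - \<zeta>) / (2 * M * h)"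
    unfolding b1 b2 using pos M by (simp add: divide_simps) (simp add: algebra_simps)
  have bs: "b1 + b2 = ((N - 2 * au) * \<xi> - (N - 2 * as) * \<zeta>) / (2 * N * M * h)"
    unfolding b1 b2 by (simp add: add_divide_distrib[symmetric]) (simp add: algebra_simps)
  have \<sigma>\<gamma>: "1 - \<gamma> = 2 * \<sigma>" "\<sigma> = 1 / (N + 1)"
    using pos by (simp_all add: \<sigma>_def \<gamma>_def N_def divide_simps)
  \<comment> \<open>The combination 1 + as - au is 1 + 2h, the factor in the denominator of the
    bridge variance.\<close>
  have den: "w u * (1 + \<sigma> * w s) + \<sigma> - \<gamma> * w s = N\<^sup>2 * (1 + 2 * h) / ((N + 1) * as * au)"
  proof -
    have "\<gamma> = 1 - 2 / (N + 1)"
      using \<sigma>\<gamma> by simp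
    moreover have "(N / au - 1) * (1 + 1 / (N + 1) * (N / as - 1)) + 1 / (N + 1) - (1 - 2 / (N + 1)) * (N / as - 1)
      = N\<^sup>2 * (1 + as - au) / ((N + 1) * as * au)"
      using pos by (simp add: divide_simps) (simp add: algebra_simps power2_eq_square)
    ultimately show ?thesis
      unfolding wN \<sigma>\<gamma>(2) auh by simp
  qed
  have pref: "(w u - w t) * (w t - w s) / (w u * (1 + \<sigma> * w s) + \<sigma> - \<gamma> * w s)
    = 4 * d1 * d2 * (N + 1) / (am\<^sup>2 * (1 + 2 * h))"
    unfolding d den using pos by (simp add: divide_simps power2_eq_square)
  have bracket: "1 + \<eta> * b1 + \<theta> * b2 + \<sigma> * b1\<^sup>2 + \<sigma> * b2\<^sup>2 - (1 - \<gamma>) * (b2 * b1)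
    = (h ^ 4 + 2 * h\<^sup>2 * (x + z) + (z - x)\<^sup>2) / (4 * M\<^sup>2 * h\<^sup>2 * (N + 1))"
  proof -
    have "1 + \<eta> * b1 + \<theta> * b2 + \<sigma> * b1\<^sup>2 + \<sigma> * b2\<^sup>2 - (1 - \<gamma>) * (b2 * b1)
      = 1 + (\<eta> + \<theta>) / 2 * (b1 + b2) - (\<theta> - \<eta>) / 2 * (b1 - b2) + \<sigma> * (b1 - b2)\<^sup>2"
      unfolding \<sigma>\<gamma>(1) by (simp add: field_simps power2_eq_square)
    also have "\<dots> = 1 + ((N - 2 * au) * \<xi> - (N - 2 * as) * \<zeta>) / (4 * M\<^sup>2 * h * (N + 1))
        - (\<beta> - \<alpha> + 4 * \<kappa>1) * (\<xi> - \<zeta>) / (4 * M\<^sup>2 * h * (N + 1)) + (\<xi> - \<zeta>)\<^sup>2 / (4 * M\<^sup>2 * h\<^sup>2 * (N + 1))"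
      unfolding sum diff bs bd \<sigma>\<gamma>(2) N_def[symmetric] using pos M by (simp add: power2_eq_square mult_ac)
    also have "\<dots> = (4 * h\<^sup>2 * (M\<^sup>2 * (N + 1)) + h * ((N - 2 * au) * \<xi> - (N - 2 * as) * \<zeta>)
        - h * ((\<beta> - \<alpha> + 4 * \<kappa>1) * (\<xi> - \<zeta>)) + (\<xi> - \<zeta>)\<^sup>2) / (4 * M\<^sup>2 * h\<^sup>2 * (N + 1))"
      using pos M by (simp add: add_divide_distrib diff_divide_distrib power2_eq_square mult_ac)
    \<comment> \<open>The hypothesis on \<open>M\<close> turns the first summand into a multiple of
      \<open>\<kappa>0 + \<kappa>1\<^sup>2\<close>. It cancels the constants left over when the
      centred values \<xi> and \<zeta> are expanded; the bridge polynomial in x and z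
      survives.\<close>
    also have "4 * h\<^sup>2 * (M\<^sup>2 * (N + 1)) + h * ((N - 2 * au) * \<xi> - (N - 2 * as) * \<zeta>)
        - h * ((\<beta> - \<alpha> + 4 * \<kappa>1) * (\<xi> - \<zeta>)) + (\<xi> - \<zeta>)\<^sup>2
      = h ^ 4 + 2 * h\<^sup>2 * (x + z) + (z - x)\<^sup>2"
      unfolding M2[folded N_def] unfolding \<xi>_def \<zeta>_def \<mu>_def N_def as_def au_def h_def by algebra
    finally show ?thesis .
  qed
  have lhs: "(c t)\<^sup>2 * ((((1 + 2 * (u - t)) * ((t - s)\<^sup>2 + x) + (1 + 2 * (t - s)) * ((u - t)\<^sup>2 + z) + 4 * (t - s) * (u - t)) * W
       - ((t - s)\<^sup>2 + x) * ((u - t)\<^sup>2 + z)) / (1 + 2 * (u - s)) - W\<^sup>2)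
    = 1 / (M * am)\<^sup>2 * (d1 * d2 * (h ^ 4 + 2 * h\<^sup>2 * (x + z) + (z - x)\<^sup>2) / (h\<^sup>2 * (1 + 2 * h)))"
    using bridge_variance_identity[OF pos(3,4), of x z]
    unfolding h[symmetric] W_def c_def am_def[symmetric] d1_def[symmetric] d2_def[symmetric] h_def[symmetric]
    by (simp add: power_divide)
  have sq: "(w u * Xs - w s * Xu)\<^sup>2 / (w u - w s)\<^sup>2 = b1\<^sup>2" "(Xu - Xs)\<^sup>2 / (w u - w s)\<^sup>2 = b2\<^sup>2"
    "(Xu - Xs) * (w u * Xs - w s * Xu) / (w u - w s)\<^sup>2 = b2 * b1"
    by (simp_all add: b1_def b2_def power_divide power2_eq_square)
  show ?thesis
    unfolding lhs pref sq b1_def[symmetric] b2_def[symmetric] bracket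
    using pos M by (simp add: power2_eq_square mult_ac)
qed

end

section \<open>The quadratic harness\<close>

text \<open>Centre at the known conditional mean, expand the square and pull the
  \<open>F\<close>-measurable \<open>W\<close> out of the cross term; the shift \<open>d\<close>
  cancels and \<open>k\<close> comes out squared.\<close>

lemma (in finite_measure_subalgebra) cond_var_affine:
  fixes Z W Q :: "'a \<Rightarrow> real" and k d :: real
  assumes Z: "integrable M Z" "integrable M (\<lambda>x. (Z x)\<^sup>2)"
    and W: "W \<in> borel_measurable F" "integrable M (\<lambda>x. W x * Z x)" "integrable M (\<lambda>x. W x * W x)"
    and cond: "AE x in M. real_cond_exp M F Z x = W x" "AE x in M. real_cond_exp M F (\<lambda>x. (Z x)\<^sup>2) x = Q x"
  shows "AE x in M. real_cond_exp M F (\<lambda>x. k * (Z x + d)) x = k * (W x + d)"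
    and "AE x in M. cond_var M F (\<lambda>x. k * (Z x + d)) x = k\<^sup>2 * (Q x - (W x)\<^sup>2)"
proof -
  have [measurable]: "Z \<in> borel_measurable M" "W \<in> borel_measurable M"
    using Z W measurable_from_subalg[OF subalg] by auto
  have const: "integrable M (\<lambda>_. d)"
    by simp
  have 1: "AE x in M. real_cond_exp M F (\<lambda>x. k * (Z x + d)) x = k * (W x + d)"
    using real_cond_exp_cmult[OF Bochner_Integration.integrable_add[OF Z(1) const], of k]
      real_cond_exp_add[OF Z(1) const] real_cond_exp_F_meas[OF const borel_measurable_const] cond(1)
    by eventually_elim simp
  then show "AE x in M. real_cond_exp M F (\<lambda>x. k * (Z x + d)) x = k * (W x + d)" .
  let ?D = "\<lambda>x. (k * (Z x + d) - real_cond_exp M F (\<lambda>x. k * (Z x + d)) x)\<^sup>2"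
  let ?E = "\<lambda>x. k\<^sup>2 * ((Z x)\<^sup>2 + (- 2 * W x) * Z x + W x * W x)"
  have DE: "AE x in M. ?D x = ?E x"
    using 1 by eventually_elim (simp add: power2_eq_square algebra_simps)
  have int2: "integrable M (\<lambda>x. (- 2 * W x) * Z x)"
    using W(2) by (simp add: mult.assoc)
  have m2: "AE x in M. real_cond_exp M F (\<lambda>x. (- 2 * W x) * Z x) x = (- 2 * W x) * real_cond_exp M F Z x"
    using W(1) int2 by (intro real_cond_exp_mult) auto
  have m3: "AE x in M. real_cond_exp M F (\<lambda>x. W x * W x) x = W x * W x"
    using W(1,3) by (intro real_cond_exp_F_meas) auto
  have a1: "AE x in M. real_cond_exp M F (\<lambda>x. (Z x)\<^sup>2 + (- 2 * W x) * Z x) x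
    = real_cond_exp M F (\<lambda>x. (Z x)\<^sup>2) x + real_cond_exp M F (\<lambda>x. (- 2 * W x) * Z x) x"
    by (rule real_cond_exp_add[OF Z(2) int2])
  have a2: "AE x in M. real_cond_exp M F (\<lambda>x. (Z x)\<^sup>2 + (- 2 * W x) * Z x + W x * W x) x
    = real_cond_exp M F (\<lambda>x. (Z x)\<^sup>2 + (- 2 * W x) * Z x) x + real_cond_exp M F (\<lambda>x. W x * W x) x"
    by (rule real_cond_exp_add[OF Bochner_Integration.integrable_add[OF Z(2) int2] W(3)])
  have a3: "AE x in M. real_cond_exp M F ?E x
    = k\<^sup>2 * real_cond_exp M F (\<lambda>x. (Z x)\<^sup>2 + (- 2 * W x) * Z x + W x * W x) x"
    by (rule real_cond_exp_cmult[OF Bochner_Integration.integrable_add[OF Bochner_Integration.integrable_add[OF Z(2) int2] W(3)]])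
  have c: "AE x in M. real_cond_exp M F ?D x = real_cond_exp M F ?E x"
    by (rule real_cond_exp_cong[OF DE]) measurable
  show "AE x in M. cond_var M F (\<lambda>x. k * (Z x + d)) x = k\<^sup>2 * (Q x - (W x)\<^sup>2)"
    unfolding cond_var_def using c a3 a2 a1 m2 m3 cond
  proof eventually_elim
    case (elim x)
    then show ?case
      by (simp add: power2_eq_square)
  qed
qed

text \<open>At each time the two processes differ by an invertible affine map, so preimages of Borel
  sets correspond; the time map only relabels the indices.\<close>

lemma generated_field_affine:
  fixes X :: "real \<Rightarrow> 'a \<Rightarrow> real"
  assumes X: "\<And>r \<omega>. r \<in> R \<Longrightarrow> \<omega> \<in> space P \<Longrightarrow> X (w r) \<omega> = k r * (Y r \<omega> + d r)"
    and k: "\<And>r. r \<in> R \<Longrightarrow> k r \<noteq> 0"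
    and pos: "\<And>r \<omega>. r \<in> R \<Longrightarrow> \<omega> \<in> space P \<Longrightarrow> Y r \<omega> > 0"
  shows "generated_field P borel X (w ` R) = generated_field P pos_lborel Y R"
proof -
  have pos_sets: "B \<in> sets pos_lborel \<longleftrightarrow> B \<in> sets borel \<and> B \<subseteq> {0<..}" for B :: "real set"
    unfolding sets_pos_lborel by (subst sets_restrict_space_iff) auto
  have "{X v -` B \<inter> space P | v B. v \<in> w ` R \<and> B \<in> sets borel}
      = {Y r -` B \<inter> space P | r B. r \<in> R \<and> B \<in> sets pos_lborel}" (is "?L = ?R")
  proof (intro equalityI subsetI)
    fix S assume "S \<in> ?L"
    then obtain r B where S: "r \<in> R" "B \<in> sets borel" "S = X (w r) -` B \<inter> space P"
      by auto
    \<comment> \<open>Y takes values in the half-line with its trace field, so the preimage is cut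
      down to it; positivity of Y keeps the event unchanged.\<close>
    let ?B = "((\<lambda>y. k r * (y + d r)) -` B \<inter> space borel) \<inter> {0<..}"
    have "(\<lambda>y. k r * (y + d r)) -` B \<inter> space borel \<in> sets borel"
      by (rule measurable_sets[OF _ S(2)]) measurable
    then have "?B \<in> sets pos_lborel"
      unfolding pos_sets by auto
    moreover have "S = Y r -` ?B \<inter> space P"
      using X[OF S(1)] pos[OF S(1)] unfolding S(3) by auto
    ultimately show "S \<in> ?R"
      using S(1) by blast
  next
    fix S assume "S \<in> ?R"
    then obtain r B where S: "r \<in> R" "B \<in> sets pos_lborel" "S = Y r -` B \<inter> space P"
      by auto
    let ?B = "(\<lambda>x. x / k r - d r) -` B \<inter> space borel"
    have "?B \<in> sets borel"
      using S(2) unfolding pos_sets by (intro measurable_sets[of _ borel borel]) auto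
    moreover have "S = X (w r) -` ?B \<inter> space P"
      using X[OF S(1)] k[OF S(1)] unfolding S(3) by auto
    ultimately show "S \<in> ?L"
      using S(1) by blast
  qed
  then show ?thesis
    by (simp add: generated_field_def)
qed

context wilson_bridge
begin

lemma esym_time:
  fixes r :: real
  defines "q \<equiv> Re (A * B) - r * Re (A + B) + r\<^sup>2" and "p \<equiv> Re (C * D) + r * Re (C + D) + r\<^sup>2"
  shows "e1 r = Re (A + B) + Re (C + D)"
    "e2 r = q + p + (Re (A + B) - 2 * r) * (Re (C + D) + 2 * r)"
    "e3 r = q * (Re (C + D) + 2 * r) + (Re (A + B) - 2 * r) * p"
    "e4 r = q * p"
proof -
  have "Re ((A - of_real r) * (B - of_real r)) = q" "Re ((C + of_real r) * (D + of_real r)) = p"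
    by (simp_all add: q_def p_def power2_eq_square algebra_simps)
  moreover have "Re (A - of_real r + (B - of_real r)) = Re (A + B) - 2 * r"
    "Re (C + of_real r + (D + of_real r)) = Re (C + D) + 2 * r"
    by simp_all
  ultimately show "e1 r = Re (A + B) + Re (C + D)"
    "e2 r = q + p + (Re (A + B) - 2 * r) * (Re (C + D) + 2 * r)"
    "e3 r = q * (Re (C + D) + 2 * r) + (Re (A + B) - 2 * r) * p"
    "e4 r = q * p"
    unfolding esym1_def esym2_def esym3_def esym4_def by simp_all
qed

text \<open>The theorem in purely real form. \<open>\<kappa>0\<close> is the mean of
  \<open>Y 0\<close>, and \<open>2 * \<kappa>1\<close> is the slope of the affine function obtained
  by adding r^2 to the mean of \<open>Y r\<close>; both are read off from e3 / e1.\<close>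

lemma quadratic_harness_affine:
  fixes M :: real and X :: "real \<Rightarrow> 'a \<Rightarrow> real"
  defines "\<alpha> \<equiv> Re (A + B)" and "\<beta> \<equiv> Re (C + D)"
  defines "\<kappa>0 \<equiv> (Re (A * B) * \<beta> + \<alpha> * Re (C * D)) / (\<alpha> + \<beta>)"
    and "\<kappa>1 \<equiv> (Re (A * B) - Re (C * D)) / (\<alpha> + \<beta>)"
  defines "w \<equiv> \<lambda>r. (2 * r + \<beta>) / (\<alpha> - 2 * r)" and "c \<equiv> \<lambda>r. 1 / (M * (\<alpha> - 2 * r))"
  assumes M: "M > 0" "M\<^sup>2 * (\<alpha> + \<beta> + 1) = \<kappa>0 + \<kappa>1\<^sup>2"
    and X: "\<And>r \<omega>. r \<in> T \<Longrightarrow> X (w r) \<omega> = c r * (Y r \<omega> - expectation (Y r))"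
    and sum: "\<eta> + \<theta> = (\<alpha> + \<beta>) / (M * (\<alpha> + \<beta> + 1))"
    and diff: "\<theta> - \<eta> = (\<beta> - \<alpha> + 4 * \<kappa>1) / (M * (\<alpha> + \<beta> + 1))"
  shows "quadratic_harness P (w ` T) X \<eta> \<theta> (1 / (\<alpha> + \<beta> + 1)) (1 / (\<alpha> + \<beta> + 1)) ((\<alpha> + \<beta> - 1) / (\<alpha> + \<beta> + 1))"
proof -
  define \<mu> where "\<mu> r = \<kappa>0 + 2 * r * \<kappa>1 - r\<^sup>2" for r
  have ab: "\<alpha> - 2 * r > 0" "\<beta> + 2 * r > 0" if "r \<in> T" for r
    using pair_AB[OF that] pair_CD[OF that] by (simp_all add: conj_pair_def \<alpha>_def \<beta>_def)
  have "0 \<in> T"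
    using AB CD by (simp add: T_def conj_pair_def)
  then have N: "\<alpha> + \<beta> > 0"
    using ab[of 0] by simp
  have c: "c r > 0" if "r \<in> T" for r
    using ab[OF that] M(1) by (simp add: c_def)
  have k: "(\<alpha> + \<beta>) * \<kappa>0 = Re (A * B) * \<beta> + \<alpha> * Re (C * D)" "(\<alpha> + \<beta>) * \<kappa>1 = Re (A * B) - Re (C * D)"
    using N by (simp_all add: \<kappa>0_def \<kappa>1_def del: times_complex.sel)
  have EY: "expectation (Y r) = \<mu> r" if r: "r \<in> T" for r
  proof -
    have "(\<alpha> + \<beta>) * expectation (Y r) = (\<alpha> + \<beta>) * \<mu> r"
    proof -
      have "(\<alpha> + \<beta>) * \<mu> r = (\<alpha> + \<beta>) * \<kappa>0 + 2 * r * ((\<alpha> + \<beta>) * \<kappa>1) - (\<alpha> + \<beta>) * r\<^sup>2"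
        by (simp add: \<mu>_def algebra_simps)
      also have "\<dots> = (Re (A * B) - r * \<alpha> + r\<^sup>2) * (\<beta> + 2 * r) + (\<alpha> - 2 * r) * (Re (C * D) + r * \<beta> + r\<^sup>2)"
        unfolding k by algebra
      also have "\<dots> = (\<alpha> + \<beta>) * expectation (Y r)"
        using expectation_Y[OF r] unfolding esym_time \<alpha>_def[symmetric] \<beta>_def[symmetric] by simp
      finally show ?thesis ..
    qed
    then show ?thesis
      using N by auto
  qed
  have var: "expectation (\<lambda>\<omega>. Y r \<omega> ^ 2) - (\<mu> r)\<^sup>2 = M\<^sup>2 * (\<alpha> - 2 * r) * (\<beta> + 2 * r)" if r: "r \<in> T" for r
  proof -
    have "M\<^sup>2 * (\<alpha> + \<beta>)\<^sup>2 * (\<alpha> + \<beta> + 1) = (\<alpha> + \<beta>)\<^sup>2 * (\<kappa>0 + \<kappa>1\<^sup>2)"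
      unfolding M(2)[symmetric] by simp
    also have "\<dots> = (\<alpha> + \<beta>) * (Re (A * B) * \<beta> + \<alpha> * Re (C * D)) + (Re (A * B) - Re (C * D))\<^sup>2"
      unfolding k[symmetric] by algebra
    finally have M2: "M\<^sup>2 * (\<alpha> + \<beta>)\<^sup>2 * (\<alpha> + \<beta> + 1)
      = (\<alpha> + \<beta>) * (Re (A * B) * \<beta> + \<alpha> * Re (C * D)) + (Re (A * B) - Re (C * D))\<^sup>2" .
    show ?thesis
      using wilson_variance_identity[OF N M2, of "\<mu> r" r "expectation (\<lambda>\<omega>. Y r \<omega> ^ 2)"]
        expectation_Y[OF r] expectation_Y_square[OF r]
      unfolding esym_time \<alpha>_def[symmetric] \<beta>_def[symmetric] EY[OF r] by blast
  qed
  \<comment> \<open>The regression of \<open>Y t\<close> on \<open>Y s\<close> has slope (\<alpha> -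
    2t) / (\<alpha> - 2s), so the covariance is that multiple of the variance at s.\<close>
  have cov: "expectation (\<lambda>\<omega>. Y s \<omega> * Y t \<omega>) - \<mu> s * \<mu> t = M\<^sup>2 * (\<alpha> - 2 * t) * (\<beta> + 2 * s)"
    if st: "s \<in> T" "t \<in> T" "s \<le> t" for s t
  proof (cases "s = t")
    case True
    then show ?thesis
      using var[OF st(1)] by (simp add: power2_eq_square)
  next
    case False
    define Q where "Q = Re (A * B) - t * \<alpha> + t\<^sup>2"
    have QA: "Re ((A - of_real t) * (B - of_real t)) = Q"
      by (simp add: Q_def \<alpha>_def power2_eq_square algebra_simps)
    have "(\<alpha> - 2 * s) * expectation (\<lambda>\<omega>. Y s \<omega> * Y t \<omega>)
      = expectation (\<lambda>\<omega>. Y s \<omega> * (Q * (2 * (t - s)) + (\<alpha> - 2 * t) * ((t - s)\<^sup>2 + Y s \<omega>)))"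
      using expectation_Y_Y[OF st(1,2)] False st unfolding \<alpha>_def[symmetric] QA by simp
    also have "\<dots> = expectation (\<lambda>\<omega>. (Q * (2 * (t - s)) + (\<alpha> - 2 * t) * (t - s)\<^sup>2) * Y s \<omega> + (\<alpha> - 2 * t) * (Y s \<omega>)\<^sup>2)"
      by (simp add: algebra_simps power2_eq_square)
    also have "\<dots> = (Q * (2 * (t - s)) + (\<alpha> - 2 * t) * (t - s)\<^sup>2) * \<mu> s + (\<alpha> - 2 * t) * expectation (\<lambda>\<omega>. (Y s \<omega>)\<^sup>2)"
      using integrable_Y[OF st(1)] integrable_Y_power[OF st(1), of 2] EY[OF st(1)] by simp
    finally have e: "(\<alpha> - 2 * s) * expectation (\<lambda>\<omega>. Y s \<omega> * Y t \<omega>)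
      = (Q * (2 * (t - s)) + (\<alpha> - 2 * t) * (t - s)\<^sup>2) * \<mu> s + (\<alpha> - 2 * t) * expectation (\<lambda>\<omega>. (Y s \<omega>)\<^sup>2)" .
    have "\<kappa>0 = Re (A * B) - \<alpha> * \<kappa>1"
    proof -
      have "(\<alpha> + \<beta>) * \<kappa>0 = (\<alpha> + \<beta>) * (Re (A * B) - \<alpha> * \<kappa>1)"
        using k by algebra
      then show ?thesis
        using N by simp
    qed
    \<comment> \<open>The regression line passes through the pair of means.\<close>
    then have lin: "Q * (2 * (t - s)) + (\<alpha> - 2 * t) * (t - s)\<^sup>2 + (\<alpha> - 2 * t) * \<mu> s = (\<alpha> - 2 * s) * \<mu> t"
      unfolding \<mu>_def Q_def by algebra
    have "(\<alpha> - 2 * s) * (expectation (\<lambda>\<omega>. Y s \<omega> * Y t \<omega>) - \<mu> s * \<mu> t)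
      = (\<alpha> - 2 * t) * (expectation (\<lambda>\<omega>. (Y s \<omega>)\<^sup>2) - (\<mu> s)\<^sup>2)"
      using e lin by algebra
    also have "\<dots> = (\<alpha> - 2 * s) * (M\<^sup>2 * (\<alpha> - 2 * t) * (\<beta> + 2 * s))"
      unfolding var[OF st(1)] by simp
    finally show ?thesis
      using ab(1)[OF st(1)] by simp
  qed
  have w_diff: "w r' - w r = 2 * (\<alpha> + \<beta>) * (r' - r) / ((\<alpha> - 2 * r) * (\<alpha> - 2 * r'))" if "r \<in> T" "r' \<in> T" for r r'
    unfolding w_def using ab(1)[OF that(1)] ab(1)[OF that(2)] by (intro time_diff[OF M(1)]) auto
  have w_less: "w r < w r' \<longleftrightarrow> r < r'" if "r \<in> T" "r' \<in> T" for r r'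
  proof -
    define K where "K = 2 * (\<alpha> + \<beta>) / ((\<alpha> - 2 * r) * (\<alpha> - 2 * r'))"
    have "K > 0"
      unfolding K_def using ab(1)[OF that(1)] ab(1)[OF that(2)] N by (intro divide_pos_pos mult_pos_pos) auto
    moreover have "w r' - w r = K * (r' - r)"
      unfolding w_diff[OF that] K_def by simp
    ultimately have "0 < w r' - w r \<longleftrightarrow> 0 < r' - r"
      by (simp add: zero_less_mult_iff)
    then show ?thesis
      by simp
  qed
  have w_le: "w r \<le> w r' \<longleftrightarrow> r \<le> r'" if "r \<in> T" "r' \<in> T" for r r'
    using w_less[OF that(2,1)] by (simp add: linorder_not_less[symmetric])
  have T: "open T" "is_interval T"
    by (simp_all add: T_def)
  have cont: "continuous_on T w"
    unfolding w_def by (intro continuous_intros) (use ab(1) in force)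
  have "inj_on w T"
    using w_le by (intro inj_onI) (metis order_antisym order_refl)
  then have "open (w ` T)"
    using injective_eq_1d_open_map_UNIV[OF cont T(2)] T(1) by blast
  moreover have "is_interval (w ` T)"
    using T(2) connected_continuous_image[OF cont] by (simp add: is_interval_connected_1)
  moreover have "w ` T \<subseteq> {0<..}"
    using ab by (auto simp: w_def add.commute)
  moreover have "w ` T \<noteq> {}"
    using \<open>0 \<in> T\<close> by auto
  moreover have XM: "X (w r) = (\<lambda>\<omega>. c r * (Y r \<omega> + - \<mu> r))" if "r \<in> T" for r
    using X[OF that] EY[OF that] by auto
  have sq: "integrable P (\<lambda>\<omega>. (X (w r) \<omega>)\<^sup>2)" if "r \<in> T" for r
    unfolding XM[OF that]
    using integrable_Y[OF that] integrable_Y_power[OF that, of 2]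
    by (simp add: power_mult_distrib power2_diff)
  moreover have "X (w r) \<in> borel_measurable P" if "r \<in> T" for r
    unfolding XM[OF that] using measurable_Y_real[OF that] by measurable
  moreover have "expectation (X (w r)) = 0" if "r \<in> T" for r
    unfolding XM[OF that] using integrable_Y[OF that] EY[OF that] by (simp add: prob_space)
  moreover have XX: "expectation (\<lambda>\<omega>. X (w r) \<omega> * X (w r') \<omega>) = w r" if r: "r \<in> T" "r' \<in> T" "r \<le> r'" for r r'
  proof -
    have "expectation (\<lambda>\<omega>. X (w r) \<omega> * X (w r') \<omega>)
      = expectation (\<lambda>\<omega>. c r * c r' * (Y r \<omega> * Y r' \<omega> - \<mu> r' * Y r \<omega> - \<mu> r * Y r' \<omega> + \<mu> r * \<mu> r'))"
      unfolding XM[OF r(1)] XM[OF r(2)] by (simp add: algebra_simps)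
    also have "\<dots> = c r * c r' * (expectation (\<lambda>\<omega>. Y r \<omega> * Y r' \<omega>) - \<mu> r * \<mu> r')"
      using integrable_Y[OF r(1)] integrable_Y[OF r(2)] integrable_Y_mult[OF r(1,2)] EY[OF r(1)] EY[OF r(2)]
      by (simp add: prob_space)
    \<comment> \<open>The scalings cancel M^2 and the factor of the later time r', leaving (\<beta>
      + 2r) / (\<alpha> - 2r), the earlier harness time.\<close>
    also have "\<dots> = w r"
      unfolding cov[OF r] c_def w_def using ab(1)[OF r(1)] ab(1)[OF r(2)] M(1)
      by (simp add: divide_simps power2_eq_square)
    finally show ?thesis .
  qed
  have "expectation (\<lambda>\<omega>. X (w t) \<omega> * X (w s) \<omega>) = min (w t) (w s)" if "s \<in> T" "t \<in> T" for s t
    using XX[OF that] XX[OF that(2,1)] w_le[OF that] w_le[OF that(2,1)]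
    by (cases "s \<le> t") (auto simp: min_def mult.commute)
  moreover have "let F = generated_field P borel X {r\<in>w ` T. r \<le> w s \<or> w u \<le> r} in
      (AE \<omega> in P. real_cond_exp P F (X (w t)) \<omega>
         = (w u - w t) / (w u - w s) * X (w s) \<omega> + (w t - w s) / (w u - w s) * X (w u) \<omega>) \<and>
      (AE \<omega> in P. cond_var P F (X (w t)) \<omega>
         = (w u - w t) * (w t - w s) / (w u * (1 + 1 / (\<alpha> + \<beta> + 1) * w s) + 1 / (\<alpha> + \<beta> + 1) - (\<alpha> + \<beta> - 1) / (\<alpha> + \<beta> + 1) * w s) *
           (1 + \<eta> * ((w u * X (w s) \<omega> - w s * X (w u) \<omega>) / (w u - w s))
              + \<theta> * ((X (w u) \<omega> - X (w s) \<omega>) / (w u - w s))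
              + 1 / (\<alpha> + \<beta> + 1) * ((w u * X (w s) \<omega> - w s * X (w u) \<omega>)\<^sup>2 / (w u - w s)\<^sup>2)
              + 1 / (\<alpha> + \<beta> + 1) * ((X (w u) \<omega> - X (w s) \<omega>)\<^sup>2 / (w u - w s)\<^sup>2)
              - (1 - (\<alpha> + \<beta> - 1) / (\<alpha> + \<beta> + 1)) *
                ((X (w u) \<omega> - X (w s) \<omega>) * (w u * X (w s) \<omega> - w s * X (w u) \<omega>) / (w u - w s)\<^sup>2)))"
    if st: "s \<in> T" "t \<in> T" "u \<in> T" "w s < w t" "w t < w u" for s t u
  proof -
    have less: "s < t" "t < u"
      using st w_less by auto
    define F where "F = generated_field P pos_lborel Y {r\<in>T. r \<le> s \<or> u \<le> r}"
    define R where "R = {r\<in>T. r \<le> s \<or> u \<le> r}"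
    have "{r\<in>w ` T. r \<le> w s \<or> w u \<le> r} = w ` R"
      using w_le st unfolding R_def by auto
    \<comment> \<open>Since \<open>w\<close> preserves the order, past and future of X on the
      harness scale are past and future of Y.\<close>
    then have F: "generated_field P borel X {r\<in>w ` T. r \<le> w s \<or> w u \<le> r} = F"
      using generated_field_affine[of R P X w c Y "\<lambda>r. - \<mu> r"] XM Y_pos c
      by (force simp: F_def R_def)
    have subalg: "subalgebra P F"
      unfolding F_def by (rule subalgebra_generated_field) (auto intro: measurable_Y)
    interpret sub: finite_measure_subalgebra P F
      using subalg by unfold_locales
    define W where "W \<omega> = ((u - t) * ((t - s)\<^sup>2 + Y s \<omega>) + (t - s) * ((u - t)\<^sup>2 + Y u \<omega>)) / (u - s)" for \<omega>
    define Q where "Q \<omega> = (((1 + 2 * (u - t)) * ((t - s)\<^sup>2 + Y s \<omega>) + (1 + 2 * (t - s)) * ((u - t)\<^sup>2 + Y u \<omega>) + 4 * (t - s) * (u - t)) * W \<omega>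
       - ((t - s)\<^sup>2 + Y s \<omega>) * ((u - t)\<^sup>2 + Y u \<omega>)) / (1 + 2 * (u - s))" for \<omega>
    have cond: "AE \<omega> in P. real_cond_exp P F (Y t) \<omega> = W \<omega>" "AE \<omega> in P. real_cond_exp P F (\<lambda>\<omega>. (Y t \<omega>)\<^sup>2) \<omega> = Q \<omega>"
      using cond_exp_bridge[OF st(1-3) less] unfolding F_def W_def Q_def by simp_all
    have W_aff: "W = (\<lambda>\<omega>. ((u - t) * (t - s)\<^sup>2 + (t - s) * (u - t)\<^sup>2) / (u - s) + (u - t) / (u - s) * Y s \<omega> + (t - s) / (u - s) * Y u \<omega>)"
      by (auto simp: W_def add_divide_distrib distrib_left)
    have [measurable]: "Y s \<in> borel_measurable F" "Y u \<in> borel_measurable F"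
      unfolding F_def using st by (auto intro!: measurable_Y_field)
    have W_meas: "W \<in> borel_measurable F"
      unfolding W_aff by measurable
    have W_int: "integrable P (\<lambda>\<omega>. W \<omega> * Y t \<omega>)" "integrable P (\<lambda>\<omega>. W \<omega> * W \<omega>)"
      unfolding W_aff by (rule integrable_affine_mult(1)[OF st(1,3,2)], rule integrable_affine_mult(2)[OF st(1,3,3)])
    note X_cond = sub.cond_var_affine[OF integrable_Y[OF st(2)] integrable_Y_power[OF st(2), of 2] W_meas W_int cond, of "c t" "- \<mu> t"]
    have mean: "c t * (W \<omega> + - \<mu> t) = (w u - w t) / (w u - w s) * X (w s) \<omega> + (w t - w s) / (w u - w s) * X (w u) \<omega>" for \<omega>
      using harness_mean_identity[OF M(1) ab(1)[OF st(1)] ab(1)[OF st(2)] ab(1)[OF st(3)] N less, where x = "Y s \<omega>" and z = "Y u \<omega>" and ?\<kappa>0.0 = \<kappa>0 and ?\<kappa>1.0 = \<kappa>1]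
      unfolding XM[OF st(1)] XM[OF st(3)] unfolding W_def c_def w_def \<mu>_def add_uminus_conv_diff .
    note variance = harness_variance_identity[OF M(1) ab(1)[OF st(1)] ab(1)[OF st(2)] ab(1)[OF st(3)] N less M(2) sum diff]
    show ?thesis
      unfolding F Let_def XM[OF st(2)]
    proof (rule conjI, goal_cases)
      case 1
      show ?case
        using X_cond(1) unfolding mean .
    next
      case 2
      show ?case
        using X_cond(2)
      proof eventually_elim
        case (elim \<omega>)
        then show ?case
          using variance[of "Y s \<omega>" "Y u \<omega>"]
          unfolding XM[OF st(1)] XM[OF st(3)] unfolding Q_def W_def c_def w_def \<mu>_def add_uminus_conv_diff
          by (simp only:)
      qed
    qed
  qed
  ultimately show ?thesis
    unfolding quadratic_harness_def ball_simps using prob_space_axioms by blast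
qed

end

section \<open>Reduction of the theorem to the real form\<close>

theorem corollary2p4:
  fixes A B C D :: complex
    and P :: "'a measure" and Y Yt X :: "real \<Rightarrow> 'a \<Rightarrow> real"
    and M :: real and l m :: "real \<Rightarrow> real" and T' :: "real set"
  assumes "Re A > 0" "Re B > 0" "Re C > 0" "Re D > 0"
    and "(A \<in> \<real> \<and> B \<in> \<real>) \<or> A = cnj B"
    and "(C \<in> \<real> \<and> D \<in> \<real>) \<or> C = cnj D"
    and "Re A \<le> Re B" "Re C \<le> Re D"
    and "wilson_process A B C D P Y"
    and "\<And>t \<omega>. - 2 * Re C < t \<Longrightarrow> t < 2 * Re A \<Longrightarrow> Yt t \<omega> = Y (t / 2) \<omega> + t\<^sup>2 / 4"
    and "M > 0"
    and "complex_of_real (M\<^sup>2) =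
           (A + C) * (B + C) * (A + D) * (B + D) /
           ((A + B + C + D)\<^sup>2 * (A + B + C + D + 1))"
    and "\<And>t. complex_of_real (l t) =
           (complex_of_real t * (A + B) - (C + D)) / (complex_of_real M * (A + B + C + D))"
    and "\<And>t. complex_of_real (m t) =
           (1 + complex_of_real t) / (complex_of_real M * (A + B + C + D))"
    and "T' = {v. \<exists>t\<in>{- 2 * Re C<..<2 * Re A}.
           complex_of_real v = (complex_of_real t + C + D) / (A + B - complex_of_real t)}"
    and "\<And>t \<omega>. t \<in> T' \<Longrightarrow>
           X t \<omega> = m t * (Yt (l t / m t) \<omega> - (\<integral>\<omega>'. Yt (l t / m t) \<omega>' \<partial>P))"
  shows "\<exists>\<eta> \<theta> \<sigma> \<tau> \<gamma> :: real.
           complex_of_real (\<eta> + \<theta>) =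
             (A + B + C + D)\<^sup>2 /
             csqrt ((A + C) * (B + C) * (A + D) * (B + D) * (A + B + C + D + 1)) \<and>
           complex_of_real (\<theta> - \<eta>) =
             ((C - D)\<^sup>2 - (A - B)\<^sup>2) /
             csqrt ((A + C) * (B + C) * (A + D) * (B + D) * (A + B + C + D + 1)) \<and>
           complex_of_real \<sigma> = 1 / (A + B + C + D + 1) \<and>
           \<tau> = \<sigma> \<and>
           \<gamma> = 1 - 2 * sqrt (\<sigma> * \<tau>) \<and>
           complex_of_real \<gamma> = (A + B + C + D - 1) / (A + B + C + D + 1) \<and>
           quadratic_harness P T' X \<eta> \<theta> \<sigma> \<tau> \<gamma>"
proof -
  have AB: "conj_pair A B" and CD: "conj_pair C D"
    using assms(1-6) by (auto simp: conj_pair_def)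
  interpret wilson_bridge A B C D P Y
    using AB CD assms(7-9) by unfold_locales
  define \<alpha> where "\<alpha> = Re (A + B)"
  define \<beta> where "\<beta> = Re (C + D)"
  define q where "q = Re (A * B)"
  define p where "p = Re (C * D)"
  define N where "N = \<alpha> + \<beta>"
  have cplx: "A + B = of_real \<alpha>" "C + D = of_real \<beta>" "A * B = of_real q" "C * D = of_real p"
    using AB CD unfolding \<alpha>_def \<beta>_def q_def p_def by (blast intro: conj_pair_sum conj_pair_mult)+
  have pos: "\<alpha> > 0" "\<beta> > 0" "N > 0"
    using assms(1-4) by (simp_all add: \<alpha>_def \<beta>_def N_def)
  have ab: "\<alpha> - 2 * r > 0" "\<beta> + 2 * r > 0" if "r \<in> T" for r
    using that assms(7,8) by (simp_all add: T_def \<alpha>_def \<beta>_def)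
  have sumN: "A + B + C + D = of_real N"
    using cplx by (simp add: N_def add.assoc)
  define \<kappa>0 where "\<kappa>0 = (q * \<beta> + \<alpha> * p) / N"
  define \<kappa>1 where "\<kappa>1 = (q - p) / N"
  have k: "N * \<kappa>0 = q * \<beta> + \<alpha> * p" "N * \<kappa>1 = q - p"
    using pos by (simp_all add: \<kappa>0_def \<kappa>1_def)
  \<comment> \<open>The product is the resultant of the quadratics with roots A, B and -C, -D, hence
    a polynomial in the sums and products of the two pairs.\<close>
  have prod4: "(A + C) * (B + C) * (A + D) * (B + D) = of_real (N\<^sup>2 * (\<kappa>0 + \<kappa>1\<^sup>2))"
  proof -
    have "(A + C) * (B + C) * (A + D) * (B + D)
      = ((A + B) + (C + D)) * (A * B * (C + D) + (A + B) * (C * D)) + (A * B - C * D)\<^sup>2"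
      by algebra
    also have "\<dots> = of_real (N * (q * \<beta> + \<alpha> * p) + (q - p)\<^sup>2)"
      unfolding cplx by (simp add: N_def)
    also have "N * (q * \<beta> + \<alpha> * p) + (q - p)\<^sup>2 = N\<^sup>2 * (\<kappa>0 + \<kappa>1\<^sup>2)"
      unfolding k[symmetric] by algebra
    finally show ?thesis .
  qed
  have M2: "M\<^sup>2 * (N + 1) = \<kappa>0 + \<kappa>1\<^sup>2"
  proof -
    have "complex_of_real (M\<^sup>2) = of_real (N\<^sup>2 * (\<kappa>0 + \<kappa>1\<^sup>2) / (N\<^sup>2 * (N + 1)))"
      using assms(12) unfolding prod4 sumN by simp
    then have "M\<^sup>2 = N\<^sup>2 * (\<kappa>0 + \<kappa>1\<^sup>2) / (N\<^sup>2 * (N + 1))"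
      by (simp only: of_real_eq_iff)
    also have "\<dots> = (\<kappa>0 + \<kappa>1\<^sup>2) / (N + 1)"
      using pos by simp
    finally show ?thesis
      using pos by simp
  qed
  \<comment> \<open>The radicand is the square of a positive real, so the principal root is that
    real; M > 0 fixes the sign.\<close>
  have root: "csqrt ((A + C) * (B + C) * (A + D) * (B + D) * (A + B + C + D + 1)) = of_real (M * N * (N + 1))"
  proof -
    have "(A + C) * (B + C) * (A + D) * (B + D) * (A + B + C + D + 1) = of_real (N\<^sup>2 * (M\<^sup>2 * (N + 1)) * (N + 1))"
      unfolding prod4 sumN M2 by simp
    also have "N\<^sup>2 * (M\<^sup>2 * (N + 1)) * (N + 1) = (M * N * (N + 1))\<^sup>2"
      by algebra
    finally show ?thesis
      using csqrt_square[of "of_real (M * N * (N + 1))"] assms(11) pos by simp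
  qed
  define S where "S = N / (M * (N + 1))"
  define \<Delta> where "\<Delta> = (\<beta> - \<alpha> + 4 * \<kappa>1) / (M * (N + 1))"
  \<comment> \<open>The prescribed values of \<eta> + \<theta> and \<theta> - \<eta> form a linear
    system; this is its solution.\<close>
  define \<eta> where "\<eta> = (S - \<Delta>) / 2"
  define \<theta> where "\<theta> = (S + \<Delta>) / 2"
  have sum: "\<eta> + \<theta> = S" and diff: "\<theta> - \<eta> = \<Delta>"
    by (simp_all add: \<eta>_def \<theta>_def field_simps)
  define w where "w r = (2 * r + \<beta>) / (\<alpha> - 2 * r)" for r
  have l: "l t = (t * \<alpha> - \<beta>) / (M * N)" and m: "m t = (1 + t) / (M * N)" for t
  proof -
    have "complex_of_real (l t) = of_real ((t * \<alpha> - \<beta>) / (M * N))"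
      using assms(13)[of t] unfolding sumN unfolding cplx by simp
    then show "l t = (t * \<alpha> - \<beta>) / (M * N)"
      by (simp only: of_real_eq_iff)
    have "complex_of_real (m t) = of_real ((1 + t) / (M * N))"
      using assms(14)[of t] unfolding sumN by simp
    then show "m t = (1 + t) / (M * N)"
      by (simp only: of_real_eq_iff)
  qed
  \<comment> \<open>\<open>w r\<close> is the harness time belonging to t = 2r. The quotient of l
    and m inverts this Moebius map, and m supplies the scaling.\<close>
  have w_time: "m (w r) = 1 / (M * (\<alpha> - 2 * r))" "l (w r) / m (w r) = 2 * r" if "r \<in> T" for r
  proof -
    have w1: "1 + w r = N / (\<alpha> - 2 * r)" "w r * \<alpha> - \<beta> = 2 * r * N / (\<alpha> - 2 * r)"
      using ab[OF that] by (simp_all add: w_def N_def field_simps)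
    show "m (w r) = 1 / (M * (\<alpha> - 2 * r))"
      unfolding m w1 using pos by simp
    show "l (w r) / m (w r) = 2 * r"
      unfolding l m w1 using pos ab[OF that] assms(11) by simp
  qed
  have T'_eq: "T' = w ` T"
  proof -
    have time: "complex_of_real v = (of_real t + C + D) / (A + B - of_real t) \<longleftrightarrow> v = w (t / 2)" for v t
    proof -
      have "(of_real t + C + D) / (A + B - of_real t) = complex_of_real (w (t / 2))"
        using cplx(1,2) by (simp add: w_def add.assoc)
      then show ?thesis
        by (simp only: of_real_eq_iff)
    qed
    show ?thesis
    proof (intro equalityI subsetI)
      fix v assume "v \<in> T'"
      then obtain t where "t \<in> {- 2 * Re C<..<2 * Re A}" "v = w (t / 2)"
        unfolding assms(15) time by blast
      then show "v \<in> w ` T"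
        by (auto simp: T_def)
    next
      fix v assume "v \<in> w ` T"
      then obtain r where "r \<in> T" "v = w (2 * r / 2)"
        by auto
      then show "v \<in> T'"
        unfolding assms(15) time by (intro CollectI bexI[of _ "2 * r"]) (auto simp: T_def)
    qed
  qed
  have X: "X (w r) \<omega> = 1 / (M * (\<alpha> - 2 * r)) * (Y r \<omega> - expectation (Y r))" if r: "r \<in> T" for r \<omega>
  proof -
    \<comment> \<open>The summand t^2 / 4 is the constant r^2 here and disappears on
      centring.\<close>
    have Yt: "Yt (2 * r) \<omega>' = Y r \<omega>' + r\<^sup>2" for \<omega>'
      using assms(10)[of "2 * r" \<omega>'] r by (simp add: T_def power_mult_distrib)
    have "X (w r) \<omega> = m (w r) * (Yt (2 * r) \<omega> - (\<integral>\<omega>'. Yt (2 * r) \<omega>' \<partial>P))"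
      using assms(16)[of "w r" \<omega>] r unfolding T'_eq w_time(2)[OF r] by simp
    then show ?thesis
      unfolding Yt w_time(1)[OF r] using integrable_Y[OF r] by (simp add: prob_space)
  qed
  have "quadratic_harness P T' X \<eta> \<theta> (1 / (N + 1)) (1 / (N + 1)) ((N - 1) / (N + 1))"
    using quadratic_harness_affine[OF assms(11), folded \<alpha>_def \<beta>_def q_def p_def, folded N_def, folded \<kappa>0_def \<kappa>1_def,
      OF M2, of X \<eta> \<theta>] X sum diff
    unfolding T'_eq S_def \<Delta>_def w_def by blast
  moreover have "complex_of_real (\<eta> + \<theta>) = (A + B + C + D)\<^sup>2 /
      csqrt ((A + C) * (B + C) * (A + D) * (B + D) * (A + B + C + D + 1))"
  proof -
    have "S = N\<^sup>2 / (M * N * (N + 1))"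
      using pos by (simp add: S_def power2_eq_square)
    then show ?thesis
      unfolding sum root unfolding sumN by simp
  qed
  moreover have "complex_of_real (\<theta> - \<eta>) = ((C - D)\<^sup>2 - (A - B)\<^sup>2) /
      csqrt ((A + C) * (B + C) * (A + D) * (B + D) * (A + B + C + D + 1))"
  proof -
    \<comment> \<open>Passing to sums and products, \<beta>^2 - \<alpha>^2 = N (\<beta> - \<alpha>)
      and 4 (q - p) = 4 N \<kappa>1 exhibit the common factor N.\<close>
    have "(C - D)\<^sup>2 - (A - B)\<^sup>2 = ((C + D)\<^sup>2 - 4 * (C * D)) - ((A + B)\<^sup>2 - 4 * (A * B))"
      by algebra
    also have "\<dots> = of_real ((\<beta>\<^sup>2 - 4 * p) - (\<alpha>\<^sup>2 - 4 * q))"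
      unfolding cplx by simp
    also have "(\<beta>\<^sup>2 - 4 * p) - (\<alpha>\<^sup>2 - 4 * q) = N * (\<beta> - \<alpha> + 4 * \<kappa>1)"
      using k(2) unfolding N_def by algebra
    finally have num: "(C - D)\<^sup>2 - (A - B)\<^sup>2 = of_real (N * (\<beta> - \<alpha> + 4 * \<kappa>1))" .
    have "\<Delta> = N * (\<beta> - \<alpha> + 4 * \<kappa>1) / (M * N * (N + 1))"
      using pos by (simp add: \<Delta>_def)
    then show ?thesis
      unfolding diff root num by (simp only: of_real_divide)
  qed
  moreover have "complex_of_real (1 / (N + 1)) = 1 / (A + B + C + D + 1)"
    unfolding sumN by simp
  moreover have "(N - 1) / (N + 1) = 1 - 2 * sqrt (1 / (N + 1) * (1 / (N + 1)))"
  proof -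
    have "sqrt (1 / (N + 1) * (1 / (N + 1))) = 1 / (N + 1)"
      using pos by (subst real_sqrt_abs2) simp
    then show ?thesis
      using pos by (simp add: field_simps)
  qed
  moreover have "complex_of_real ((N - 1) / (N + 1)) = (A + B + C + D - 1) / (A + B + C + D + 1)"
    unfolding sumN by simp
  ultimately show ?thesis
    by blast
qed

end
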